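(* For any $s\in(0,1)$ there exists a constant $C=C(s)\ge 1$ such that for all $t>0$ and all $x,v\in\mathbb{R}$ the fundamental solution $p_s$ of the fractional Kolmogorov equation satisfies $C^{-1}\,\Psi(t,x,v)\le p_s(t,x,v)\le C\,\Psi(t,x,v)$, where $$\Psi(t,x,v):=\Big(\frac{1}{t^{1+1/s}}\wedge\frac{t^{2+2s}}{\big|(x-\frac{tv}{2},\,tv)\big|^{2+2s}}\Big)\Big(1\wedge\frac{t^{1+2s}}{\big(|x-\frac{tv}{2}|-|\frac{tv}{2}|\big)_+^{2s}}\Big).$$
   Context: The fractional Kolmogorov equation in one spatial dimension is $\partial_t u+v\,\partial_x u+(-\Delta_v)^s u=0$ in $(0,\infty)\times\mathbb{R}\times\mathbb{R}$ with $u(0,\cdot,\cdot)=u_0$ on $\mathbb{R}\times\mathbb{R}$, where $u=u(t,x,v)$ and $(-\Delta_v)^s$ is the fractional Laplacian in $v$, normalized to have Fourier symbol $|\phi|^{2s}$. Its fundamental solution $p_s$ is given, for $t>0$ and $x,v\in\mathbb{R}$, by $$p_s(t,x,v)=\frac{1}{(2\pi)^2}\int_{\mathbb{R}}\int_{\mathbb{R}}e^{i(x\xi+v\phi)}\exp\Big(-\int_0^t|\phi+u\xi|^{2s}\,du\Big)\,d\xi\,d\phi .$$ Notation: $r_+=\max\{r,0\}$, $a\wedge b=\min\{a,b\}$, $|(\cdot,\cdot)|$ is the Euclidean norm on $\mathbb{R}^2$; a quotient with positive numerator and zero denominator is read as $+\infty$. *)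

theory Defs
  imports "HOL-Analysis.Analysis"
begin

definition kolmogorov_kernel :: "real \<Rightarrow> real \<Rightarrow> real \<Rightarrow> real \<Rightarrow> complex" where
  "kolmogorov_kernel s t x v =
     complex_of_real (1 / (2 * pi)\<^sup>2) *
     (LINT \<phi>|lborel. LINT \<xi>|lborel.
        exp (\<i> * complex_of_real (x * \<xi> + v * \<phi>)) *
        complex_of_real (exp (- (LINT u:{0..t}|lborel. \<bar>\<phi> + u * \<xi>\<bar> powr (2 * s)))))"

text \<open>
  The quotients are taken in \<^typ>\<open>ereal\<close>, where a positive number divided by \<open>0\<close> is \<open>\<infinity>\<close>.
  A zero denominator occurs in the first factor when \<open>x = v = 0\<close> and in the second one when
  \<open>\<bar>x - t * v / 2\<bar> \<le> \<bar>t * v / 2\<bar>\<close>. The norm on \<^typ>\<open>real \<times> real\<close> is the Euclidean one.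
\<close>

definition kolmogorov_profile :: "real \<Rightarrow> real \<Rightarrow> real \<Rightarrow> real \<Rightarrow> ereal" where
  "kolmogorov_profile s t x v =
     min (1 / ereal (t powr (1 + 1 / s)))
         (ereal (t powr (2 + 2 * s)) / ereal (norm (x - t * v / 2, t * v) powr (2 + 2 * s))) *
     min 1
         (ereal (t powr (1 + 2 * s)) /
          ereal (max (\<bar>x - t * v / 2\<bar> - \<bar>t * v / 2\<bar>) 0 powr (2 * s)))"

end

theory Submission
  imports Defs "HOL-Probability.Characteristic_Functions"
begin

text \<open>
Write \<open>\<alpha> = 2 * s\<close>. Scaling reduces the statement to \<open>t = 1\<close>, where \<open>p\<^sub>s\<close> is the density of the pair
\<open>(\<integral> u dL\<^sub>u, L\<^sub>1)\<close> for a symmetric \<open>\<alpha>\<close>-stable process \<open>L\<close>. In the coordinates \<open>a = x\<close>, \<open>b = v - x\<close> the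
characteristic exponent is \<open>\<integral> \<bar>u * \<eta> + (1 - u) * \<phi>\<bar> powr \<alpha> du\<close> over \<open>0 \<le> u \<le> 1\<close>. A jump of size \<open>z\<close> at time
\<open>u\<close> moves the pair by \<open>(u * z, (1 - u) * z)\<close>, so the Levy measure has a density proportional to
\<open>\<bar>a + b\<bar> powr (- 2 - \<alpha>)\<close> on the double cone \<open>a * b > 0\<close> and zero elsewhere
(\<open>cone_levy_khintchine\<close>). A far point of the cone is reached by one big jump, which explains the first
factor of the profile. A point outside the cone, at distance \<open>gap\<close> from it, needs a second jump, in the
opposite half of the cone and at least as large as the gap; that jump has probability of order
\<open>gap powr (- \<alpha>)\<close>, which is the second factor.

To make this rigorous without constructing the process, the Levy density is split into a part with
bounded jumps and an integrable part \<open>J\<close> with \<open>\<bar>a + b\<bar> > 1\<close>, of total mass \<open>\<lambda>\<close>. On the Fourier side the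
exponent of the second part is expanded in a power series, and the density becomes
\<open>exp (- \<lambda>) * (\<Sum>n. J\<^sup>*\<^sup>n * g / n!)\<close>, where \<open>g\<close> has the exponent of the bounded jumps
(\<open>compound_poisson_density\<close>).

The function \<open>g\<close> is nonnegative and decays exponentially (\<open>fourier_exp_levy_decay\<close>): it is a limit of
densities of compound Poisson variables with a Gaussian component, and multiplying such a density by
\<open>exp (\<theta> \<bullet> x)\<close> amounts to multiplying the Levy density by \<open>exp (\<theta> \<bullet> y)\<close>, so the tilted function is again
bounded by the integral of its Fourier transform.

With \<open>h = heat_profile \<alpha>\<close>, the upper bound follows from \<open>J * h \<le> C * h\<close>
(\<open>convol_large_jumps_profile_le\<close>), because then the \<open>n\<close>-th term of the series is at most
\<open>A * C ^ n / n! * h\<close>. For the lower bound the single term \<open>n = 2\<close> is enough, at every point of the plane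
(\<open>convol_convol_large_jumps_ge\<close>): first jump away from the target by about \<open>1 + gap\<close> in both coordinates,
against the side of the target; the remaining displacement lies well inside the cone.
\<close>

section \<open>Fourier integrals and convolution powers\<close>

lemma lborel_eq_distr_reflect: "(lborel::'a::euclidean_space measure) = distr lborel borel (\<lambda>y. x - y)"
  using lborel_affine[of "-1" x] by (simp add: density_1)

lemma lborel_integral_reflect:
  fixes f :: "'a::euclidean_space \<Rightarrow> 'b::{banach, second_countable_topology}"
  assumes "f \<in> borel_measurable borel"
  shows "(LINT y|lborel. f (x - y)) = (LINT y|lborel. f y)"
  by (subst (2) lborel_eq_distr_reflect[of x]) (use assms in \<open>simp add: integral_distr\<close>)

lemma lborel_integrable_reflect:
  fixes f :: "'a::euclidean_space \<Rightarrow> 'b::{banach, second_countable_topology}"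
  assumes "integrable lborel f"
  shows "integrable lborel (\<lambda>y. f (x - y))"
  using assms
  by (subst (asm) lborel_eq_distr_reflect[of x]) (use borel_measurable_integrable[OF assms] in \<open>simp add: integrable_distr_eq\<close>)

lemma nn_integral_reflect:
  fixes f :: "'a::euclidean_space \<Rightarrow> ennreal"
  assumes "f \<in> borel_measurable borel"
  shows "(\<integral>\<^sup>+y. f (x - y) \<partial>lborel) = (\<integral>\<^sup>+y. f y \<partial>lborel)"
  by (subst (2) lborel_eq_distr_reflect[of x]) (use assms in \<open>simp add: nn_integral_distr\<close>)

text \<open>
The normalisation constant is left out, and the kernel is \<open>cis\<close> with a plus sign, as in the formula for
\<open>p\<^sub>s\<close>.
\<close>

definition fourier_int :: "('a::euclidean_space \<Rightarrow> complex) \<Rightarrow> 'a \<Rightarrow> complex" where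
  "fourier_int F x = (LINT \<zeta>|lborel. cis (x \<bullet> \<zeta>) * F \<zeta>)"

definition char_int :: "('a::euclidean_space \<Rightarrow> real) \<Rightarrow> 'a \<Rightarrow> complex" where
  "char_int J \<zeta> = (LINT y|lborel. complex_of_real (J y) * cis (- (y \<bullet> \<zeta>)))"

definition convol :: "('a::euclidean_space \<Rightarrow> real) \<Rightarrow> ('a \<Rightarrow> real) \<Rightarrow> 'a \<Rightarrow> real" where
  "convol J f x = (LINT y|lborel. J y * f (x - y))"

lemma cis_borel_measurable [measurable]: "cis \<in> borel_measurable borel"
  by (intro borel_measurable_continuous_onI continuous_intros)

lemma integrable_mult_bounded:
  fixes f g :: "'a \<Rightarrow> 'b::{banach, second_countable_topology, real_normed_algebra}"
  assumes "integrable M f" "g \<in> borel_measurable M" "\<And>x. norm (g x) \<le> B"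
  shows "integrable M (\<lambda>x. g x * f x)" "integrable M (\<lambda>x. f x * g x)"
proof -
  have B: "norm (g x * f x) \<le> norm (B * norm (f x))" "norm (f x * g x) \<le> norm (B * norm (f x))" for x
  proof -
    have "0 \<le> B" using assms(3)[of x] norm_ge_zero order_trans by blast
    have "norm (g x * f x) \<le> norm (g x) * norm (f x)" by (rule norm_mult_ineq)
    also have "\<dots> \<le> B * norm (f x)" by (intro mult_right_mono assms) auto
    finally show "norm (g x * f x) \<le> norm (B * norm (f x))" using \<open>0 \<le> B\<close> by simp
    have "norm (f x * g x) \<le> norm (f x) * norm (g x)" by (rule norm_mult_ineq)
    also have "\<dots> \<le> norm (f x) * B" by (intro mult_left_mono assms) auto
    finally show "norm (f x * g x) \<le> norm (B * norm (f x))" using \<open>0 \<le> B\<close> by (simp add: mult.commute)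
  qed
  have [measurable]: "f \<in> borel_measurable M" using assms(1) by (rule borel_measurable_integrable)
  note assms(2)[measurable]
  have i: "integrable M (\<lambda>x. B * norm (f x))" using assms(1) by simp
  show "integrable M (\<lambda>x. g x * f x)"
    by (rule Bochner_Integration.integrable_bound[OF i]) (use B in auto)
  show "integrable M (\<lambda>x. f x * g x)"
    by (rule Bochner_Integration.integrable_bound[OF i]) (use B in auto)
qed

lemma integrable_cis_mult:
  fixes F :: "'a::euclidean_space \<Rightarrow> complex"
  assumes "integrable lborel F"
  shows "integrable lborel (\<lambda>\<zeta>. cis (x \<bullet> \<zeta>) * F \<zeta>)"
  by (rule integrable_mult_bounded(1)[where B=1]) (use assms in auto)

lemma char_int_borel_measurable [measurable]:
  assumes [measurable]: "J \<in> borel_measurable borel"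
  shows "char_int J \<in> borel_measurable borel"
  unfolding char_int_def[abs_def] by measurable

lemma norm_char_int_le: "norm (char_int J \<zeta>) \<le> (LINT y|lborel. \<bar>J y\<bar>)"
  unfolding char_int_def
  by (rule order_trans[OF integral_norm_bound]) (simp add: norm_mult)

lemma fourier_int_borel_measurable [measurable]:
  assumes [measurable]: "F \<in> borel_measurable borel"
  shows "fourier_int F \<in> borel_measurable borel"
  unfolding fourier_int_def[abs_def] by measurable

text \<open>
Fubini. The representation of \<open>f\<close> is required at every point, not almost everywhere, so that the
conclusion can be iterated and gives pointwise bounds.
\<close>

lemma convol_fourier_int:
  fixes J :: "'a::euclidean_space \<Rightarrow> real" and F :: "'a \<Rightarrow> complex"
  assumes J: "integrable lborel J" and F: "integrable lborel F"
    and f: "\<And>x. complex_of_real (f x) = fourier_int F x"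
  shows "complex_of_real (convol J f x) = fourier_int (\<lambda>\<zeta>. char_int J \<zeta> * F \<zeta>) x"
proof -
  have [measurable]: "J \<in> borel_measurable borel" using borel_measurable_integrable[OF J] by simp
  have [measurable]: "F \<in> borel_measurable borel" using borel_measurable_integrable[OF F] by simp
  let ?k = "\<lambda>y \<zeta>. complex_of_real (J y) * (cis ((x - y) \<bullet> \<zeta>) * F \<zeta>)"
  have I: "integrable (lborel \<Otimes>\<^sub>M lborel) (case_prod ?k)"
  proof (rule lborel_pair.Fubini_integrable)
    show "case_prod ?k \<in> borel_measurable (lborel \<Otimes>\<^sub>M lborel)"
      by measurable
    have "(\<lambda>y. LINT \<zeta>|lborel. norm (case (y, \<zeta>) of (y, \<zeta>) \<Rightarrow> ?k y \<zeta>)) = (\<lambda>y. \<bar>J y\<bar> * (LINT \<zeta>|lborel. norm (F \<zeta>)))"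
      by (simp add: norm_mult)
    then show "integrable lborel (\<lambda>y. LINT \<zeta>|lborel. norm (case (y, \<zeta>) of (y, \<zeta>) \<Rightarrow> ?k y \<zeta>))"
      using J by simp
    show "AE y in lborel. integrable lborel (\<lambda>\<zeta>. case (y, \<zeta>) of (y, \<zeta>) \<Rightarrow> ?k y \<zeta>)"
      using integrable_cis_mult[OF F] by auto
  qed
  have "complex_of_real (convol J f x) = (LINT y|lborel. complex_of_real (J y * f (x - y)))"
    unfolding convol_def by (rule integral_complex_of_real[symmetric])
  also have "\<dots> = (LINT y|lborel. LINT \<zeta>|lborel. ?k y \<zeta>)"
    by (simp add: f fourier_int_def)
  also have "\<dots> = (LINT \<zeta>|lborel. LINT y|lborel. ?k y \<zeta>)"
    by (rule lborel_pair.Fubini_integral[OF I, symmetric])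
  also have "\<dots> = (LINT \<zeta>|lborel. cis (x \<bullet> \<zeta>) * (char_int J \<zeta> * F \<zeta>))"
  proof (rule Bochner_Integration.integral_cong)
    fix \<zeta> :: 'a
    have "?k y \<zeta> = (complex_of_real (J y) * cis (- (y \<bullet> \<zeta>))) * (cis (x \<bullet> \<zeta>) * F \<zeta>)" for y
    proof -
      have "cis ((x - y) \<bullet> \<zeta>) = cis (x \<bullet> \<zeta>) * cis (- (y \<bullet> \<zeta>))"
        by (simp add: cis_mult inner_diff_left)
      then show ?thesis by (simp only: mult_ac)
    qed
    then have "(LINT y|lborel. ?k y \<zeta>)
        = (LINT y|lborel. (complex_of_real (J y) * cis (- (y \<bullet> \<zeta>))) * (cis (x \<bullet> \<zeta>) * F \<zeta>))"
      by presburger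
    also have "\<dots> = char_int J \<zeta> * (cis (x \<bullet> \<zeta>) * F \<zeta>)"
      unfolding char_int_def by (rule integral_mult_left_zero)
    finally show "(LINT y|lborel. ?k y \<zeta>) = cis (x \<bullet> \<zeta>) * (char_int J \<zeta> * F \<zeta>)"
      by (simp only: mult_ac)
  qed simp
  finally show ?thesis unfolding fourier_int_def .
qed

lemma integrable_char_int_mult:
  assumes J: "integrable lborel J" and F: "integrable lborel F"
  shows "integrable lborel (\<lambda>\<zeta>. char_int J \<zeta> * F \<zeta>)"
  by (rule integrable_mult_bounded(1)[OF F])
     (use norm_char_int_le J in \<open>auto dest: borel_measurable_integrable\<close>)

lemma convol_power_fourier_int:
  assumes J: "integrable lborel J" and F: "integrable lborel F"
    and f: "\<And>x. complex_of_real (f x) = fourier_int F x"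
  shows "integrable lborel (\<lambda>\<zeta>. char_int J \<zeta> ^ n * F \<zeta>)
    \<and> (\<forall>x. complex_of_real ((convol J ^^ n) f x) = fourier_int (\<lambda>\<zeta>. char_int J \<zeta> ^ n * F \<zeta>) x)"
proof (induction n)
  case 0
  then show ?case using F f by simp
next
  case (Suc n)
  then show ?case
    using integrable_char_int_mult[OF J, of "\<lambda>\<zeta>. char_int J \<zeta> ^ n * F \<zeta>"]
      convol_fourier_int[OF J, of "\<lambda>\<zeta>. char_int J \<zeta> ^ n * F \<zeta>" "(convol J ^^ n) f"]
    by (simp add: mult.assoc)
qed

text \<open>
The compound Poisson series: the power series of \<open>exp\<close> may be integrated term by term since
\<open>char_int J\<close> is bounded by the mass of \<open>J\<close>.
\<close>

lemma exp_convol_sums: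
  assumes J: "integrable lborel J" and F: "integrable lborel F"
    and f: "\<And>x. complex_of_real (f x) = fourier_int F x"
  shows "(\<lambda>n. complex_of_real ((convol J ^^ n) f x / fact n)) sums
           fourier_int (\<lambda>\<zeta>. exp (char_int J \<zeta>) * F \<zeta>) x"
proof -
  let ?L = "LINT y|lborel. \<bar>J y\<bar>"
  let ?u = "\<lambda>n \<zeta>. cis (x \<bullet> \<zeta>) * (char_int J \<zeta> ^ n * F \<zeta>) / fact n"
  note P = convol_power_fourier_int[OF J F f]
  have int: "integrable lborel (?u n)" for n
    using integrable_cis_mult P by (intro integrable_divide_zero) auto
  have E: "(\<lambda>n. char_int J \<zeta> ^ n / fact n) sums exp (char_int J \<zeta>)" for \<zeta>
    using exp_converges[of "char_int J \<zeta>"] by (simp add: scaleR_conv_of_real divide_inverse mult.commute)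
  have U: "(\<lambda>n. ?u n \<zeta>) sums (cis (x \<bullet> \<zeta>) * (exp (char_int J \<zeta>) * F \<zeta>))" for \<zeta>
    using sums_mult[OF E[of \<zeta>], of "cis (x \<bullet> \<zeta>) * F \<zeta>"] by (simp add: mult_ac)
  have L0: "0 \<le> ?L" by simp
  have R: "(\<lambda>n. ?L ^ n / fact n) sums exp ?L"
    using exp_converges[of ?L] by (simp add: divide_inverse mult.commute)
  have nb: "norm (?u n \<zeta>) \<le> ?L ^ n / fact n * norm (F \<zeta>)" for n \<zeta>
    using norm_char_int_le[of J \<zeta>]
    by (simp add: norm_mult norm_divide norm_power divide_right_mono mult_right_mono power_mono)
  have "(\<lambda>n. integral\<^sup>L lborel (?u n)) sums (LINT \<zeta>|lborel. (\<Sum>n. ?u n \<zeta>))"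
  proof (rule sums_integral[OF int])
    show "AE \<zeta> in lborel. summable (\<lambda>n. norm (?u n \<zeta>))"
    proof (rule AE_I2)
      fix \<zeta>
      show "summable (\<lambda>n. norm (?u n \<zeta>))"
        by (rule summable_comparison_test'[of "\<lambda>n. ?L ^ n / fact n * norm (F \<zeta>)" 0])
           (use R nb summable_mult2[of "\<lambda>n. ?L ^ n / fact n"] in \<open>auto simp: sums_iff simp del: times_divide_eq_left\<close>)
    qed
    show "summable (\<lambda>n. LINT \<zeta>|lborel. norm (?u n \<zeta>))"
    proof (rule summable_comparison_test'[of "\<lambda>n. ?L ^ n / fact n * (LINT \<zeta>|lborel. norm (F \<zeta>))" 0])
      show "summable (\<lambda>n. ?L ^ n / fact n * (LINT \<zeta>|lborel. norm (F \<zeta>)))"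
        using R by (intro summable_mult2) (simp add: sums_iff)
      fix n
      have "(LINT \<zeta>|lborel. norm (?u n \<zeta>)) \<le> (LINT \<zeta>|lborel. ?L ^ n / fact n * norm (F \<zeta>))"
        using F nb by (intro integral_mono integrable_norm int) auto
      then show "norm (LINT \<zeta>|lborel. norm (?u n \<zeta>)) \<le> ?L ^ n / fact n * (LINT \<zeta>|lborel. norm (F \<zeta>))"
        by (simp del: norm_divide)
    qed
  qed
  moreover have "integral\<^sup>L lborel (?u n) = complex_of_real ((convol J ^^ n) f x / fact n)" for n
    using P by (simp add: fourier_int_def)
  moreover have "(LINT \<zeta>|lborel. (\<Sum>n. ?u n \<zeta>)) = fourier_int (\<lambda>\<zeta>. exp (char_int J \<zeta>) * F \<zeta>) x"
    using U by (simp add: fourier_int_def sums_iff)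
  ultimately show ?thesis by simp
qed

section \<open>Kernels with bounded jumps\<close>

text \<open>
A rescaling of the characteristic function of the standard normal law.
\<close>

lemma gaussian_fourier_1d:
  assumes "\<sigma> > 0"
  shows "(LINT w|lborel. cis (x * w) * complex_of_real (exp (- \<sigma> * w\<^sup>2 / 2))) =
           complex_of_real (sqrt (2 * pi / \<sigma>) * exp (- x\<^sup>2 / (2 * \<sigma>)))"
proof -
  let ?c = "sqrt \<sigma>" and ?t = "x / sqrt \<sigma>"
  have c: "?c > 0" "?c * ?c = \<sigma>" using assms by auto
  have "complex_of_real (exp (- (?t\<^sup>2) / 2)) = char std_normal_distribution ?t"
    by (simp add: char_std_normal_distribution)
  also have "\<dots> = (LINT w|lborel. std_normal_density w *\<^sub>R cis (?t * w))"
    unfolding char_def by (subst integral_density) (auto simp: cis_conv_exp)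
  also have "\<dots> = \<bar>?c\<bar> *\<^sub>R (LINT w|lborel. std_normal_density (0 + ?c * w) *\<^sub>R cis (?t * (0 + ?c * w)))"
    by (rule lborel_integral_real_affine) (use c in auto)
  also have "(\<lambda>w. std_normal_density (0 + ?c * w) *\<^sub>R cis (?t * (0 + ?c * w))) =
      (\<lambda>w. complex_of_real (1 / sqrt (2 * pi)) * (cis (x * w) * complex_of_real (exp (- \<sigma> * w\<^sup>2 / 2))))"
    using c by (auto simp: std_normal_density_def scaleR_conv_of_real power_mult_distrib)
  also have "(LINT w|lborel. complex_of_real (1 / sqrt (2 * pi)) * (cis (x * w) * complex_of_real (exp (- \<sigma> * w\<^sup>2 / 2))))
     = complex_of_real (1 / sqrt (2 * pi)) * (LINT w|lborel. (cis (x * w) * complex_of_real (exp (- \<sigma> * w\<^sup>2 / 2))))"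
    by (rule integral_mult_right_zero)
  finally have *: "complex_of_real (exp (- (?t\<^sup>2) / 2)) = complex_of_real (?c / sqrt (2 * pi)) *
     (LINT w|lborel. (cis (x * w) * complex_of_real (exp (- \<sigma> * w\<^sup>2 / 2))))"
    using c by (simp add: scaleR_conv_of_real mult.assoc)
  have t2: "- (?t\<^sup>2) / 2 = - x\<^sup>2 / (2 * \<sigma>)" using assms by (simp add: power_divide)
  have "complex_of_real (sqrt (2 * pi / \<sigma>)) * complex_of_real (?c / sqrt (2 * pi)) = 1"
    using assms by (simp add: real_sqrt_divide flip: of_real_mult)
  then have "(LINT w|lborel. (cis (x * w) * complex_of_real (exp (- \<sigma> * w\<^sup>2 / 2))))
      = complex_of_real (sqrt (2 * pi / \<sigma>)) * complex_of_real (exp (- (?t\<^sup>2) / 2))"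
    unfolding * by (simp only: mult.assoc[symmetric] mult_1_left)
  then show ?thesis unfolding t2 by simp
qed

lemma gaussian_integrable_1d:
  assumes "\<sigma> > 0"
  shows "integrable lborel (\<lambda>w::real. exp (- \<sigma> * w\<^sup>2 / 2))"
proof -
  have s: "1 / sqrt \<sigma> > 0" using assms by simp
  have "(\<lambda>w. exp (- \<sigma> * w\<^sup>2 / 2)) = (\<lambda>w. sqrt (2 * pi * (1 / sqrt \<sigma>)\<^sup>2) * normal_density 0 (1 / sqrt \<sigma>) w)"
    using assms by (auto simp: normal_density_def power_divide)
  then show ?thesis by (simp only:) (intro integrable_mult_right integrable_normal_density[OF s])
qed

definition gaussian :: "real \<Rightarrow> real \<times> real \<Rightarrow> real" where
  "gaussian \<sigma> \<zeta> = exp (- \<sigma> * (norm \<zeta>)\<^sup>2 / 2)"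

lemma gaussian_measurable [measurable]: "gaussian \<sigma> \<in> borel_measurable borel"
  unfolding gaussian_def[abs_def] by measurable

lemma gaussian_prod: "gaussian \<sigma> (a, b) = exp (- \<sigma> * a\<^sup>2 / 2) * exp (- \<sigma> * b\<^sup>2 / 2)"
  unfolding gaussian_def by (simp add: norm_Pair add_divide_distrib[symmetric] distrib_left flip: exp_add)

lemma gaussian_integrable:
  assumes "\<sigma> > 0"
  shows "integrable lborel (gaussian \<sigma>)"
proof -
  have "integrable (lborel \<Otimes>\<^sub>M lborel) (\<lambda>(a,b). exp (- \<sigma> * a\<^sup>2 / 2) * exp (- \<sigma> * b\<^sup>2 / 2))"
    by (rule lborel_pair.Fubini_integrable)
       (use gaussian_integrable_1d[OF assms] in \<open>simp_all add: abs_mult case_prod_beta\<close>)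
  then show ?thesis unfolding lborel_prod
    by (rule arg_cong[of _ _ "integrable lborel", THEN iffD1, rotated])
       (simp add: gaussian_prod fun_eq_iff)
qed

lemma gaussian_fourier:
  assumes "\<sigma> > 0"
  shows "fourier_int (\<lambda>\<zeta>. complex_of_real (gaussian \<sigma> \<zeta>)) x =
           complex_of_real (2 * pi / \<sigma> * exp (- (norm x)\<^sup>2 / (2 * \<sigma>)))"
proof -
  obtain a b where x: "x = (a, b)" by (cases x)
  let ?h = "\<lambda>a w. cis (a * w) * complex_of_real (exp (- \<sigma> * w\<^sup>2 / 2))"
  let ?H = "\<lambda>\<zeta>. cis (x \<bullet> \<zeta>) * complex_of_real (gaussian \<sigma> \<zeta>)"
  have H: "?H (p, q) = ?h a p * ?h b q" for p q
    unfolding x gaussian_prod by (simp add: inner_Pair flip: cis_mult)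
  have "integrable (lborel \<Otimes>\<^sub>M lborel) ?H"
    unfolding lborel_prod by (intro integrable_cis_mult integrable_of_real gaussian_integrable assms)
  from lborel_pair.integral_fst'[OF this]
  have "fourier_int (\<lambda>\<zeta>. complex_of_real (gaussian \<sigma> \<zeta>)) x = (LINT p|lborel. LINT q|lborel. ?H (p, q))"
    unfolding fourier_int_def lborel_prod by simp
  also have "\<dots> = (LINT p|lborel. ?h a p) * (LINT q|lborel. ?h b q)"
    unfolding H by simp
  also have "\<dots> = complex_of_real (2 * pi / \<sigma> * exp (- (norm x)\<^sup>2 / (2 * \<sigma>)))"
  proof -
    have "sqrt (2 * pi / \<sigma>) * exp (- a\<^sup>2 / (2 * \<sigma>)) * (sqrt (2 * pi / \<sigma>) * exp (- b\<^sup>2 / (2 * \<sigma>)))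
      = (sqrt (2 * pi / \<sigma>) * sqrt (2 * pi / \<sigma>)) * (exp (- a\<^sup>2 / (2 * \<sigma>)) * exp (- b\<^sup>2 / (2 * \<sigma>)))"
      by (simp only: mult_ac)
    also have "\<dots> = 2 * pi / \<sigma> * exp (- (norm x)\<^sup>2 / (2 * \<sigma>))"
      using assms by (simp add: x norm_Pair diff_divide_distrib flip: exp_add)
    finally show ?thesis
      unfolding gaussian_fourier_1d[OF assms] by (simp only: of_real_mult[symmetric])
  qed
  finally show ?thesis .
qed

text \<open>
Levy--Khintchine exponent of a symmetric pure jump law with Levy density \<open>J\<close>; finite also for
many \<open>J\<close> that are not integrable at the origin.
\<close>

definition levy_exponent :: "('a::euclidean_space \<Rightarrow> real) \<Rightarrow> 'a \<Rightarrow> real" where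
  "levy_exponent J \<zeta> = (LINT y|lborel. (1 - cos (y \<bullet> \<zeta>)) * J y)"

lemma levy_exponent_measurable [measurable]:
  assumes [measurable]: "J \<in> borel_measurable borel"
  shows "levy_exponent J \<in> borel_measurable borel"
  unfolding levy_exponent_def[abs_def] by measurable

lemma levy_exponent_nonneg: "(\<And>y. J y \<ge> 0) \<Longrightarrow> levy_exponent J \<zeta> \<ge> 0"
  unfolding levy_exponent_def by (intro integral_nonneg_AE) auto

lemma integrable_one_minus_cos_mult:
  assumes "integrable lborel J"
  shows "integrable lborel (\<lambda>y. (1 - cos (y \<bullet> \<zeta>)) * J y :: real)"
proof (rule integrable_mult_bounded(1)[OF assms, where B=2])
  show "norm (1 - cos (y \<bullet> \<zeta>)) \<le> 2" for y
    using cos_ge_minus_one[of "y \<bullet> \<zeta>"] cos_le_one[of "y \<bullet> \<zeta>"] by (simp add: abs_le_iff del: cos_ge_minus_one cos_le_one)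
qed auto

lemma Re_char_int:
  assumes J: "integrable lborel J"
  shows "Re (char_int J \<zeta>) = integral\<^sup>L lborel J - levy_exponent J \<zeta>"
proof -
  have [measurable]: "J \<in> borel_measurable borel" using borel_measurable_integrable[OF J] by simp
  have I: "integrable lborel (\<lambda>y. complex_of_real (J y) * cis (- (y \<bullet> \<zeta>)))"
    by (rule integrable_mult_bounded(2)[where B=1]) (use J in auto)
  have "Re (char_int J \<zeta>) = (LINT y|lborel. Re (complex_of_real (J y) * cis (- (y \<bullet> \<zeta>))))"
    unfolding char_int_def by (rule integral_Re[OF I, symmetric])
  also have "\<dots> = (LINT y|lborel. J y - (1 - cos (y \<bullet> \<zeta>)) * J y)"
    by (intro Bochner_Integration.integral_cong) (auto simp: algebra_simps)
  also have "\<dots> = integral\<^sup>L lborel J - levy_exponent J \<zeta>"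
    unfolding levy_exponent_def by (intro Bochner_Integration.integral_diff J integrable_one_minus_cos_mult)
  finally show ?thesis .
qed

lemma integral_odd_eq_0:
  fixes f :: "'a::euclidean_space \<Rightarrow> real"
  assumes "f \<in> borel_measurable borel" "\<And>y. f (- y) = - f y"
  shows "(LINT y|lborel. f y) = 0"
  using lborel_integral_reflect[OF assms(1), of 0] assms(2) by simp

lemma char_int_even:
  assumes J: "integrable lborel J" and even: "\<And>y. J (- y) = J y"
  shows "char_int J \<zeta> = complex_of_real (integral\<^sup>L lborel J - levy_exponent J \<zeta>)"
proof (rule complex_eqI)
  have [measurable]: "J \<in> borel_measurable borel" using borel_measurable_integrable[OF J] by simp
  have I: "integrable lborel (\<lambda>y. complex_of_real (J y) * cis (- (y \<bullet> \<zeta>)))"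
    by (rule integrable_mult_bounded(2)[where B=1]) (use J in auto)
  have "Im (char_int J \<zeta>) = (LINT y|lborel. Im (complex_of_real (J y) * cis (- (y \<bullet> \<zeta>))))"
    unfolding char_int_def by (rule integral_Im[OF I, symmetric])
  also have "\<dots> = 0"
    by (rule integral_odd_eq_0) (auto simp: even)
  finally show "Im (char_int J \<zeta>) = Im (complex_of_real (integral\<^sup>L lborel J - levy_exponent J \<zeta>))" by simp
qed (simp add: Re_char_int[OF J])

text \<open>
The exponential is multiplicative, so it distributes over a convolution; this is what makes the
Esscher transform of a compound Poisson law compound Poisson again.
\<close>

lemma convol_exp_tilt:
  "convol (\<lambda>y. exp (\<theta> \<bullet> y) * J y) (\<lambda>x. exp (\<theta> \<bullet> x) * f x) x = exp (\<theta> \<bullet> x) * convol J f x"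
proof -
  have "exp (\<theta> \<bullet> y) * J y * (exp (\<theta> \<bullet> (x - y)) * f (x - y)) = exp (\<theta> \<bullet> x) * (J y * f (x - y))" for y
    by (simp add: inner_diff_right exp_diff)
  then have "convol (\<lambda>y. exp (\<theta> \<bullet> y) * J y) (\<lambda>x. exp (\<theta> \<bullet> x) * f x) x
      = (LINT y|lborel. exp (\<theta> \<bullet> x) * (J y * f (x - y)))"
    unfolding convol_def by presburger
  then show ?thesis unfolding convol_def by simp
qed

lemma convol_power_exp_tilt:
  "(convol (\<lambda>y. exp (\<theta> \<bullet> y) * J y) ^^ n) (\<lambda>x. exp (\<theta> \<bullet> x) * f x) x
     = exp (\<theta> \<bullet> x) * (convol J ^^ n) f x"
proof -
  have "(convol (\<lambda>y. exp (\<theta> \<bullet> y) * J y) ^^ n) (\<lambda>x. exp (\<theta> \<bullet> x) * f x)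
     = (\<lambda>x. exp (\<theta> \<bullet> x) * (convol J ^^ n) f x)"
    by (induction n) (auto simp: convol_exp_tilt)
  then show ?thesis by simp
qed

lemma convol_power_nonneg:
  assumes "\<And>y. J y \<ge> 0" "\<And>x. f x \<ge> 0"
  shows "(convol J ^^ n) f x \<ge> 0"
  by (induction n arbitrary: x) (auto simp: convol_def assms intro!: integral_nonneg_AE)

lemma exp_le_quadratic:
  fixes t :: real
  assumes "\<bar>t\<bar> \<le> 1"
  shows "exp t \<le> 1 + t + t\<^sup>2"
proof (cases "t \<ge> 0")
  case True
  then show ?thesis using assms exp_bound[of t] by simp
next
  case False
  define u where "u = - t"
  have u: "u > 0" using False u_def by simp
  have "(1 - u + u\<^sup>2) * (1 + u + u\<^sup>2 / 2) = 1 + (u ^ 2 + u ^ 3 + u ^ 4) / 2"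
    by (simp add: field_simps power2_eq_square power3_eq_cube power4_eq_xxxx)
  then have "1 \<le> (1 - u + u\<^sup>2) * (1 + u + u\<^sup>2 / 2)"
    using u by simp
  also have "\<dots> \<le> (1 - u + u\<^sup>2) * exp u"
    using u exp_lower_Taylor_quadratic[of u] sum_power2_ge_zero[of "u - 1/2" 0]
    by (intro mult_left_mono) (auto simp: power2_eq_square algebra_simps)
  finally have "exp (- u) * 1 \<le> exp (- u) * ((1 - u + u\<^sup>2) * exp u)"
    by (intro mult_left_mono) auto
  also have "exp (- u) * ((1 - u + u\<^sup>2) * exp u) = (1 - u + u\<^sup>2) * (exp (- u) * exp u)"
    by (simp only: mult_ac)
  also have "\<dots> = 1 + t + t\<^sup>2" by (simp add: u_def flip: exp_add)
  finally show ?thesis by (simp add: u_def)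
qed

text \<open>
Completing the square: the tilted Gaussian is a translate, and a translation appears on the Fourier side
as a factor of modulus one.
\<close>

lemma gaussian_tilt_fourier:
  fixes \<theta> x :: "real \<times> real"
  assumes "\<sigma> > 0"
  shows "complex_of_real (exp (\<theta> \<bullet> x) * (2 * pi / \<sigma> * exp (- (norm x)\<^sup>2 / (2 * \<sigma>)))) =
    fourier_int (\<lambda>\<zeta>. complex_of_real (exp (\<sigma> * (norm \<theta>)\<^sup>2 / 2)) * (cis (- \<sigma> * (\<theta> \<bullet> \<zeta>)) * complex_of_real (gaussian \<sigma> \<zeta>))) x"
proof -
  have e: "(norm (x - \<sigma> *\<^sub>R \<theta>))\<^sup>2 = (norm x)\<^sup>2 - 2 * \<sigma> * (\<theta> \<bullet> x) + \<sigma>\<^sup>2 * (norm \<theta>)\<^sup>2"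
    unfolding power2_norm_eq_inner
    by (simp add: inner_diff_left inner_diff_right inner_commute power2_eq_square algebra_simps)
  have "cis (x \<bullet> \<zeta>) * (c * (cis (- \<sigma> * (\<theta> \<bullet> \<zeta>)) * G)) = c * (cis ((x - \<sigma> *\<^sub>R \<theta>) \<bullet> \<zeta>) * G)" for c G \<zeta>
  proof -
    have "cis (x \<bullet> \<zeta>) * cis (- \<sigma> * (\<theta> \<bullet> \<zeta>)) = cis ((x - \<sigma> *\<^sub>R \<theta>) \<bullet> \<zeta>)"
      by (simp add: cis_mult inner_diff_left)
    then show ?thesis by (simp only: mult_ac)
  qed
  then have "fourier_int (\<lambda>\<zeta>. complex_of_real (exp (\<sigma> * (norm \<theta>)\<^sup>2 / 2)) * (cis (- \<sigma> * (\<theta> \<bullet> \<zeta>)) * complex_of_real (gaussian \<sigma> \<zeta>))) x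
     = complex_of_real (exp (\<sigma> * (norm \<theta>)\<^sup>2 / 2)) * fourier_int (\<lambda>\<zeta>. complex_of_real (gaussian \<sigma> \<zeta>)) (x - \<sigma> *\<^sub>R \<theta>)"
    unfolding fourier_int_def by (simp only: integral_mult_right_zero)
  also have "\<dots> = complex_of_real (2 * pi / \<sigma> * (exp (\<sigma> * (norm \<theta>)\<^sup>2 / 2) * exp (- (norm (x - \<sigma> *\<^sub>R \<theta>))\<^sup>2 / (2 * \<sigma>))))"
    unfolding gaussian_fourier[OF assms] by simp
  also have "exp (\<sigma> * (norm \<theta>)\<^sup>2 / 2) * exp (- (norm (x - \<sigma> *\<^sub>R \<theta>))\<^sup>2 / (2 * \<sigma>)) = exp (\<theta> \<bullet> x) * exp (- (norm x)\<^sup>2 / (2 * \<sigma>))"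
    unfolding e using assms by (simp add: field_simps power2_eq_square flip: exp_add)
  finally show ?thesis by (simp add: mult_ac)
qed


lemma Re_nonneg_Im_zero_limit:
  fixes z :: "nat \<Rightarrow> complex"
  assumes "z \<longlonglongrightarrow> w" "\<And>n. Im (z n) = 0" "\<And>n. 0 \<le> Re (z n)"
  shows "Im w = 0" "0 \<le> Re w"
proof -
  have "(\<lambda>n. Im (z n)) \<longlonglongrightarrow> Im w" by (rule tendsto_Im[OF assms(1)])
  then show "Im w = 0" using assms(2) by (simp add: LIMSEQ_const_iff)
  have "(\<lambda>n. Re (z n)) \<longlonglongrightarrow> Re w" by (rule tendsto_Re[OF assms(1)])
  then show "0 \<le> Re w" by (rule LIMSEQ_le_const) (use assms(3) in auto)
qed

text \<open>
Positivity of the density is read off from the series, whose terms are iterated convolutions of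
nonnegative functions. It would not be visible from the Fourier integral.
\<close>

lemma compound_poisson_density:
  assumes J: "integrable lborel J" "\<And>y. J y \<ge> 0"
    and F: "integrable lborel F" and f: "\<And>x. complex_of_real (f x) = fourier_int F x" "\<And>x. f x \<ge> 0"
  shows "\<exists>p. p \<ge> 0 \<and> (\<lambda>n. (convol J ^^ n) f x / fact n) sums p
           \<and> fourier_int (\<lambda>\<zeta>. exp (char_int J \<zeta>) * F \<zeta>) x = complex_of_real p"
proof -
  let ?S = "fourier_int (\<lambda>\<zeta>. exp (char_int J \<zeta>) * F \<zeta>) x"
  have s: "(\<lambda>n. complex_of_real ((convol J ^^ n) f x / fact n)) sums ?S"
    by (rule exp_convol_sums[OF J(1) F f(1)])
  have r: "(\<lambda>n. (convol J ^^ n) f x / fact n) sums Re ?S"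
    using sums_Re[OF s] by (simp only: Re_complex_of_real)
  have "(\<lambda>n. 0) sums Im ?S" using sums_Im[OF s] by (simp only: Im_complex_of_real)
  then have "Im ?S = 0" using sums_unique2 sums_zero by blast
  moreover have "0 \<le> Re ?S"
    by (rule sums_le[OF _ sums_zero r]) (simp add: convol_power_nonneg J f)
  ultimately show ?thesis using r by (intro exI[of _ "Re ?S"]) (auto simp: complex_eq_iff)
qed

lemma fourier_int_limit:
  assumes meas: "\<And>n. F n \<in> borel_measurable borel" "G \<in> borel_measurable borel"
    and lim: "\<And>\<zeta>. (\<lambda>n. F n \<zeta>) \<longlonglongrightarrow> G \<zeta>"
    and bound: "\<And>n \<zeta>. norm (F n \<zeta>) \<le> w \<zeta>" "integrable lborel w"
  shows "(\<lambda>n. fourier_int (F n) x) \<longlonglongrightarrow> fourier_int G x"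
  unfolding fourier_int_def
proof (rule integral_dominated_convergence[where w=w])
  show "AE \<zeta> in lborel. (\<lambda>n. cis (x \<bullet> \<zeta>) * F n \<zeta>) \<longlonglongrightarrow> cis (x \<bullet> \<zeta>) * G \<zeta>"
    using lim by (auto intro!: tendsto_intros)
qed (use meas bound in \<open>auto simp: norm_mult\<close>)

text \<open>
The regularised case: an integrable Levy density and a Gaussian factor. The tilted density is the Fourier
integral of a function whose modulus is a constant times a Gaussian times \<open>exp (- levy_exponent J')\<close>, with
\<open>J' y = exp (\<theta> \<bullet> y) * J y \<ge> J y / e\<close> because jumps have norm at most one. The constant contains the
change of mass \<open>\<integral> (exp (\<theta> \<bullet> y) - 1) * J y\<close>; by symmetry of \<open>J\<close> the linear term drops out and only second
moments remain. Hence the bound involves neither the mass of \<open>J\<close> nor an inverse power of \<open>\<sigma>\<close> and passes to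
the limit.
\<close>

lemma fourier_exp_levy_gaussian:
  fixes J :: "real \<times> real \<Rightarrow> real" and x \<theta> :: "real \<times> real"
  assumes J: "integrable lborel J" "\<And>y. J y \<ge> 0" "\<And>y. J (- y) = J y" "\<And>y. J y \<noteq> 0 \<Longrightarrow> norm y \<le> 1"
    and \<sigma>: "\<sigma> > 0" and \<theta>: "norm \<theta> = 1" and m: "(LINT y|lborel. (norm y)\<^sup>2 * J y) \<le> m"
  defines "h \<equiv> fourier_int (\<lambda>\<zeta>. complex_of_real (exp (- levy_exponent J \<zeta>) * gaussian \<sigma> \<zeta>)) x"
  shows "Im h = 0" "0 \<le> Re h"
    "exp (\<theta> \<bullet> x) * Re h \<le> exp (m + \<sigma> / 2) * (LINT \<zeta>|lborel. exp (- levy_exponent J \<zeta> / exp 1) * gaussian \<sigma> \<zeta>)"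
proof -
  let ?lam = "integral\<^sup>L lborel J"
  have [measurable]: "J \<in> borel_measurable borel" using borel_measurable_integrable[OF J(1)] by simp
  define F where "F = (\<lambda>\<zeta>. complex_of_real (gaussian \<sigma> \<zeta>))"
  define f where "f = (\<lambda>x::real \<times> real. 2 * pi / \<sigma> * exp (- (norm x)\<^sup>2 / (2 * \<sigma>)))"
  have F: "integrable lborel F" unfolding F_def by (intro integrable_of_real gaussian_integrable \<sigma>)
  have fF: "complex_of_real (f x) = fourier_int F x" "f x \<ge> 0" for x
    unfolding f_def F_def using gaussian_fourier[OF \<sigma>, of x] \<sigma> by auto
  obtain p where p: "p \<ge> 0" "(\<lambda>n. (convol J ^^ n) f x / fact n) sums p"
     "fourier_int (\<lambda>\<zeta>. exp (char_int J \<zeta>) * F \<zeta>) x = complex_of_real p"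
    using compound_poisson_density[OF J(1,2) F fF] by blast
  have h: "h = complex_of_real (exp (- ?lam) * p)"
  proof -
    have "cis (x \<bullet> \<zeta>) * complex_of_real (exp (- levy_exponent J \<zeta>) * gaussian \<sigma> \<zeta>)
        = complex_of_real (exp (- ?lam)) * (cis (x \<bullet> \<zeta>) * (exp (char_int J \<zeta>) * F \<zeta>))" for \<zeta>
      unfolding char_int_even[OF J(1,3)] F_def by (simp add: exp_diff exp_minus exp_of_real field_simps)
    then have "h = complex_of_real (exp (- ?lam)) * fourier_int (\<lambda>\<zeta>. exp (char_int J \<zeta>) * F \<zeta>) x"
      unfolding h_def fourier_int_def by (simp only: integral_mult_right_zero)
    then show ?thesis unfolding p(3) by simp
  qed
  show "Im h = 0" "0 \<le> Re h" unfolding h using p(1) by auto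
  \<comment> \<open>The Esscher transform of the compound Poisson law with respect to \<open>\<theta>\<close>.\<close>
  define J' where "J' = (\<lambda>y. exp (\<theta> \<bullet> y) * J y)"
  define f' where "f' = (\<lambda>x. exp (\<theta> \<bullet> x) * f x)"
  define F' where "F' = (\<lambda>\<zeta>. complex_of_real (exp (\<sigma> / 2)) * (cis (- \<sigma> * (\<theta> \<bullet> \<zeta>)) * F \<zeta>))"
  have ty: "\<bar>\<theta> \<bullet> y\<bar> \<le> 1" if "J y \<noteq> 0" for y
    using Cauchy_Schwarz_ineq2[of \<theta> y] \<theta> J(4)[OF that] by simp
  have J'_le: "J' y \<le> exp 1 * J y" "J' y \<ge> exp (-1) * J y" "J' y \<ge> 0" for y
  proof -
    show "J' y \<le> exp 1 * J y" "J' y \<ge> exp (-1) * J y" "J' y \<ge> 0"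
      unfolding J'_def using ty[of y] J(2)[of y] by (cases "J y = 0"; auto intro!: mult_right_mono)+
  qed
  have J': "integrable lborel J'"
  proof (rule Bochner_Integration.integrable_bound)
    show "integrable lborel (\<lambda>y. exp 1 * J y)" using J(1) by simp
    show "J' \<in> borel_measurable lborel" unfolding J'_def by measurable
    show "AE y in lborel. norm (J' y) \<le> norm (exp 1 * J y)" using J'_le J(2) by auto
  qed
  have F': "integrable lborel F'"
    unfolding F'_def
    by (intro integrable_mult_right integrable_mult_bounded(1)[where B=1 and f=F, OF F]) auto
  have f'F': "complex_of_real (f' x) = fourier_int F' x" for x
    unfolding f'_def F'_def f_def F_def using gaussian_tilt_fourier[OF \<sigma>, of \<theta> x] \<theta> by simp
  have "(\<lambda>n. complex_of_real ((convol J' ^^ n) f' x / fact n)) sums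
           fourier_int (\<lambda>\<zeta>. exp (char_int J' \<zeta>) * F' \<zeta>) x"
    by (rule exp_convol_sums[OF J' F' f'F'])
  moreover have "(\<lambda>n. complex_of_real ((convol J' ^^ n) f' x / fact n)) sums complex_of_real (exp (\<theta> \<bullet> x) * p)"
    unfolding J'_def f'_def convol_power_exp_tilt
    using sums_mult[OF p(2), of "exp (\<theta> \<bullet> x)"] by (subst sums_of_real_iff) simp
  ultimately have "complex_of_real (exp (\<theta> \<bullet> x) * p) = fourier_int (\<lambda>\<zeta>. exp (char_int J' \<zeta>) * F' \<zeta>) x"
    using sums_unique2 by blast
  then have "exp (\<theta> \<bullet> x) * p = norm (fourier_int (\<lambda>\<zeta>. exp (char_int J' \<zeta>) * F' \<zeta>) x)"
    using p(1) by (metis abs_of_nonneg exp_ge_zero mult_nonneg_nonneg norm_of_real)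
  also have "\<dots> \<le> (LINT \<zeta>|lborel. norm (exp (char_int J' \<zeta>) * F' \<zeta>))"
    unfolding fourier_int_def by (rule order_trans[OF integral_norm_bound]) (simp add: norm_mult)
  also have "\<dots> \<le> (LINT \<zeta>|lborel. exp (?lam + m + \<sigma> / 2) * (exp (- levy_exponent J \<zeta> / exp 1) * gaussian \<sigma> \<zeta>))"
  proof (rule integral_mono')
    have "integrable lborel (\<lambda>\<zeta>. exp (- levy_exponent J \<zeta> / exp 1) * gaussian \<sigma> \<zeta>)"
      by (rule integrable_mult_bounded(1)[where B=1, OF gaussian_integrable[OF \<sigma>]])
         (use levy_exponent_nonneg[of J, OF J(2)] in auto)
    then show "integrable lborel (\<lambda>\<zeta>. exp (?lam + m + \<sigma> / 2) * (exp (- levy_exponent J \<zeta> / exp 1) * gaussian \<sigma> \<zeta>))"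
      by (rule integrable_mult_right)
    fix \<zeta> :: "real \<times> real"
    show "0 \<le> exp (?lam + m + \<sigma> / 2) * (exp (- levy_exponent J \<zeta> / exp 1) * gaussian \<sigma> \<zeta>)"
      by (simp add: gaussian_def)
    have "Re (char_int J' \<zeta>) = integral\<^sup>L lborel J' - levy_exponent J' \<zeta>" by (rule Re_char_int[OF J'])
    moreover have "levy_exponent J' \<zeta> \<ge> levy_exponent J \<zeta> / exp 1"
    proof -
      have "levy_exponent J' \<zeta> \<ge> (LINT y|lborel. exp (-1) * ((1 - cos (y \<bullet> \<zeta>)) * J y))"
        unfolding levy_exponent_def
      proof (rule integral_mono)
        show "exp (-1) * ((1 - cos (y \<bullet> \<zeta>)) * J y) \<le> (1 - cos (y \<bullet> \<zeta>)) * J' y" for y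
          using mult_left_mono[OF J'_le(2)[of y], of "1 - cos (y \<bullet> \<zeta>)"] by (simp add: mult_ac)
      qed (intro integrable_mult_right integrable_one_minus_cos_mult J(1) J')+
      then show ?thesis unfolding levy_exponent_def by (simp add: exp_minus field_simps)
    qed
    moreover have "integral\<^sup>L lborel J' \<le> ?lam + m"
    proof -
      have i1: "integrable lborel (\<lambda>y. (\<theta> \<bullet> y) * J y)" and i2: "integrable lborel (\<lambda>y. (norm y)\<^sup>2 * J y)"
      proof -
        show "integrable lborel (\<lambda>y. (\<theta> \<bullet> y) * J y)"
        proof (rule Bochner_Integration.integrable_bound[OF J(1)])
          have "\<bar>\<theta> \<bullet> y\<bar> * \<bar>J y\<bar> \<le> \<bar>J y\<bar>" for y
            using ty[of y] by (cases "J y = 0") (auto intro!: mult_left_le_one_le)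
          then show "AE y in lborel. norm ((\<theta> \<bullet> y) * J y) \<le> norm (J y)" by (simp only: real_norm_def abs_mult) simp
        qed simp
        show "integrable lborel (\<lambda>y. (norm y)\<^sup>2 * J y)"
        proof (rule Bochner_Integration.integrable_bound[OF J(1)])
          have "\<bar>(norm y)\<^sup>2\<bar> * \<bar>J y\<bar> \<le> \<bar>J y\<bar>" for y
            using J(4)[of y] by (cases "J y = 0") (auto simp: power_le_one intro!: mult_left_le_one_le)
          then show "AE y in lborel. norm ((norm y)\<^sup>2 * J y) \<le> norm (J y)" by (simp only: real_norm_def abs_mult) simp
        qed simp
      qed
      have "integral\<^sup>L lborel J' \<le> (LINT y|lborel. J y + (\<theta> \<bullet> y) * J y + (norm y)\<^sup>2 * J y)"
      proof (rule integral_mono[OF J'])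
        fix y
        have "exp (\<theta> \<bullet> y) \<le> 1 + (\<theta> \<bullet> y) + (norm y)\<^sup>2" if "J y \<noteq> 0"
        proof -
          have "(\<theta> \<bullet> y)\<^sup>2 \<le> (norm y)\<^sup>2"
            using Cauchy_Schwarz_ineq2[of \<theta> y] \<theta> by (intro power2_le_iff_abs_le[THEN iffD2]) auto
          then show ?thesis using exp_le_quadratic[OF ty[OF that]] by simp
        qed
        then show "J' y \<le> J y + (\<theta> \<bullet> y) * J y + (norm y)\<^sup>2 * J y"
          unfolding J'_def using J(2)[of y] mult_right_mono[of "exp (\<theta> \<bullet> y)" "1 + (\<theta> \<bullet> y) + (norm y)\<^sup>2" "J y"]
          by (cases "J y = 0") (auto simp: algebra_simps)
      qed (intro Bochner_Integration.integrable_add J(1) i1 i2)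
      also have "\<dots> = ?lam + (LINT y|lborel. (\<theta> \<bullet> y) * J y) + (LINT y|lborel. (norm y)\<^sup>2 * J y)"
        using J(1) i1 i2 by simp
      also have "(LINT y|lborel. (\<theta> \<bullet> y) * J y) = 0"
        by (rule integral_odd_eq_0) (auto simp: J(3))
      finally show ?thesis using m by simp
    qed
    ultimately have R: "Re (char_int J' \<zeta>) \<le> ?lam + m - levy_exponent J \<zeta> / exp 1" by simp
    have "norm (exp (char_int J' \<zeta>) * F' \<zeta>) = exp (Re (char_int J' \<zeta>)) * (exp (\<sigma> / 2) * gaussian \<sigma> \<zeta>)"
      by (simp add: norm_mult F'_def F_def gaussian_def)
    also have "\<dots> \<le> exp (?lam + m - levy_exponent J \<zeta> / exp 1) * (exp (\<sigma> / 2) * gaussian \<sigma> \<zeta>)"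
      using R by (intro mult_right_mono) (auto simp: gaussian_def)
    also have "exp (?lam + m - levy_exponent J \<zeta> / exp 1) * (exp (\<sigma> / 2) * gaussian \<sigma> \<zeta>)
        = exp (?lam + m + \<sigma> / 2) * (exp (- levy_exponent J \<zeta> / exp 1) * gaussian \<sigma> \<zeta>)"
      unfolding mult.assoc[symmetric] by (simp flip: exp_add)
    finally show "norm (exp (char_int J' \<zeta>) * F' \<zeta>) \<le> exp (?lam + m + \<sigma> / 2) * (exp (- levy_exponent J \<zeta> / exp 1) * gaussian \<sigma> \<zeta>)" .
  qed
  finally have "exp (\<theta> \<bullet> x) * p \<le> exp ?lam * (exp (m + \<sigma> / 2) * (LINT \<zeta>|lborel. exp (- levy_exponent J \<zeta> / exp 1) * gaussian \<sigma> \<zeta>))"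
    unfolding integral_mult_right_zero by (simp add: exp_add mult_ac)
  then show "exp (\<theta> \<bullet> x) * Re h \<le> exp (m + \<sigma> / 2) * (LINT \<zeta>|lborel. exp (- levy_exponent J \<zeta> / exp 1) * gaussian \<sigma> \<zeta>)"
    unfolding h by (simp add: exp_minus field_simps)
qed


lemma one_minus_cos_le: "1 - cos t \<le> t\<^sup>2 / (2::real)"
proof -
  have "1 - cos t = 2 * (sin (t / 2))\<^sup>2" using cos_double_sin[of "t / 2"] by simp
  also have "(sin (t / 2))\<^sup>2 \<le> (t / 2)\<^sup>2"
    using abs_sin_x_le_abs_x[of "t / 2"] by (rule abs_le_square_iff[THEN iffD1])
  finally show ?thesis by (simp add: power_divide)
qed

lemma one_minus_cos_inner_le: "1 - cos (y \<bullet> \<zeta>) \<le> (norm \<zeta>)\<^sup>2 * (norm y)\<^sup>2" for y :: "'a::real_inner"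
proof -
  have "(y \<bullet> \<zeta>)\<^sup>2 \<le> (norm y * norm \<zeta>)\<^sup>2"
    using Cauchy_Schwarz_ineq2[of y \<zeta>] by (intro power2_le_iff_abs_le[THEN iffD2]) auto
  moreover have "1 - cos (y \<bullet> \<zeta>) \<le> (y \<bullet> \<zeta>)\<^sup>2"
    using one_minus_cos_le[of "y \<bullet> \<zeta>"] zero_le_power2[of "y \<bullet> \<zeta>"] by linarith
  ultimately show ?thesis by (simp add: power_mult_distrib mult.commute)
qed

text \<open>
The cutoff \<open>min (J y) n\<close> makes a Levy density with bounded support integrable and keeps it symmetric.
\<close>

lemma levy_exponent_truncation_limit:
  fixes J :: "'a::euclidean_space \<Rightarrow> real"
  assumes [measurable]: "J \<in> borel_measurable borel" and J: "\<And>y. J y \<ge> 0"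
    and i2: "integrable lborel (\<lambda>y. (norm y)\<^sup>2 * J y)"
  shows "(\<lambda>n. levy_exponent (\<lambda>y. min (J y) (real n)) \<zeta>) \<longlonglongrightarrow> levy_exponent J \<zeta>"
  unfolding levy_exponent_def
proof (rule integral_dominated_convergence[where w="\<lambda>y. (norm \<zeta>)\<^sup>2 * ((norm y)\<^sup>2 * J y)"])
  show "integrable lborel (\<lambda>y. (norm \<zeta>)\<^sup>2 * ((norm y)\<^sup>2 * J y))" using i2 by simp
  show "AE y in lborel. (\<lambda>n. (1 - cos (y \<bullet> \<zeta>)) * min (J y) (real n)) \<longlonglongrightarrow> (1 - cos (y \<bullet> \<zeta>)) * J y"
  proof (rule AE_I2)
    fix y
    obtain k :: nat where k: "J y \<le> real k" using real_arch_simple by blast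
    have "eventually (\<lambda>n. min (J y) (real n) = J y) sequentially"
      using eventually_ge_at_top[of k] by eventually_elim (use k in auto)
    then have "(\<lambda>n. min (J y) (real n)) \<longlonglongrightarrow> J y" by (rule tendsto_eventually)
    then show "(\<lambda>n. (1 - cos (y \<bullet> \<zeta>)) * min (J y) (real n)) \<longlonglongrightarrow> (1 - cos (y \<bullet> \<zeta>)) * J y"
      by (intro tendsto_intros)
  qed
  show "AE y in lborel. norm ((1 - cos (y \<bullet> \<zeta>)) * min (J y) (real n)) \<le> (norm \<zeta>)\<^sup>2 * ((norm y)\<^sup>2 * J y)" for n
  proof (rule AE_I2)
    fix y
    have "(1 - cos (y \<bullet> \<zeta>)) * min (J y) (real n) \<le> ((norm \<zeta>)\<^sup>2 * (norm y)\<^sup>2) * J y"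
      using J[of y] by (intro mult_mono one_minus_cos_inner_le) auto
    then show "norm ((1 - cos (y \<bullet> \<zeta>)) * min (J y) (real n)) \<le> (norm \<zeta>)\<^sup>2 * ((norm y)\<^sup>2 * J y)"
      using J[of y] by (simp add: abs_mult mult.assoc)
  qed
qed auto

text \<open>
Two limits of the regularised case, first in the cutoff of the Levy density and then in the variance of
the Gaussian: the Gaussian dominates the integrands in the first limit, the exponent of the full density
in the second. The direction \<open>\<theta>\<close> of the tilt is finally chosen
along \<open>x\<close>.
\<close>

lemma fourier_exp_levy_decay:
  fixes J :: "real \<times> real \<Rightarrow> real" and x :: "real \<times> real"
  assumes [measurable]: "J \<in> borel_measurable borel"
    and J: "\<And>y. J y \<ge> 0" "\<And>y. J (- y) = J y" "\<And>y. J y \<noteq> 0 \<Longrightarrow> norm y \<le> 1"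
    and i2: "integrable lborel (\<lambda>y. (norm y)\<^sup>2 * J y)"
    and E: "integrable lborel (\<lambda>\<zeta>. exp (- levy_exponent J \<zeta> / exp 1))"
  defines "g \<equiv> fourier_int (\<lambda>\<zeta>. complex_of_real (exp (- levy_exponent J \<zeta>))) x"
    and "m \<equiv> LINT y|lborel. (norm y)\<^sup>2 * J y"
    and "I \<equiv> LINT \<zeta>|lborel. exp (- levy_exponent J \<zeta> / exp 1)"
  shows "Im g = 0" "0 \<le> Re g" "Re g \<le> exp m * I * exp (- norm x)"
proof -
  define Jn where "Jn = (\<lambda>n y. min (J y) (real n))"
  have Jn_meas [measurable]: "Jn n \<in> borel_measurable borel" for n unfolding Jn_def by measurable
  have Jn_int: "integrable lborel (Jn n)" for n
  proof (rule Bochner_Integration.integrable_bound)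
    show "integrable lborel (\<lambda>y. real n * indicator (cball 0 1) (y :: real \<times> real))"
      using emeasure_bounded_finite[OF bounded_cball, of "0 :: real \<times> real" 1]
      by (intro integrable_mult_right integrable_real_indicator) auto
    have "norm (Jn n y) \<le> norm (real n * indicator (cball 0 1) y)" for y
      using J(1)[of y] J(3)[of y] by (cases "J y = 0") (simp_all add: Jn_def indicator_def)
    then show "AE y in lborel. norm (Jn n y) \<le> norm (real n * indicator (cball 0 1) y)" by simp
  qed simp
  have Jn: "Jn n y \<ge> 0" "Jn n (- y) = Jn n y" "Jn n y \<noteq> 0 \<Longrightarrow> norm y \<le> 1" for n y
    using J[of y] by (auto simp: Jn_def min_def split: if_splits)
  have m: "(LINT y|lborel. (norm y)\<^sup>2 * Jn n y) \<le> m" for n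
    unfolding m_def by (rule integral_mono'[OF i2]) (auto simp: Jn_def J intro!: mult_left_mono)
  have lim: "(\<lambda>n. levy_exponent (Jn n) \<zeta>) \<longlonglongrightarrow> levy_exponent J \<zeta>" for \<zeta>
    unfolding Jn_def by (rule levy_exponent_truncation_limit) (use J i2 in auto)
  have g0: "0 \<le> gaussian \<sigma> \<zeta>" for \<sigma> \<zeta> by (simp add: gaussian_def)
  have g1: "gaussian \<sigma> \<zeta> \<le> 1" if "\<sigma> > 0" for \<sigma> \<zeta> using that by (simp add: gaussian_def)
  have l0: "0 \<le> levy_exponent (Jn n) \<zeta>" "0 \<le> levy_exponent J \<zeta>" for n \<zeta>
    using levy_exponent_nonneg[of "Jn n"] levy_exponent_nonneg[of J] J(1) Jn(1) by auto
  define h where "h = (\<lambda>\<sigma>. fourier_int (\<lambda>\<zeta>. complex_of_real (exp (- levy_exponent J \<zeta>) * gaussian \<sigma> \<zeta>)) x)"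
  have H: "Im (h \<sigma>) = 0 \<and> 0 \<le> Re (h \<sigma>) \<and> (\<forall>\<theta>. norm \<theta> = 1 \<longrightarrow> exp (\<theta> \<bullet> x) * Re (h \<sigma>) \<le> exp (m + \<sigma> / 2) * I)"
    if \<sigma>: "\<sigma> > 0" for \<sigma>
  proof -
    let ?hn = "\<lambda>n. fourier_int (\<lambda>\<zeta>. complex_of_real (exp (- levy_exponent (Jn n) \<zeta>) * gaussian \<sigma> \<zeta>)) x"
    have L: "?hn \<longlonglongrightarrow> h \<sigma>"
      unfolding h_def
    proof (rule fourier_int_limit[where w="gaussian \<sigma>"])
      show "(\<lambda>n. complex_of_real (exp (- levy_exponent (Jn n) \<zeta>) * gaussian \<sigma> \<zeta>))
          \<longlonglongrightarrow> complex_of_real (exp (- levy_exponent J \<zeta>) * gaussian \<sigma> \<zeta>)" for \<zeta>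
        by (intro tendsto_intros lim)
      show "norm (complex_of_real (exp (- levy_exponent (Jn n) \<zeta>) * gaussian \<sigma> \<zeta>)) \<le> gaussian \<sigma> \<zeta>" for n \<zeta>
        using l0 g0 by (auto simp: norm_mult mult_left_le_one_le)
    qed (use gaussian_integrable[OF \<sigma>] in auto)
    have B: "Im (?hn n) = 0" "0 \<le> Re (?hn n)"
        "exp (\<theta> \<bullet> x) * Re (?hn n) \<le> exp (m + \<sigma> / 2) * (LINT \<zeta>|lborel. exp (- levy_exponent (Jn n) \<zeta> / exp 1) * gaussian \<sigma> \<zeta>)"
      if "norm \<theta> = 1" for n \<theta>
      by (rule fourier_exp_levy_gaussian; (rule Jn_int Jn(1) Jn(2) \<sigma> that m | erule Jn(3)))+
    have ex: "norm (1::real, 0::real) = 1" by simp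
    have 1: "Im (h \<sigma>) = 0" "0 \<le> Re (h \<sigma>)"
      by (rule Re_nonneg_Im_zero_limit[OF L]; rule B(1,2)[OF ex])+
    have "exp (\<theta> \<bullet> x) * Re (h \<sigma>) \<le> exp (m + \<sigma> / 2) * I" if \<theta>: "norm \<theta> = 1" for \<theta>
    proof -
      have "(\<lambda>n. LINT \<zeta>|lborel. exp (- levy_exponent (Jn n) \<zeta> / exp 1) * gaussian \<sigma> \<zeta>)
         \<longlonglongrightarrow> (LINT \<zeta>|lborel. exp (- levy_exponent J \<zeta> / exp 1) * gaussian \<sigma> \<zeta>)"
      proof (rule integral_dominated_convergence[where w="gaussian \<sigma>"])
        show "AE \<zeta> in lborel. (\<lambda>n. exp (- levy_exponent (Jn n) \<zeta> / exp 1) * gaussian \<sigma> \<zeta>)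
           \<longlonglongrightarrow> exp (- levy_exponent J \<zeta> / exp 1) * gaussian \<sigma> \<zeta>"
          by (intro AE_I2 tendsto_intros lim) auto
        show "AE \<zeta> in lborel. norm (exp (- levy_exponent (Jn n) \<zeta> / exp 1) * gaussian \<sigma> \<zeta>) \<le> gaussian \<sigma> \<zeta>" for n
          using l0 g0 by (auto simp: norm_mult mult_left_le_one_le)
      qed (use gaussian_integrable[OF \<sigma>] in auto)
      then have R: "(\<lambda>n. exp (m + \<sigma> / 2) * (LINT \<zeta>|lborel. exp (- levy_exponent (Jn n) \<zeta> / exp 1) * gaussian \<sigma> \<zeta>))
         \<longlonglongrightarrow> exp (m + \<sigma> / 2) * (LINT \<zeta>|lborel. exp (- levy_exponent J \<zeta> / exp 1) * gaussian \<sigma> \<zeta>)"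
        by (intro tendsto_intros)
      have "exp (\<theta> \<bullet> x) * Re (h \<sigma>) \<le> exp (m + \<sigma> / 2) * (LINT \<zeta>|lborel. exp (- levy_exponent J \<zeta> / exp 1) * gaussian \<sigma> \<zeta>)"
        by (rule LIMSEQ_le[OF tendsto_mult_left[OF tendsto_Re[OF L]] R]) (use B(3)[OF \<theta>] in auto)
      also have "\<dots> \<le> exp (m + \<sigma> / 2) * I"
        unfolding I_def
        by (intro mult_left_mono integral_mono' E) (use g0 g1[OF \<sigma>] in \<open>auto intro: mult_left_le\<close>)
      finally show ?thesis .
    qed
    with 1 show ?thesis by blast
  qed
  \<comment> \<open>The variance of the Gaussian component tends to zero.\<close>
  define sg where "sg = (\<lambda>n. 1 / real (Suc n))"
  have sg: "sg n > 0" for n by (simp add: sg_def)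
  have sg0: "sg \<longlonglongrightarrow> 0" unfolding sg_def using LIMSEQ_inverse_real_of_nat by (simp add: inverse_eq_divide)
  have L: "(\<lambda>n. h (sg n)) \<longlonglongrightarrow> g"
    unfolding h_def g_def
  proof (rule fourier_int_limit[where w="\<lambda>\<zeta>. exp (- levy_exponent J \<zeta> / exp 1)"])
    fix \<zeta> :: "real \<times> real"
    have "(\<lambda>n. gaussian (sg n) \<zeta>) \<longlonglongrightarrow> exp (- 0 * (norm \<zeta>)\<^sup>2 / 2)"
      unfolding gaussian_def by (intro tendsto_intros sg0) auto
    then show "(\<lambda>n. complex_of_real (exp (- levy_exponent J \<zeta>) * gaussian (sg n) \<zeta>))
        \<longlonglongrightarrow> complex_of_real (exp (- levy_exponent J \<zeta>))"
      using tendsto_mult[OF tendsto_const[of "exp (- levy_exponent J \<zeta>)"]] by (intro tendsto_of_real) fastforce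
    fix n
    have "levy_exponent J \<zeta> / exp 1 \<le> levy_exponent J \<zeta>"
      using mult_right_mono[OF _ l0(2)[of \<zeta>], of 1 "exp 1"] by (simp add: field_simps)
    then have "exp (- levy_exponent J \<zeta>) * gaussian (sg n) \<zeta> \<le> exp (- levy_exponent J \<zeta> / exp 1) * 1"
      using g0 g1[OF sg] by (intro mult_mono) auto
    then show "norm (complex_of_real (exp (- levy_exponent J \<zeta>) * gaussian (sg n) \<zeta>)) \<le> exp (- levy_exponent J \<zeta> / exp 1)"
      using g0 by (simp add: norm_mult)
  qed (use E in auto)
  show "Im g = 0" "0 \<le> Re g"
    by (rule Re_nonneg_Im_zero_limit[OF L]; use H[OF sg] in blast)+
  obtain \<theta> :: "real \<times> real" where \<theta>: "norm \<theta> = 1" "\<theta> \<bullet> x = norm x"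
  proof (cases "x = 0")
    case True
    then show ?thesis using that[of "(1,0)"] by simp
  next
    case False
    then show ?thesis
      using that[of "x /\<^sub>R norm x"] by (simp add: dot_square_norm power2_eq_square)
  qed
  have R: "(\<lambda>n. exp (m + sg n / 2) * I) \<longlonglongrightarrow> exp (m + 0 / 2) * I" by (intro tendsto_intros sg0) auto
  have "\<forall>n\<ge>0. exp (\<theta> \<bullet> x) * Re (h (sg n)) \<le> exp (m + sg n / 2) * I"
    using H[OF sg] \<theta>(1) by blast
  then have "exp (\<theta> \<bullet> x) * Re g \<le> exp (m + 0 / 2) * I"
    by (intro LIMSEQ_le[OF tendsto_mult_left[OF tendsto_Re[OF L]] R] exI)
  then show "Re g \<le> exp m * I * exp (- norm x)"
    unfolding \<theta> by (simp add: exp_minus field_simps)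
qed

section \<open>The profile and convolution with large jumps\<close>

lemma nn_integral_line_powr:
  assumes A: "A > 0" and q: "q > 0"
  shows "(\<integral>\<^sup>+b. ennreal ((A + \<bar>b\<bar>) powr (- 1 - q)) \<partial>lborel) = ennreal (2 / q * A powr (- q))"
proof -
  let ?f = "\<lambda>b. ennreal ((A + b) powr (- 1 - q)) * indicator {0..} b"
  have pos: "(\<integral>\<^sup>+b. ?f b \<partial>lborel) = ennreal (0 - (- (1 / q) * (A + 0) powr (- q)))"
  proof (rule nn_integral_FTC_atLeast[where F="\<lambda>b. - (1 / q) * (A + b) powr (- q)"])
    show "DERIV (\<lambda>b. - (1 / q) * (A + b) powr (- q)) b :> (A + b) powr (- 1 - q)" if "0 \<le> b" for b
    proof -
      have "DERIV (\<lambda>b. (A + b) powr (- q)) b :> (- q) * (A + b) powr (- q - 1) * 1"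
        by (rule DERIV_chain2[where g="\<lambda>b. A + b", OF has_real_derivative_powr])
           (use A that in \<open>auto intro!: derivative_eq_intros\<close>)
      from DERIV_cmult[OF this, of "- (1 / q)"] show ?thesis
        using q by (simp add: minus_diff_commute)
    qed
    have "((\<lambda>b. (A + b) powr (- q)) \<longlongrightarrow> 0) at_top"
      using q by (intro tendsto_neg_powr filterlim_tendsto_add_at_top[OF tendsto_const filterlim_ident]) auto
    then show "((\<lambda>b. - (1 / q) * (A + b) powr (- q)) \<longlongrightarrow> 0) at_top"
      using tendsto_mult_right_zero by blast
  qed auto
  have "(\<integral>\<^sup>+b. ennreal ((A + \<bar>b\<bar>) powr (- 1 - q)) \<partial>lborel) = (\<integral>\<^sup>+b. ?f b + ?f (0 - b) \<partial>lborel)"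
  proof (rule nn_integral_cong_AE)
    have "AE b in lborel. b \<noteq> (0::real)" by (rule AE_lborel_singleton)
    then show "AE b in lborel. ennreal ((A + \<bar>b\<bar>) powr (- 1 - q)) = ?f b + ?f (0 - b)"
      by eventually_elim (auto simp: indicator_def)
  qed
  also have "\<dots> = (\<integral>\<^sup>+b. ?f b \<partial>lborel) + (\<integral>\<^sup>+b. ?f (0 - b) \<partial>lborel)"
    by (rule nn_integral_add) auto
  also have "(\<integral>\<^sup>+b. ?f (0 - b) \<partial>lborel) = (\<integral>\<^sup>+b. ?f b \<partial>lborel)"
    by (rule nn_integral_reflect) auto
  finally show ?thesis unfolding pos using q by (simp flip: ennreal_plus)
qed

lemma fst_snd_real_measurable [measurable]:
  "(fst :: real \<times> real \<Rightarrow> real) \<in> borel_measurable borel" "(snd :: real \<times> real \<Rightarrow> real) \<in> borel_measurable borel"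
  by (intro borel_measurable_continuous_onI continuous_intros)+

definition l1norm :: "real \<times> real \<Rightarrow> real" where
  "l1norm y = \<bar>fst y\<bar> + \<bar>snd y\<bar>"

lemma l1norm_nonneg [simp]: "0 \<le> l1norm y" "0 < 1 + l1norm y" by (simp_all add: l1norm_def)

lemma l1norm_triangle: "l1norm x \<le> l1norm (x - y) + l1norm y"
  using abs_triangle_ineq[of "fst x - fst y" "fst y"] abs_triangle_ineq[of "snd x - snd y" "snd y"]
  by (simp add: l1norm_def)

lemma l1norm_measurable [measurable]: "l1norm \<in> borel_measurable borel"
  unfolding l1norm_def[abs_def] by measurable

lemma nn_integral_lborel_fst:
  fixes f :: "real \<times> real \<Rightarrow> ennreal"
  assumes "f \<in> borel_measurable borel"
  shows "(\<integral>\<^sup>+y. f y \<partial>lborel) = (\<integral>\<^sup>+a. \<integral>\<^sup>+b. f (a, b) \<partial>lborel \<partial>lborel)"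
  using assms by (subst lborel_prod[symmetric], subst lborel.nn_integral_fst) (auto simp: lborel_prod)

lemma nn_integral_plane_powr:
  assumes A: "A > 0" and \<alpha>: "\<alpha> > 0"
  shows "(\<integral>\<^sup>+y. ennreal ((A + l1norm y) powr (- 2 - \<alpha>)) \<partial>lborel) = ennreal (4 / (\<alpha> * (1 + \<alpha>)) * A powr (- \<alpha>))"
proof -
  let ?f = "\<lambda>y. ennreal ((A + l1norm y) powr (- 2 - \<alpha>))"
  have "(\<integral>\<^sup>+y. ?f y \<partial>lborel) = (\<integral>\<^sup>+a. \<integral>\<^sup>+b. ?f (a, b) \<partial>lborel \<partial>lborel)"
    by (rule nn_integral_lborel_fst) measurable
  also have "\<dots> = (\<integral>\<^sup>+a. ennreal (2 / (1 + \<alpha>)) * ennreal ((A + \<bar>a\<bar>) powr (- 1 - \<alpha>)) \<partial>lborel)"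
  proof (rule nn_integral_cong)
    fix a :: real
    have "(\<integral>\<^sup>+b. ?f (a, b) \<partial>lborel) = (\<integral>\<^sup>+b. ennreal (((A + \<bar>a\<bar>) + \<bar>b\<bar>) powr (- 1 - (1 + \<alpha>))) \<partial>lborel)"
      by (simp add: l1norm_def add.assoc)
    also have "\<dots> = ennreal (2 / (1 + \<alpha>) * (A + \<bar>a\<bar>) powr (- (1 + \<alpha>)))"
      using A \<alpha> by (intro nn_integral_line_powr) auto
    finally show "(\<integral>\<^sup>+b. ?f (a, b) \<partial>lborel) = ennreal (2 / (1 + \<alpha>)) * ennreal ((A + \<bar>a\<bar>) powr (- 1 - \<alpha>))"
      using \<alpha> by (simp flip: ennreal_mult)
  qed
  also have "\<dots> = ennreal (2 / (1 + \<alpha>)) * ennreal (2 / \<alpha> * A powr (- \<alpha>))"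
    using nn_integral_line_powr[OF A \<alpha>] by (simp add: nn_integral_cmult)
  also have "\<dots> = ennreal (4 / (\<alpha> * (1 + \<alpha>)) * A powr (- \<alpha>))"
    using \<alpha> by (simp add: field_simps flip: ennreal_mult)
  finally show ?thesis .
qed

lemma integral_plane_powr:
  assumes A: "A > 0" and \<alpha>: "\<alpha> > 0"
  shows "integrable lborel (\<lambda>y. (A + l1norm y) powr (- 2 - \<alpha>))"
    and "(LINT y|lborel. (A + l1norm y) powr (- 2 - \<alpha>)) = 4 / (\<alpha> * (1 + \<alpha>)) * A powr (- \<alpha>)"
proof -
  have "has_bochner_integral lborel (\<lambda>y. (A + l1norm y) powr (- 2 - \<alpha>)) (4 / (\<alpha> * (1 + \<alpha>)) * A powr (- \<alpha>))"
    by (rule has_bochner_integral_nn_integral) (use nn_integral_plane_powr[OF A \<alpha>] \<alpha> in auto)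
  then show "integrable lborel (\<lambda>y. (A + l1norm y) powr (- 2 - \<alpha>))"
    "(LINT y|lborel. (A + l1norm y) powr (- 2 - \<alpha>)) = 4 / (\<alpha> * (1 + \<alpha>)) * A powr (- \<alpha>)"
    by (auto simp: has_bochner_integral_iff)
qed

text \<open>
The distance, in the maximum norm, to the double cone \<open>a * b \<ge> 0\<close>: it vanishes there and equals
\<open>min \<bar>a\<bar> \<bar>b\<bar>\<close> outside.
\<close>

definition gap :: "real \<times> real \<Rightarrow> real" where
  "gap y = max 0 ((\<bar>fst y - snd y\<bar> - \<bar>fst y + snd y\<bar>) / 2)"

lemma gap_nonneg [simp]: "0 \<le> gap y" "0 < 1 + gap y" by (simp_all add: gap_def)

lemma gap_measurable [measurable]: "gap \<in> borel_measurable borel"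
  unfolding gap_def[abs_def] by measurable

lemma gap_plus_l1norm_pos [simp]: "0 < 1 + gap x + l1norm y"
  using gap_nonneg(1)[of x] l1norm_nonneg(1)[of y] by linarith

lemma gap_le_l1norm: "gap y \<le> l1norm y"
  by (auto simp: gap_def l1norm_def)

text \<open>
The profile of the theorem at unit time, up to constants, in the coordinates \<open>a = x\<close>, \<open>b = v - x\<close>.
Adding one to both lengths replaces the minima.
\<close>

definition heat_profile :: "real \<Rightarrow> real \<times> real \<Rightarrow> real" where
  "heat_profile \<alpha> y = (1 + l1norm y) powr (- 2 - \<alpha>) * (1 + gap y) powr (- \<alpha>)"

definition large_jumps :: "real \<Rightarrow> real \<Rightarrow> real \<times> real \<Rightarrow> real" where
  "large_jumps \<alpha> c y = (if fst y * snd y > 0 \<and> \<bar>fst y + snd y\<bar> > 1 then c * \<bar>fst y + snd y\<bar> powr (- 2 - \<alpha>) else 0)"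

lemma heat_profile_measurable [measurable]: "heat_profile \<alpha> \<in> borel_measurable borel"
  unfolding heat_profile_def[abs_def] by measurable

lemma large_jumps_measurable [measurable]: "large_jumps \<alpha> c \<in> borel_measurable borel"
  unfolding large_jumps_def[abs_def] by measurable

lemma heat_profile_pos: "0 < heat_profile \<alpha> y"
  using gap_nonneg(1)[of y] l1norm_nonneg(1)[of y] unfolding heat_profile_def by (intro mult_pos_pos) (auto simp: add_nonneg_eq_0_iff)

lemma large_jumps_nonneg: "c \<ge> 0 \<Longrightarrow> 0 \<le> large_jumps \<alpha> c y"
  by (auto simp: large_jumps_def)

lemma same_sign_l1norm: "fst y * snd y > 0 \<Longrightarrow> \<bar>fst y + snd y\<bar> = l1norm y"
  by (auto simp: l1norm_def zero_less_mult_iff)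

lemma large_jumps_le:
  assumes "c \<ge> 0" "\<alpha> > 0"
  shows "large_jumps \<alpha> c y \<le> c * 2 powr (2 + \<alpha>) * (1 + l1norm y) powr (- 2 - \<alpha>)"
proof (cases "fst y * snd y > 0 \<and> \<bar>fst y + snd y\<bar> > 1")
  case True
  then have l: "\<bar>fst y + snd y\<bar> = l1norm y" "l1norm y > 1" using same_sign_l1norm[of y] by auto
  have "l1norm y powr (- 2 - \<alpha>) \<le> ((1 + l1norm y) / 2) powr (- 2 - \<alpha>)"
    using l assms by (intro powr_mono2') auto
  also have "\<dots> = 2 powr (2 + \<alpha>) * (1 + l1norm y) powr (- 2 - \<alpha>)"
    using l by (simp add: powr_divide powr_minus_divide powr_diff powr_add)
  finally show ?thesis using True l assms by (simp add: large_jumps_def mult_left_mono mult.assoc)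
qed (use assms in \<open>auto simp: large_jumps_def\<close>)

lemma large_jumps_integrable:
  assumes "c \<ge> 0" "\<alpha> > 0"
  shows "integrable lborel (large_jumps \<alpha> c)"
proof (rule Bochner_Integration.integrable_bound)
  show "integrable lborel (\<lambda>y. c * 2 powr (2 + \<alpha>) * (1 + l1norm y) powr (- 2 - \<alpha>))"
    using integral_plane_powr(1)[of 1 \<alpha>] assms by simp
  show "AE y in lborel. norm (large_jumps \<alpha> c y) \<le> norm (c * 2 powr (2 + \<alpha>) * (1 + l1norm y) powr (- 2 - \<alpha>))"
    using large_jumps_le[OF assms] large_jumps_nonneg[OF assms(1)] assms by auto
qed simp

lemma gap_uminus: "gap (- y) = gap y" and l1norm_uminus: "l1norm (- y) = l1norm y"
  by (auto simp: gap_def l1norm_def max_def abs_if)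

text \<open>
On the half plane \<open>a + b \<ge> 0\<close> only the smaller coordinate can be negative.
\<close>

lemma gap_eq_of_sum_nonneg: "a + b \<ge> 0 \<Longrightarrow> gap (a, b) = max 0 (- min a b)"
  unfolding gap_def by (auto simp: max_def min_def abs_if field_simps)

lemma gap_ge: "min (- a) b \<le> gap (a, b)" "min a (- b) \<le> gap (a, b)"
  unfolding gap_def by (auto simp: max_def min_def abs_if field_simps)

lemma gap_diff_ge: "gap x - l1norm y \<le> gap (x - y)"
  unfolding gap_def l1norm_def by (simp add: max_def abs_if)

text \<open>
If the coordinates of \<open>y\<close> are positive, then a negative coordinate of \<open>x\<close> is even more negative in \<open>x - y\<close>.
Either \<open>y\<close> is short compared with \<open>x\<close>, and both size and gap survive, or it is long. If the
coordinates of \<open>y\<close> are negative, then \<open>x - y\<close> is at least about as large as \<open>x\<close>, and the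
gap can only have been reduced by as much as the length of \<open>y\<close>.
\<close>

lemma jump_trichotomy_aux:
  assumes "a + b \<ge> 0" and y: "(p > 0 \<and> q > 0) \<or> (p < 0 \<and> q < 0)"
  defines "x \<equiv> (a, b)" and "y \<equiv> (p, q)"
  shows "(1 + l1norm x \<le> 2 * (1 + l1norm (x - y)) \<and> 1 + gap x \<le> 2 * (1 + gap (x - y)))
    \<or> (1 + l1norm x \<le> 4 * (1 + l1norm y) \<and> 1 + gap x \<le> 1 + l1norm (x - y))
    \<or> (1 + l1norm x \<le> 2 * (1 + l1norm (x - y)) \<and> 1 + gap x \<le> 2 * (1 + l1norm y))"
  using y
proof
  assume pq: "p > 0 \<and> q > 0"
  have "gap x \<le> l1norm (x - y)"
    unfolding x_def gap_eq_of_sum_nonneg[OF assms(1)] y_def l1norm_def using pq by (auto simp: max_def min_def)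
  moreover have "1 + l1norm x \<le> 2 * (1 + l1norm (x - y)) \<and> 1 + gap x \<le> 2 * (1 + gap (x - y))"
    if far: "1 + l1norm x > 4 * (1 + l1norm y)"
  proof
    show "1 + l1norm x \<le> 2 * (1 + l1norm (x - y))"
      using far l1norm_triangle[of x y] l1norm_nonneg(1)[of y] by argo
    show "1 + gap x \<le> 2 * (1 + gap (x - y))"
      using far pq assms(1) gap_ge[of "a - p" "b - q"] gap_nonneg(1)[of "x - y"]
      unfolding x_def gap_eq_of_sum_nonneg[OF assms(1)] y_def l1norm_def
      by (auto simp: max_def min_def abs_if split: if_splits)
  qed
  ultimately show ?thesis by linarith
next
  assume pq: "p < 0 \<and> q < 0"
  have "1 + l1norm x \<le> 2 * (1 + l1norm (x - y))"
    using pq assms(1) unfolding x_def y_def l1norm_def by (auto simp: abs_if)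
  then show ?thesis using gap_diff_ge[of x y] by auto
qed

text \<open>
The three ways to arrive at \<open>x\<close> by a last jump \<open>y\<close>: from a point that is at least about as unlikely as \<open>x\<close>; by a
jump as long as \<open>x\<close> from a point at least \<open>gap x\<close> away from the origin; or by a jump that makes up for
the gap of \<open>x\<close> from a point that is as far away as \<open>x\<close>. These correspond to the three summands in
\<open>heat_profile_jump_le\<close>.
\<close>

lemma jump_trichotomy:
  assumes "fst y * snd y > 0"
  shows "(1 + l1norm x \<le> 2 * (1 + l1norm (x - y)) \<and> 1 + gap x \<le> 2 * (1 + gap (x - y)))
    \<or> (1 + l1norm x \<le> 4 * (1 + l1norm y) \<and> 1 + gap x \<le> 1 + l1norm (x - y))
    \<or> (1 + l1norm x \<le> 2 * (1 + l1norm (x - y)) \<and> 1 + gap x \<le> 2 * (1 + l1norm y))"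
proof -
  obtain a b where x: "x = (a, b)" by (cases x)
  obtain p q where y: "y = (p, q)" by (cases y)
  have pq: "(p > 0 \<and> q > 0) \<or> (p < 0 \<and> q < 0)" using assms by (auto simp: y zero_less_mult_iff)
  show ?thesis
  proof (cases "a + b \<ge> 0")
    case True
    show ?thesis unfolding x y by (rule jump_trichotomy_aux[OF True pq])
  next
    case False
    then have "- a + - b \<ge> 0" "(- p > 0 \<and> - q > 0) \<or> (- p < 0 \<and> - q < 0)" using pq by auto
    from jump_trichotomy_aux[OF this]
    show ?thesis
      using gap_uminus[of x] l1norm_uminus[of x] gap_uminus[of "x - y"] l1norm_uminus[of "x - y"] l1norm_uminus[of y]
      unfolding x y by simp
  qed
qed

lemma powr_neg_le_scale:
  fixes u v k p :: real
  assumes "0 < u" "u \<le> k * v" "0 < k" "p \<ge> 0"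
  shows "v powr (- p) \<le> k powr p * u powr (- p)"
proof -
  have "(k * v) powr (- p) \<le> u powr (- p)"
    using assms by (intro powr_mono2') auto
  moreover have "(k * v) powr (- p) = k powr (- p) * v powr (- p)"
    by (rule powr_mult)
  ultimately have "k powr p * (k powr (- p) * v powr (- p)) \<le> k powr p * u powr (- p)"
    by (intro mult_left_mono) auto
  moreover have "k powr p * (k powr (- p) * v powr (- p)) = v powr (- p)"
    using assms by (simp add: powr_minus)
  ultimately show ?thesis by simp
qed


text \<open>
Each of the three functions of \<open>y\<close> on the right has integral of order \<open>D x powr (- \<alpha>)\<close>, which together
with the factor \<open>N x powr (- 2 - \<alpha>)\<close> is the profile at \<open>x\<close>. The restrictions to long jumps and to distant
starting points are encoded by adding \<open>D x\<close> to the length, so that no domain of integration has to be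
split.
\<close>

lemma heat_profile_jump_le:
  assumes c: "c \<ge> 0" and \<alpha>: "\<alpha> > 0"
  defines "N \<equiv> \<lambda>y. 1 + l1norm y" and "D \<equiv> \<lambda>y. 1 + gap y"
  shows "large_jumps \<alpha> c y * heat_profile \<alpha> (x - y) \<le>
    c * 2 powr (2 + \<alpha>) * (12 powr (2 + \<alpha>) * 2 powr \<alpha>) * N x powr (- 2 - \<alpha>) *
      (D x powr (- \<alpha>) * N y powr (- 2 - \<alpha>) + (D x + l1norm (x - y)) powr (- 2 - \<alpha>) + (D x + l1norm y) powr (- 2 - \<alpha>))"
proof (cases "fst y * snd y > 0")
  case False
  then show ?thesis
    using c by (auto simp: large_jumps_def intro!: mult_nonneg_nonneg add_nonneg_nonneg)
next
  case True
  let ?p = "2 + \<alpha>"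
  have p: "- 2 - \<alpha> = - ?p" by simp
  have N1: "N z \<ge> 1" and D1: "D z \<ge> 1" for z by (auto simp: N_def D_def)
  have K1: "2 powr ?p * 2 powr \<alpha> \<le> 12 powr ?p * 2 powr \<alpha>" "4 powr ?p * 2 powr ?p \<le> 12 powr ?p * 2 powr \<alpha>"
     "2 powr ?p * 3 powr ?p \<le> 12 powr ?p * 2 powr \<alpha>"
  proof -
    show "2 powr ?p * 2 powr \<alpha> \<le> 12 powr ?p * 2 powr \<alpha>" using \<alpha> by (intro mult_right_mono powr_mono2) auto
    have "4 powr ?p * 2 powr ?p = 8 powr ?p" "2 powr ?p * 3 powr ?p = 6 powr ?p" by (simp_all flip: powr_mult)
    moreover have "8 powr ?p \<le> 12 powr ?p" "6 powr ?p \<le> 12 powr ?p" using \<alpha> by (auto intro!: powr_mono2)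
    moreover have "12 powr ?p * 1 \<le> 12 powr ?p * 2 powr \<alpha>" using \<alpha> by (intro mult_left_mono) (auto simp: ge_one_powr_ge_zero)
    ultimately show "4 powr ?p * 2 powr ?p \<le> 12 powr ?p * 2 powr \<alpha>" "2 powr ?p * 3 powr ?p \<le> 12 powr ?p * 2 powr \<alpha>" by linarith+
  qed
  let ?K = "12 powr ?p * 2 powr \<alpha>"
  have h: "heat_profile \<alpha> (x - y) = N (x - y) powr (- ?p) * D (x - y) powr (- \<alpha>)"
    by (simp add: heat_profile_def N_def D_def)
  have hle: "heat_profile \<alpha> (x - y) \<le> N (x - y) powr (- ?p)"
    unfolding h using \<alpha> D1[of "x - y"] powr_mono2'[of "- \<alpha>" 1 "D (x - y)"] by (intro mult_left_le) auto
  define S where "S = D x powr (- \<alpha>) * N y powr (- ?p) + (D x + l1norm (x - y)) powr (- ?p) + (D x + l1norm y) powr (- ?p)"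
  have S: "D x powr (- \<alpha>) * N y powr (- ?p) \<le> S" "(D x + l1norm (x - y)) powr (- ?p) \<le> S" "(D x + l1norm y) powr (- ?p) \<le> S"
    unfolding S_def by (auto intro!: add_nonneg_nonneg)
  have S0: "S \<ge> 0" unfolding S_def by auto
  have main: "N y powr (- ?p) * heat_profile \<alpha> (x - y) \<le> ?K * N x powr (- ?p) * S"
    using jump_trichotomy[OF True, of x]
  proof (elim disjE conjE)
    assume a: "1 + l1norm x \<le> 2 * (1 + l1norm (x - y))" "1 + gap x \<le> 2 * (1 + gap (x - y))"
    have "N (x - y) powr (- ?p) \<le> 2 powr ?p * N x powr (- ?p)"
      using a N1[of x] \<alpha> by (intro powr_neg_le_scale) (auto simp: N_def)
    moreover have "D (x - y) powr (- \<alpha>) \<le> 2 powr \<alpha> * D x powr (- \<alpha>)"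
      using a D1[of x] \<alpha> by (intro powr_neg_le_scale) (auto simp: D_def)
    ultimately have "N y powr (- ?p) * heat_profile \<alpha> (x - y) \<le> N y powr (- ?p) * ((2 powr ?p * N x powr (- ?p)) * (2 powr \<alpha> * D x powr (- \<alpha>)))"
      unfolding h by (intro mult_left_mono mult_mono) auto
    also have "\<dots> = (2 powr ?p * 2 powr \<alpha>) * N x powr (- ?p) * (D x powr (- \<alpha>) * N y powr (- ?p))" by (simp only: mult_ac)
    also have "\<dots> \<le> ?K * N x powr (- ?p) * S"
      by (rule mult_mono[OF mult_right_mono[OF K1(1)] S(1)]) (use S0 in auto)
    finally show ?thesis .
  next
    assume a: "1 + l1norm x \<le> 4 * (1 + l1norm y)" "1 + gap x \<le> 1 + l1norm (x - y)"
    have "N y powr (- ?p) \<le> 4 powr ?p * N x powr (- ?p)"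
      using a N1[of x] \<alpha> by (intro powr_neg_le_scale) (auto simp: N_def)
    moreover have "N (x - y) powr (- ?p) \<le> 2 powr ?p * (D x + l1norm (x - y)) powr (- ?p)"
      using a D1[of x] l1norm_nonneg(1)[of "x - y"] \<alpha> by (intro powr_neg_le_scale) (auto simp: N_def D_def)
    ultimately have "N y powr (- ?p) * heat_profile \<alpha> (x - y) \<le> (4 powr ?p * N x powr (- ?p)) * (2 powr ?p * (D x + l1norm (x - y)) powr (- ?p))"
      using hle by (intro mult_mono) (auto intro: less_imp_le[OF heat_profile_pos])
    also have "\<dots> = (4 powr ?p * 2 powr ?p) * N x powr (- ?p) * (D x + l1norm (x - y)) powr (- ?p)" by (simp only: mult_ac)
    also have "\<dots> \<le> ?K * N x powr (- ?p) * S"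
      by (rule mult_mono[OF mult_right_mono[OF K1(2)] S(2)]) (use S0 in auto)
    finally show ?thesis .
  next
    assume a: "1 + l1norm x \<le> 2 * (1 + l1norm (x - y))" "1 + gap x \<le> 2 * (1 + l1norm y)"
    have "N (x - y) powr (- ?p) \<le> 2 powr ?p * N x powr (- ?p)"
      using a N1[of x] \<alpha> by (intro powr_neg_le_scale) (auto simp: N_def)
    moreover have "N y powr (- ?p) \<le> 3 powr ?p * (D x + l1norm y) powr (- ?p)"
      using a D1[of x] l1norm_nonneg(1)[of y] \<alpha> by (intro powr_neg_le_scale) (auto simp: N_def D_def)
    ultimately have "N y powr (- ?p) * heat_profile \<alpha> (x - y) \<le> (3 powr ?p * (D x + l1norm y) powr (- ?p)) * (2 powr ?p * N x powr (- ?p))"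
      using hle by (intro mult_mono) (auto intro: less_imp_le[OF heat_profile_pos])
    also have "\<dots> = (2 powr ?p * 3 powr ?p) * N x powr (- ?p) * (D x + l1norm y) powr (- ?p)" by (simp only: mult_ac)
    also have "\<dots> \<le> ?K * N x powr (- ?p) * S"
      by (rule mult_mono[OF mult_right_mono[OF K1(3)] S(3)]) (use S0 in auto)
    finally show ?thesis .
  qed
  have "large_jumps \<alpha> c y * heat_profile \<alpha> (x - y) \<le> (c * 2 powr ?p * N y powr (- ?p)) * heat_profile \<alpha> (x - y)"
    using large_jumps_le[OF c \<alpha>, of y] by (intro mult_right_mono) (auto simp: N_def intro: less_imp_le[OF heat_profile_pos])
  also have "\<dots> = c * 2 powr ?p * (N y powr (- ?p) * heat_profile \<alpha> (x - y))" by (simp only: mult_ac)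
  also have "\<dots> \<le> c * 2 powr ?p * (?K * N x powr (- ?p) * S)"
    using c by (intro mult_left_mono main) auto
  finally show ?thesis unfolding S_def p by (simp only: mult_ac)
qed

lemma convol_large_jumps_profile_le:
  assumes c: "c \<ge> 0" and \<alpha>: "\<alpha> > 0"
  shows "\<exists>C\<ge>0. \<forall>x. convol (large_jumps \<alpha> c) (heat_profile \<alpha>) x \<le> C * heat_profile \<alpha> x"
proof -
  let ?A = "4 / (\<alpha> * (1 + \<alpha>))"
  let ?K = "c * 2 powr (2 + \<alpha>) * (12 powr (2 + \<alpha>) * 2 powr \<alpha>)"
  have "convol (large_jumps \<alpha> c) (heat_profile \<alpha>) x \<le> ?K * (3 * ?A) * heat_profile \<alpha> x" for x
  proof -
    let ?N = "1 + l1norm x" and ?D = "1 + gap x"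
    have D: "?D > 0" using gap_nonneg(1)[of x] by linarith
    have i1: "integrable lborel (\<lambda>y. (1 + l1norm y) powr (- 2 - \<alpha>))"
      and i2: "integrable lborel (\<lambda>y. (?D + l1norm y) powr (- 2 - \<alpha>))"
      and i3: "integrable lborel (\<lambda>y. (?D + l1norm (x - y)) powr (- 2 - \<alpha>))"
      using integral_plane_powr(1)[of 1 \<alpha>] integral_plane_powr(1)[OF D \<alpha>]
        lborel_integrable_reflect[OF integral_plane_powr(1)[OF D \<alpha>], of x] \<alpha> by simp_all
    let ?S = "\<lambda>y. ?D powr (- \<alpha>) * (1 + l1norm y) powr (- 2 - \<alpha>) + (?D + l1norm (x - y)) powr (- 2 - \<alpha>) + (?D + l1norm y) powr (- 2 - \<alpha>)"
    have "(LINT y|lborel. ?S y) = ?D powr (- \<alpha>) * (LINT y|lborel. (1 + l1norm y) powr (- 2 - \<alpha>))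
      + (LINT y|lborel. (?D + l1norm (x - y)) powr (- 2 - \<alpha>)) + (LINT y|lborel. (?D + l1norm y) powr (- 2 - \<alpha>))"
      using i1 i2 i3 by simp
    also have "(LINT y|lborel. (?D + l1norm (x - y)) powr (- 2 - \<alpha>)) = (LINT y|lborel. (?D + l1norm y) powr (- 2 - \<alpha>))"
      by (rule lborel_integral_reflect[of "\<lambda>y. (?D + l1norm y) powr (- 2 - \<alpha>)"]) auto
    finally have S: "(LINT y|lborel. ?S y) = 3 * ?A * ?D powr (- \<alpha>)"
      using integral_plane_powr(2)[of 1 \<alpha>] integral_plane_powr(2)[OF D \<alpha>] \<alpha> by simp
    have "convol (large_jumps \<alpha> c) (heat_profile \<alpha>) x \<le> (LINT y|lborel. ?K * ?N powr (- 2 - \<alpha>) * ?S y)"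
      unfolding convol_def
    proof (rule integral_mono')
      show "integrable lborel (\<lambda>y. ?K * ?N powr (- 2 - \<alpha>) * ?S y)"
        by (intro integrable_mult_right Bochner_Integration.integrable_add i1 i2 i3)
      show "0 \<le> ?K * ?N powr (- 2 - \<alpha>) * ?S y" for y
        using c by (intro mult_nonneg_nonneg add_nonneg_nonneg) auto
    qed (rule heat_profile_jump_le[OF c \<alpha>])
    also have "\<dots> = ?K * ?N powr (- 2 - \<alpha>) * (3 * ?A * ?D powr (- \<alpha>))"
      unfolding integral_mult_right_zero S ..
    also have "\<dots> = ?K * (3 * ?A) * heat_profile \<alpha> x"
      unfolding heat_profile_def by (simp only: mult_ac)
    finally show ?thesis .
  qed
  then show ?thesis using c \<alpha> by (intro exI[of _ "?K * (3 * ?A)"]) auto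
qed

lemma integral_ge_on_box:
  fixes g :: "real \<times> real \<Rightarrow> real"
  assumes g: "integrable lborel g" "\<And>y. 0 \<le> g y" and k: "\<And>y. y \<in> cbox l u \<Longrightarrow> k \<le> g y"
    and lu: "fst l \<le> fst u" "snd l \<le> snd u"
  shows "k * ((fst u - fst l) * (snd u - snd l)) \<le> (LINT y|lborel. g y)"
proof -
  have "measure lborel (cbox l u) = (fst u - fst l) * (snd u - snd l)"
    using lu content_Pair[of "fst l" "snd l" "fst u" "snd u"] by simp
  then have "k * ((fst u - fst l) * (snd u - snd l)) = (LINT y|lborel. k * indicator (cbox l u) y)"
    by simp
  also have "\<dots> \<le> (LINT y|lborel. g y)"
  proof (rule integral_mono)
    show "integrable lborel (\<lambda>y. k * indicator (cbox l u) y)"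
      using emeasure_bounded_finite[OF bounded_cbox, of l u] by (intro integrable_mult_right integrable_real_indicator) auto
    show "k * indicator (cbox l u) y \<le> g y" for y using k[of y] g(2)[of y] by (auto simp: indicator_def)
  qed (rule g(1))
  finally show ?thesis .
qed

lemma mem_cbox_prod: "y \<in> cbox l u \<longleftrightarrow> fst l \<le> fst y \<and> fst y \<le> fst u \<and> snd l \<le> snd y \<and> snd y \<le> snd (u :: real \<times> real)"
  by (cases l, cases u, cases y) auto

lemma large_jumps_ge:
  assumes c: "c \<ge> 0" and \<alpha>: "\<alpha> > 0" and y: "fst y * snd y > 0" "l1norm y > 1" and B: "l1norm y \<le> B"
  shows "c * B powr (- 2 - \<alpha>) \<le> large_jumps \<alpha> c y"
proof -
  have "B powr (- 2 - \<alpha>) \<le> l1norm y powr (- 2 - \<alpha>)" using y B \<alpha> by (intro powr_mono2') auto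
  then show ?thesis using y c same_sign_l1norm[OF y(1)] by (simp add: large_jumps_def mult_left_mono)
qed

text \<open>
One jump suffices to reach a point \<open>w\<close> well inside the cone from near the origin: a small box
around \<open>w\<close> still lies in the cone.
\<close>

lemma convol_large_jumps_ge:
  assumes c: "c > 0" and \<alpha>: "\<alpha> > 0" and \<delta>: "0 < \<delta>" "\<delta> \<le> 1 / 4" and "\<kappa> \<ge> 0"
    and [measurable]: "f \<in> borel_measurable borel" and f: "\<And>y. 0 \<le> f y" "\<And>y. f y \<le> M"
    and near: "\<And>y. \<bar>fst y\<bar> \<le> \<delta> \<Longrightarrow> \<bar>snd y\<bar> \<le> \<delta> \<Longrightarrow> \<kappa> \<le> f y"
    and w: "fst w * snd w > 0" "1 \<le> \<bar>fst w\<bar>" "1 \<le> \<bar>snd w\<bar>"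
  shows "c * \<kappa> * (2 * \<delta>)\<^sup>2 * (1 + l1norm w) powr (- 2 - \<alpha>) \<le> convol (large_jumps \<alpha> c) f w"
proof -
  have I: "integrable lborel (\<lambda>y. large_jumps \<alpha> c y * f (w - y))"
    by (rule integrable_mult_bounded(2)[where B=M]) (use large_jumps_integrable[of c \<alpha>] c \<alpha> f in auto)
  have sg: "(fst w \<ge> 1 \<and> snd w \<ge> 1) \<or> (fst w \<le> -1 \<and> snd w \<le> -1)"
    using w by (auto simp: abs_if zero_less_mult_iff split: if_splits)
  have "c * (1 + l1norm w) powr (- 2 - \<alpha>) * \<kappa> * ((fst (w + (\<delta>, \<delta>)) - fst (w - (\<delta>, \<delta>))) * (snd (w + (\<delta>, \<delta>)) - snd (w - (\<delta>, \<delta>))))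
     \<le> (LINT y|lborel. large_jumps \<alpha> c y * f (w - y))"
  proof (rule integral_ge_on_box[OF I])
    show "0 \<le> large_jumps \<alpha> c y * f (w - y)" for y using f large_jumps_nonneg[of c] c by simp
    fix y assume "y \<in> cbox (w - (\<delta>, \<delta>)) (w + (\<delta>, \<delta>))"
    then have y: "fst w - \<delta> \<le> fst y" "fst y \<le> fst w + \<delta>" "snd w - \<delta> \<le> snd y" "snd y \<le> snd w + \<delta>"
      by (auto simp: mem_cbox_prod)
    have "(fst y > 1/2 \<and> snd y > 1/2) \<or> (fst y < -1/2 \<and> snd y < -1/2)" using y \<delta> sg by auto
    then have "fst y * snd y > 0" "l1norm y > 1" by (auto simp: zero_less_mult_iff l1norm_def)
    moreover have "l1norm y \<le> 1 + l1norm w" using y \<delta> unfolding l1norm_def by (simp add: abs_if)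
    ultimately have "c * (1 + l1norm w) powr (- 2 - \<alpha>) \<le> large_jumps \<alpha> c y"
      using c \<alpha> by (intro large_jumps_ge) auto
    moreover have "\<kappa> \<le> f (w - y)" using y by (intro near) (auto simp: abs_le_iff)
    ultimately show "c * (1 + l1norm w) powr (- 2 - \<alpha>) * \<kappa> \<le> large_jumps \<alpha> c y * f (w - y)"
      using \<open>\<kappa> \<ge> 0\<close> large_jumps_nonneg[of c \<alpha> y] c by (intro mult_mono) auto
  qed (use \<delta> in auto)
  then show ?thesis unfolding convol_def by (simp add: power2_eq_square mult_ac)
qed

text \<open>
Where to put the first of two jumps: the box has side \<open>1 + gap x\<close>, lies in the half of the cone opposite
to \<open>x\<close> at distance comparable to its side, and subtracting any of its points from \<open>x\<close> leads into the
interior of the cone.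
\<close>

lemma counter_jump_box:
  obtains l u :: "real \<times> real" where "fst u - fst l = 1 + gap x" "snd u - snd l = 1 + gap x"
    "\<And>y. y \<in> cbox l u \<Longrightarrow> fst y * snd y > 0 \<and> 2 * (1 + gap x) \<le> l1norm y \<and> l1norm y \<le> 4 * (1 + gap x)
          \<and> fst (x - y) * snd (x - y) > 0 \<and> 1 \<le> \<bar>fst (x - y)\<bar> \<and> 1 \<le> \<bar>snd (x - y)\<bar>"
proof (cases "fst x + snd x \<ge> 0")
  case True
  define D where "D = 1 + gap x"
  have D: "D \<ge> 1" by (simp add: D_def)
  have "gap x = max 0 (- min (fst x) (snd x))" using gap_eq_of_sum_nonneg[OF True] by simp
  then have xD: "fst x + D \<ge> 1" "snd x + D \<ge> 1" unfolding D_def by (simp_all add: max_def min_def)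
  show ?thesis
  proof (rule that[of "(- D, - D)" "(- 2 * D, - 2 * D)", folded D_def])
    fix y :: "real \<times> real" assume "y \<in> cbox (- 2 * D, - 2 * D) (- D, - D)"
    then have y: "- 2 * D \<le> fst y" "fst y \<le> - D" "- 2 * D \<le> snd y" "snd y \<le> - D" by (auto simp: mem_cbox_prod)
    then have "fst y < 0" "snd y < 0" "fst (x - y) \<ge> 1" "snd (x - y) \<ge> 1" using D xD by auto
    moreover from this have "fst y * snd y > 0" "fst (x - y) * snd (x - y) > 0"
      by (auto intro: mult_neg_neg mult_pos_pos)
    ultimately show "fst y * snd y > 0 \<and> 2 * D \<le> l1norm y \<and> l1norm y \<le> 4 * D
          \<and> fst (x - y) * snd (x - y) > 0 \<and> 1 \<le> \<bar>fst (x - y)\<bar> \<and> 1 \<le> \<bar>snd (x - y)\<bar>"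
      using y unfolding l1norm_def by linarith
  qed auto
next
  case False
  define D where "D = 1 + gap x"
  have D: "D \<ge> 1" by (simp add: D_def)
  have "- fst x + - snd x \<ge> 0" using False by simp
  from gap_eq_of_sum_nonneg[OF this] have "gap x = max 0 (- min (- fst x) (- snd x))"
    using gap_uminus[of x] by (cases x) simp
  then have xD: "fst x - D \<le> -1" "snd x - D \<le> -1" unfolding D_def by (simp_all add: max_def min_def)
  show ?thesis
  proof (rule that[of "(2 * D, 2 * D)" "(D, D)", folded D_def])
    fix y :: "real \<times> real" assume "y \<in> cbox (D, D) (2 * D, 2 * D)"
    then have y: "D \<le> fst y" "fst y \<le> 2 * D" "D \<le> snd y" "snd y \<le> 2 * D" by (auto simp: mem_cbox_prod)
    then have "fst y > 0" "snd y > 0" "fst (x - y) \<le> -1" "snd (x - y) \<le> -1" using D xD by auto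
    moreover from this have "fst y * snd y > 0" "fst (x - y) * snd (x - y) > 0"
      by (auto intro: mult_neg_neg mult_pos_pos)
    ultimately show "fst y * snd y > 0 \<and> 2 * D \<le> l1norm y \<and> l1norm y \<le> 4 * D
          \<and> fst (x - y) * snd (x - y) > 0 \<and> 1 \<le> \<bar>fst (x - y)\<bar> \<and> 1 \<le> \<bar>snd (x - y)\<bar>"
      using y unfolding l1norm_def by linarith
  qed auto
qed

text \<open>
The box has area \<open>D\<^sup>2\<close> with \<open>D = 1 + gap x\<close>, the first jump has density of order \<open>D powr (- 2 - \<alpha>)\<close> on it,
and the second one has density of order \<open>(1 + l1norm x) powr (- 2 - \<alpha>)\<close>. The product is the profile,
uniformly in \<open>x\<close>, inside as well as outside the cone.
\<close>

lemma convol_convol_large_jumps_ge: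
  assumes c: "c > 0" and \<alpha>: "\<alpha> > 0" and \<delta>: "0 < \<delta>" and \<kappa>: "\<kappa> > 0"
    and [measurable]: "f \<in> borel_measurable borel" and f: "\<And>y. 0 \<le> f y" "\<And>y. f y \<le> M"
    and near': "\<And>y. \<bar>fst y\<bar> \<le> \<delta> \<Longrightarrow> \<bar>snd y\<bar> \<le> \<delta> \<Longrightarrow> \<kappa> \<le> f y"
  shows "\<exists>C>0. \<forall>x. C * heat_profile \<alpha> x \<le> (convol (large_jumps \<alpha> c) ^^ 2) f x"
proof -
  \<comment> \<open>Boxes of half side at most \<open>1 / 4\<close> around points with coordinates of modulus at least one stay in the region of large jumps.\<close>
  define \<delta>' where "\<delta>' = min \<delta> (1/4)"
  have \<delta>': "0 < \<delta>'" "\<delta>' \<le> 1/4" using \<delta> by (auto simp: \<delta>'_def)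
  have near: "\<bar>fst y\<bar> \<le> \<delta>' \<Longrightarrow> \<bar>snd y\<bar> \<le> \<delta>' \<Longrightarrow> \<kappa> \<le> f y" for y
    using near'[of y] by (auto simp: \<delta>'_def)
  let ?J = "large_jumps \<alpha> c" and ?p = "2 + \<alpha>"
  define g where "g = convol ?J f"
  have J: "integrable lborel ?J" using large_jumps_integrable[of c \<alpha>] c \<alpha> by simp
  have J0: "?J y \<ge> 0" for y using large_jumps_nonneg[of c] c by simp
  have [measurable]: "g \<in> borel_measurable borel" unfolding g_def convol_def[abs_def] by measurable
  have g0: "g y \<ge> 0" for y unfolding g_def convol_def by (intro integral_nonneg_AE) (use J0 f in auto)
  have gM: "g y \<le> M * integral\<^sup>L lborel ?J" for y
  proof -
    have "M \<ge> 0" using f(1)[of 0] f(2)[of 0] by linarith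
    have "g y \<le> (LINT z|lborel. M * ?J z)"
      unfolding g_def convol_def
    proof (rule integral_mono')
      show "?J z * f (y - z) \<le> M * ?J z" for z
        using mult_left_mono[OF f(2)[of "y - z"] J0[of z]] by (simp add: mult.commute)
    qed (use J J0 \<open>M \<ge> 0\<close> in auto)
    then show ?thesis by simp
  qed
  let ?k = "c * \<kappa> * (2 * \<delta>')\<^sup>2"
  let ?C = "c * 4 powr (- ?p) * (?k * 5 powr (- ?p))"
  have "?C * heat_profile \<alpha> x \<le> (convol ?J ^^ 2) f x" for x
  proof -
    let ?N = "1 + l1norm x" and ?D = "1 + gap x"
    have D: "?D \<ge> 1" and DN: "?D \<le> ?N" using gap_le_l1norm[of x] by auto
    have I: "integrable lborel (\<lambda>y. ?J y * g (x - y))"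
      by (rule integrable_mult_bounded(2)[OF J, where B="M * integral\<^sup>L lborel ?J"]) (use g0 gM in auto)
    obtain l u :: "real \<times> real" where lu: "fst u - fst l = ?D" "snd u - snd l = ?D"
      and box: "\<And>y. y \<in> cbox l u \<Longrightarrow> fst y * snd y > 0 \<and> 2 * ?D \<le> l1norm y \<and> l1norm y \<le> 4 * ?D
          \<and> fst (x - y) * snd (x - y) > 0 \<and> 1 \<le> \<bar>fst (x - y)\<bar> \<and> 1 \<le> \<bar>snd (x - y)\<bar>"
      using counter_jump_box[of x] by blast
    have "(c * (4 * ?D) powr (- 2 - \<alpha>)) * (?k * (5 * ?N) powr (- 2 - \<alpha>)) * ((fst u - fst l) * (snd u - snd l)) \<le> (LINT y|lborel. ?J y * g (x - y))"
    proof (rule integral_ge_on_box[OF I])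
      show "0 \<le> ?J y * g (x - y)" for y using J0 g0 by simp
      fix y assume "y \<in> cbox l u"
      note b = box[OF this]
      have "2 * ?D \<le> l1norm y" using b by blast
      then have "l1norm y > 1" using D by argo
      then have "c * (4 * ?D) powr (- 2 - \<alpha>) \<le> ?J y"
        using b c \<alpha> D by (intro large_jumps_ge) auto
      moreover have "?k * (5 * ?N) powr (- 2 - \<alpha>) \<le> g (x - y)"
      proof -
        have "l1norm (x - y) \<le> l1norm x + l1norm y"
          using abs_triangle_ineq4[of "fst x" "fst y"] abs_triangle_ineq4[of "snd x" "snd y"] by (simp add: l1norm_def)
        then have "1 + l1norm (x - y) \<le> 5 * ?N" using b DN by argo
        then have "(5 * ?N) powr (- 2 - \<alpha>) \<le> (1 + l1norm (x - y)) powr (- 2 - \<alpha>)"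
          using l1norm_nonneg(1)[of "x - y"] \<alpha> by (intro powr_mono2') linarith+
        then have "?k * (5 * ?N) powr (- 2 - \<alpha>) \<le> ?k * (1 + l1norm (x - y)) powr (- 2 - \<alpha>)"
          using c \<kappa> by (intro mult_left_mono) auto
        also have "\<dots> \<le> g (x - y)"
          unfolding g_def by (rule convol_large_jumps_ge[where M=M]) (use c \<alpha> \<delta>' \<kappa> f near b in auto)
        finally show ?thesis .
      qed
      ultimately show "(c * (4 * ?D) powr (- 2 - \<alpha>)) * (?k * (5 * ?N) powr (- 2 - \<alpha>)) \<le> ?J y * g (x - y)"
        using J0 c \<kappa> by (intro mult_mono) auto
    qed (use lu D in argo)+
    also have "(LINT y|lborel. ?J y * g (x - y)) = (convol ?J ^^ 2) f x"
      by (simp add: numeral_2_eq_2 g_def convol_def)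
    also have "(c * (4 * ?D) powr (- 2 - \<alpha>)) * (?k * (5 * ?N) powr (- 2 - \<alpha>)) * ((fst u - fst l) * (snd u - snd l))
       = ?C * heat_profile \<alpha> x"
    proof -
      have "?D powr (- 2 - \<alpha>) * (?D * ?D) = ?D powr (- 2 - \<alpha>) * ?D powr 2" using D by (simp add: power2_eq_square)
      also have "\<dots> = ?D powr (- \<alpha>)" by (simp only: powr_add[symmetric]) simp
      finally have e: "?D powr (- 2 - \<alpha>) * (?D * ?D) = ?D powr (- \<alpha>)" .
      have "(c * (4 * ?D) powr (- 2 - \<alpha>)) * (?k * (5 * ?N) powr (- 2 - \<alpha>)) * (?D * ?D)
         = c * 4 powr (- 2 - \<alpha>) * (?k * 5 powr (- 2 - \<alpha>)) * ?N powr (- 2 - \<alpha>) * (?D powr (- 2 - \<alpha>) * (?D * ?D))"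
        using D DN by (simp only: powr_mult mult_ac)
      then show ?thesis unfolding lu e heat_profile_def by (simp add: mult_ac)
    qed
    finally show ?thesis .
  qed
  then show ?thesis using c \<kappa> \<delta>' by (intro exI[of _ ?C]) auto
qed

section \<open>The stable Levy density on the double cone\<close>

definition cone_density :: "real \<Rightarrow> real \<times> real \<Rightarrow> real" where
  "cone_density \<alpha> y = (if fst y * snd y > 0 then \<bar>fst y + snd y\<bar> powr (- 2 - \<alpha>) else 0)"

lemma cone_density_measurable [measurable]: "cone_density \<alpha> \<in> borel_measurable borel"
  unfolding cone_density_def[abs_def] by measurable

lemma cone_density_nonneg: "0 \<le> cone_density \<alpha> y" by (simp add: cone_density_def)

lemma cone_density_uminus: "cone_density \<alpha> (- y) = cone_density \<alpha> y"
proof -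
  have "\<bar>- fst y - snd y\<bar> = \<bar>fst y + snd y\<bar>" by (simp add: abs_if)
  then show ?thesis by (simp add: cone_density_def)
qed

lemma Pair_real_measurable [measurable]:
  assumes [measurable]: "f \<in> borel_measurable M" "g \<in> borel_measurable M"
  shows "(\<lambda>x. (f x, g x) :: real \<times> real) \<in> borel_measurable M"
  by (subst borel_prod[symmetric]) measurable

text \<open>
Change of variables \<open>(a, b) = (u * z, (1 - u) * z)\<close>, done one coordinate at a time: a shear
\<open>b = z - a\<close> and then a scaling \<open>a = u * z\<close> for fixed \<open>z\<close>. The condition \<open>a * b > 0\<close> becomes \<open>0 < u < 1\<close>, and the
Jacobian \<open>\<bar>z\<bar>\<close> turns the exponent \<open>- 2 - \<alpha>\<close> into the exponent \<open>- 1 - \<alpha>\<close> of the one-dimensional stable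
law.
\<close>

lemma cone_integral_polar:
  fixes G :: "real \<times> real \<Rightarrow> ennreal"
  assumes [measurable]: "G \<in> borel_measurable borel"
  shows "(\<integral>\<^sup>+y. G y * ennreal (cone_density \<alpha> y) \<partial>lborel) =
    (\<integral>\<^sup>+u. indicator {0<..<1} u * (\<integral>\<^sup>+z. G (u * z, (1 - u) * z) * ennreal (\<bar>z\<bar> powr (- 1 - \<alpha>)) \<partial>lborel) \<partial>lborel)"
proof -
  let ?H = "\<lambda>y. G y * ennreal (cone_density \<alpha> y)"
  let ?R = "\<lambda>u z. indicator {0<..<1} u * (G (u * z, (1 - u) * z) * ennreal (\<bar>z\<bar> powr (- 1 - \<alpha>)))"
  have "(\<integral>\<^sup>+y. ?H y \<partial>lborel) = (\<integral>\<^sup>+a. \<integral>\<^sup>+b. ?H (a, b) \<partial>lborel \<partial>lborel)"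
    by (rule nn_integral_lborel_fst) measurable
  also have "\<dots> = (\<integral>\<^sup>+a. \<integral>\<^sup>+z. ?H (a, z - a) \<partial>lborel \<partial>lborel)"
  proof (rule nn_integral_cong)
    fix a :: real
    have "(\<integral>\<^sup>+b. ?H (a, b) \<partial>lborel) = ennreal \<bar>1\<bar> * (\<integral>\<^sup>+z. ?H (a, - a + 1 * z) \<partial>lborel)"
      by (rule nn_integral_real_affine) measurable
    then show "(\<integral>\<^sup>+b. ?H (a, b) \<partial>lborel) = (\<integral>\<^sup>+z. ?H (a, z - a) \<partial>lborel)" by simp
  qed
  also have "\<dots> = (\<integral>\<^sup>+z. \<integral>\<^sup>+a. ?H (a, z - a) \<partial>lborel \<partial>lborel)"
    by (rule lborel_pair.Fubini'[symmetric]) measurable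
  also have "\<dots> = (\<integral>\<^sup>+z. \<integral>\<^sup>+u. ?R u z \<partial>lborel \<partial>lborel)"
  proof (rule nn_integral_cong)
    fix z :: real
    show "(\<integral>\<^sup>+a. ?H (a, z - a) \<partial>lborel) = (\<integral>\<^sup>+u. ?R u z \<partial>lborel)"
    proof (cases "z = 0")
      case True
      then show ?thesis by (simp add: cone_density_def mult_less_0_iff not_less)
    next
      case False
      have "(\<integral>\<^sup>+a. ?H (a, z - a) \<partial>lborel) = ennreal \<bar>z\<bar> * (\<integral>\<^sup>+u. ?H (0 + z * u, z - (0 + z * u)) \<partial>lborel)"
        by (rule nn_integral_real_affine[OF _ False]) measurable
      also have "\<dots> = (\<integral>\<^sup>+u. ennreal \<bar>z\<bar> * ?H (0 + z * u, z - (0 + z * u)) \<partial>lborel)"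
        by (rule nn_integral_cmult[symmetric]) measurable
      also have "\<dots> = (\<integral>\<^sup>+u. ?R u z \<partial>lborel)"
      proof (rule nn_integral_cong)
        fix u :: real
        have pt: "(0 + z * u, z - (0 + z * u)) = (u * z, (1 - u) * z)" by (simp add: algebra_simps)
        have "(u * z) * ((1 - u) * z) = (z * z) * (u * (1 - u))" by (simp add: algebra_simps)
        moreover have "z * z > 0" using False by (simp add: zero_less_mult_iff) linarith
        ultimately have "(u * z) * ((1 - u) * z) > 0 \<longleftrightarrow> u * (1 - u) > 0"
          by (metis mult_pos_pos zero_less_mult_pos)
        also have "\<dots> \<longleftrightarrow> u \<in> {0<..<1}" by (auto simp: zero_less_mult_iff)
        finally have sg: "(u * z) * ((1 - u) * z) > 0 \<longleftrightarrow> u \<in> {0<..<1}" .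
        have sm: "u * z + (1 - u) * z = z" by (simp add: algebra_simps)
        have "\<bar>z\<bar> powr (- 1 - \<alpha>) = \<bar>z\<bar> powr 1 * \<bar>z\<bar> powr (- 2 - \<alpha>)" by (simp only: powr_add[symmetric]) simp
        then have pw: "\<bar>z\<bar> powr (- 1 - \<alpha>) = \<bar>z\<bar> * \<bar>z\<bar> powr (- 2 - \<alpha>)" using False by simp
        show "ennreal \<bar>z\<bar> * ?H (0 + z * u, z - (0 + z * u)) = ?R u z"
          unfolding pt cone_density_def fst_conv snd_conv sg sm pw
          by (simp add: indicator_def ennreal_mult mult_ac)
      qed
      finally show ?thesis .
    qed
  qed
  also have "\<dots> = (\<integral>\<^sup>+u. \<integral>\<^sup>+z. ?R u z \<partial>lborel \<partial>lborel)"
    by (rule lborel_pair.Fubini') measurable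
  also have "\<dots> = (\<integral>\<^sup>+u. indicator {0<..<1} u * (\<integral>\<^sup>+z. G (u * z, (1 - u) * z) * ennreal (\<bar>z\<bar> powr (- 1 - \<alpha>)) \<partial>lborel) \<partial>lborel)"
    by (intro nn_integral_cong nn_integral_cmult) measurable
  finally show ?thesis .
qed

lemma nn_integral_small_jumps_finite:
  assumes "\<alpha> < 2"
  shows "(\<integral>\<^sup>+z. ennreal (if \<bar>z\<bar> \<le> 1 then z\<^sup>2 * \<bar>z\<bar> powr (- 1 - \<alpha>) else 0) \<partial>lborel) < \<infinity>"
proof -
  let ?f = "\<lambda>z::real. ennreal (indicator {0..1} z * z powr (1 - \<alpha>))"
  have I: "(\<integral>\<^sup>+z. ?f z \<partial>lborel) = ennreal (1 powr (1 - \<alpha> + 1) / (1 - \<alpha> + 1))"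
    using nn_integral_has_integral_lebesgue[OF _ has_integral_powr_from_0[of "1 - \<alpha>" 1]] assms by simp
  have "(\<integral>\<^sup>+z. ennreal (if \<bar>z\<bar> \<le> 1 then z\<^sup>2 * \<bar>z\<bar> powr (- 1 - \<alpha>) else 0) \<partial>lborel) \<le> (\<integral>\<^sup>+z. ?f z + ?f (0 - z) \<partial>lborel)"
  proof (rule nn_integral_mono)
    fix z :: real
    have "z\<^sup>2 * \<bar>z\<bar> powr (- 1 - \<alpha>) = \<bar>z\<bar> powr (1 - \<alpha>)"
    proof (cases "z = 0")
      case False
      then have "z\<^sup>2 = \<bar>z\<bar> powr 2" by simp
      then show ?thesis by (simp only: powr_add[symmetric]) simp
    qed simp
    then show "ennreal (if \<bar>z\<bar> \<le> 1 then z\<^sup>2 * \<bar>z\<bar> powr (- 1 - \<alpha>) else 0) \<le> ?f z + ?f (0 - z)"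
      by (cases "z \<ge> 0") (auto simp: indicator_def)
  qed
  also have "\<dots> = (\<integral>\<^sup>+z. ?f z \<partial>lborel) + (\<integral>\<^sup>+z. ?f (0 - z) \<partial>lborel)"
    by (rule nn_integral_add) auto
  also have "(\<integral>\<^sup>+z. ?f (0 - z) \<partial>lborel) = (\<integral>\<^sup>+z. ?f z \<partial>lborel)"
    by (rule nn_integral_reflect) auto
  finally show ?thesis unfolding I by (simp add: order_le_less_trans flip: ennreal_plus)
qed

text \<open>
The integral converges at the origin since \<open>\<alpha> < 2\<close> and at infinity since \<open>\<alpha> > 0\<close>; the dependence on \<open>w\<close>
follows by scaling.
\<close>

lemma stable_constant:
  assumes \<alpha>: "0 < \<alpha>" "\<alpha> < 2"
  shows "\<exists>K>0. \<forall>w. (\<integral>\<^sup>+z. ennreal ((1 - cos (z * w)) * \<bar>z\<bar> powr (- 1 - \<alpha>)) \<partial>lborel) = ennreal (K * \<bar>w\<bar> powr \<alpha>)"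
proof -
  let ?f = "\<lambda>z. ennreal ((1 - cos z) * \<bar>z\<bar> powr (- 1 - \<alpha>))"
  let ?I = "\<integral>\<^sup>+z. ?f z \<partial>lborel"
  have "?I \<le> (\<integral>\<^sup>+z. ennreal (if \<bar>z\<bar> \<le> 1 then z\<^sup>2 * \<bar>z\<bar> powr (- 1 - \<alpha>) else 0)
       + ennreal (2 * 2 powr (1 + \<alpha>)) * ennreal ((1 + \<bar>z\<bar>) powr (- 1 - \<alpha>)) \<partial>lborel)"
  proof (rule nn_integral_mono)
    fix z :: real
    show "?f z \<le> ennreal (if \<bar>z\<bar> \<le> 1 then z\<^sup>2 * \<bar>z\<bar> powr (- 1 - \<alpha>) else 0)
       + ennreal (2 * 2 powr (1 + \<alpha>)) * ennreal ((1 + \<bar>z\<bar>) powr (- 1 - \<alpha>))"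
    proof (cases "\<bar>z\<bar> \<le> 1")
      case True
      have "1 - cos z \<le> z\<^sup>2" using one_minus_cos_le[of z] zero_le_power2[of z] by linarith
      then have "?f z \<le> ennreal (z\<^sup>2 * \<bar>z\<bar> powr (- 1 - \<alpha>))" by (intro ennreal_leI mult_right_mono) auto
      then show ?thesis using True by (simp add: add_increasing2)
    next
      case False
      have "\<bar>z\<bar> powr (- (1 + \<alpha>)) \<le> 2 powr (1 + \<alpha>) * (1 + \<bar>z\<bar>) powr (- (1 + \<alpha>))"
        using False \<alpha> by (intro powr_neg_le_scale) auto
      moreover have "1 - cos z \<le> 2" using cos_ge_minus_one[of z] by linarith
      ultimately have "(1 - cos z) * \<bar>z\<bar> powr (- (1 + \<alpha>)) \<le> 2 * (2 powr (1 + \<alpha>) * (1 + \<bar>z\<bar>) powr (- (1 + \<alpha>)))"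
        by (intro mult_mono) auto
      then have "?f z \<le> ennreal (2 * 2 powr (1 + \<alpha>) * (1 + \<bar>z\<bar>) powr (- 1 - \<alpha>))"
        by (intro ennreal_leI) (simp add: mult_ac)
      then show ?thesis using False by (simp flip: ennreal_mult)
    qed
  qed
  also have "\<dots> = (\<integral>\<^sup>+z. ennreal (if \<bar>z\<bar> \<le> 1 then z\<^sup>2 * \<bar>z\<bar> powr (- 1 - \<alpha>) else 0) \<partial>lborel)
       + ennreal (2 * 2 powr (1 + \<alpha>)) * ennreal (2 / \<alpha> * 1 powr (- \<alpha>))"
    using nn_integral_line_powr[of 1 \<alpha>] \<alpha> by (subst nn_integral_add) (auto simp: nn_integral_cmult)
  also have "\<dots> < \<infinity>" using nn_integral_small_jumps_finite[OF \<alpha>(2)] by (simp add: ennreal_mult_less_top)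
  finally have fin: "?I < \<infinity>" .
  have "0 < ennreal ((1 - cos 1) * 2 powr (- 1 - \<alpha>)) * emeasure lborel {1..2::real}"
    using cos_monotone_0_pi[of 0 1] pi_gt3 by simp
  also have "\<dots> = (\<integral>\<^sup>+z. ennreal ((1 - cos 1) * 2 powr (- 1 - \<alpha>)) * indicator {1..2::real} z \<partial>lborel)"
    by (simp add: nn_integral_cmult_indicator)
  also have "\<dots> \<le> ?I"
  proof (rule nn_integral_mono)
    fix z :: real
    show "ennreal ((1 - cos 1) * 2 powr (- 1 - \<alpha>)) * indicator {1..2::real} z \<le> ?f z"
    proof (cases "z \<in> {1..2}")
      case True
      have "cos z \<le> cos 1" using True pi_gt3 by (intro cos_monotone_0_pi_le) auto
      moreover have "2 powr (- 1 - \<alpha>) \<le> \<bar>z\<bar> powr (- 1 - \<alpha>)" using True \<alpha> by (intro powr_mono2') auto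
      ultimately show ?thesis using True by (auto intro!: ennreal_leI mult_mono)
    qed simp
  qed
  finally have pos: "?I > 0" .
  define K where "K = enn2real ?I"
  have K: "?I = ennreal K" "K > 0" using fin pos unfolding K_def by (auto simp: enn2real_positive_iff)
  have "(\<integral>\<^sup>+z. ennreal ((1 - cos (z * w)) * \<bar>z\<bar> powr (- 1 - \<alpha>)) \<partial>lborel) = ennreal (K * \<bar>w\<bar> powr \<alpha>)" for w
  proof (cases "w = 0")
    case False
    have "?I = ennreal \<bar>w\<bar> * (\<integral>\<^sup>+z. ?f (0 + w * z) \<partial>lborel)"
      by (rule nn_integral_real_affine[OF _ False]) measurable
    also have "(\<lambda>z. ?f (0 + w * z)) = (\<lambda>z. ennreal (\<bar>w\<bar> powr (- 1 - \<alpha>)) * ennreal ((1 - cos (z * w)) * \<bar>z\<bar> powr (- 1 - \<alpha>)))"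
      by (auto simp: abs_mult powr_mult mult_ac simp flip: ennreal_mult)
    also have "ennreal \<bar>w\<bar> * (\<integral>\<^sup>+z. ennreal (\<bar>w\<bar> powr (- 1 - \<alpha>)) * ennreal ((1 - cos (z * w)) * \<bar>z\<bar> powr (- 1 - \<alpha>)) \<partial>lborel)
       = ennreal (\<bar>w\<bar> * \<bar>w\<bar> powr (- 1 - \<alpha>)) * (\<integral>\<^sup>+z. ennreal ((1 - cos (z * w)) * \<bar>z\<bar> powr (- 1 - \<alpha>)) \<partial>lborel)" (is "_ = _ * ?X")
      by (subst nn_integral_cmult) (auto simp: ennreal_mult mult_ac)
    also have "\<bar>w\<bar> * \<bar>w\<bar> powr (- 1 - \<alpha>) = \<bar>w\<bar> powr 1 * \<bar>w\<bar> powr (- 1 - \<alpha>)" using False by simp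
    also have "\<dots> = \<bar>w\<bar> powr (- \<alpha>)" by (simp only: powr_add[symmetric]) simp
    finally have "ennreal K = ennreal (\<bar>w\<bar> powr (- \<alpha>)) * ?X" using K by simp
    then have "ennreal (\<bar>w\<bar> powr \<alpha>) * ennreal K = ennreal (\<bar>w\<bar> powr \<alpha>) * ennreal (\<bar>w\<bar> powr (- \<alpha>)) * ?X"
      by (simp add: mult_ac)
    also have "ennreal (\<bar>w\<bar> powr \<alpha>) * ennreal (\<bar>w\<bar> powr (- \<alpha>)) = 1"
      using False by (simp flip: ennreal_mult powr_add)
    finally show ?thesis using K by (simp add: mult.commute flip: ennreal_mult)
  qed simp
  with K(2) show ?thesis by blast
qed

definition cone_exponent :: "real \<Rightarrow> real \<times> real \<Rightarrow> real" where
  "cone_exponent \<alpha> \<zeta> = (LINT u:{0..1}|lborel. \<bar>u * fst \<zeta> + (1 - u) * snd \<zeta>\<bar> powr \<alpha>)"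

lemma cone_exponent_integrable:
  assumes "\<alpha> > 0"
  shows "set_integrable lborel {0..1} (\<lambda>u. \<bar>u * p + (1 - u) * q\<bar> powr \<alpha> :: real)"
  unfolding set_integrable_def
  by (intro borel_integrable_compact continuous_on_powr' continuous_intros) (use assms in auto)

lemma cone_exponent_nonneg: "0 \<le> cone_exponent \<alpha> \<zeta>"
  unfolding cone_exponent_def set_lebesgue_integral_def by (intro integral_nonneg_AE) auto

lemma cone_levy_khintchine:
  assumes \<alpha>: "0 < \<alpha>" "\<alpha> < 2"
  shows "\<exists>K>0. \<forall>\<zeta>. (\<integral>\<^sup>+y. ennreal ((1 - cos (y \<bullet> \<zeta>)) * cone_density \<alpha> y) \<partial>lborel) = ennreal (K * cone_exponent \<alpha> \<zeta>)"
proof -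
  obtain K where K: "K > 0"
    "\<And>w. (\<integral>\<^sup>+z. ennreal ((1 - cos (z * w)) * \<bar>z\<bar> powr (- 1 - \<alpha>)) \<partial>lborel) = ennreal (K * \<bar>w\<bar> powr \<alpha>)"
    using stable_constant[OF \<alpha>] by blast
  have "(\<integral>\<^sup>+y. ennreal ((1 - cos (y \<bullet> \<zeta>)) * cone_density \<alpha> y) \<partial>lborel) = ennreal (K * cone_exponent \<alpha> \<zeta>)" for \<zeta>
  proof -
    let ?w = "\<lambda>u. u * fst \<zeta> + (1 - u) * snd \<zeta>"
    have inn: "(u * z, (1 - u) * z) \<bullet> \<zeta> = z * ?w u" for u z
      by (cases \<zeta>) (simp add: inner_Pair algebra_simps)
    have "(\<integral>\<^sup>+y. ennreal ((1 - cos (y \<bullet> \<zeta>)) * cone_density \<alpha> y) \<partial>lborel)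
       = (\<integral>\<^sup>+y. ennreal (1 - cos (y \<bullet> \<zeta>)) * ennreal (cone_density \<alpha> y) \<partial>lborel)"
      by (simp add: ennreal_mult cone_density_nonneg)
    also have "\<dots> = (\<integral>\<^sup>+u. indicator {0<..<1} u *
        (\<integral>\<^sup>+z. ennreal (1 - cos ((u * z, (1 - u) * z) \<bullet> \<zeta>)) * ennreal (\<bar>z\<bar> powr (- 1 - \<alpha>)) \<partial>lborel) \<partial>lborel)"
      by (rule cone_integral_polar) measurable
    also have "\<dots> = (\<integral>\<^sup>+u. indicator {0<..<1} u * ennreal (K * \<bar>?w u\<bar> powr \<alpha>) \<partial>lborel)"
      unfolding inn using K(2) by (simp flip: ennreal_mult)
    also have "\<dots> = (\<integral>\<^sup>+u. ennreal (K * (indicator {0..1} u *\<^sub>R \<bar>?w u\<bar> powr \<alpha>)) \<partial>lborel)"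
    proof (rule nn_integral_cong_AE)
      have "AE u in lborel. u \<noteq> (0::real)" "AE u in lborel. u \<noteq> (1::real)" by (rule AE_lborel_singleton)+
      then show "AE u in lborel. indicator {0<..<1} u * ennreal (K * \<bar>?w u\<bar> powr \<alpha>) = ennreal (K * (indicator {0..1} u *\<^sub>R \<bar>?w u\<bar> powr \<alpha>))"
        by eventually_elim (auto simp: indicator_def)
    qed
    also have "\<dots> = ennreal (LINT u|lborel. K * (indicator {0..1} u *\<^sub>R \<bar>?w u\<bar> powr \<alpha>))"
      by (rule nn_integral_eq_integral)
         (use cone_exponent_integrable[OF \<alpha>(1), of "fst \<zeta>" "snd \<zeta>"] K in \<open>auto simp: set_integrable_def\<close>)
    also have "(LINT u|lborel. K * (indicator {0..1} u *\<^sub>R \<bar>?w u\<bar> powr \<alpha>)) = K * cone_exponent \<alpha> \<zeta>"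
      unfolding cone_exponent_def set_lebesgue_integral_def by (rule integral_mult_right_zero)
    finally show ?thesis .
  qed
  then show ?thesis using K(1) by blast
qed


text \<open>
The larger of the two coordinates dominates on the quarter of the interval where its weight is at least
\<open>3 / 4\<close>.
\<close>

lemma cone_exponent_ge:
  assumes "\<alpha> > 0"
  shows "1 / 4 * (l1norm \<zeta> / 4) powr \<alpha> \<le> cone_exponent \<alpha> \<zeta>"
proof -
  obtain p q where \<zeta>: "\<zeta> = (p, q)" by (cases \<zeta>)
  let ?f = "\<lambda>u. indicator {0..1} u *\<^sub>R \<bar>u * p + (1 - u) * q\<bar> powr \<alpha>"
  define M where "M = l1norm \<zeta> / 4"
  have M: "M \<ge> 0" "l1norm \<zeta> = 4 * M" by (simp_all add: M_def)
  have If: "integrable lborel ?f" using cone_exponent_integrable[OF assms] by (simp add: set_integrable_def)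
  have *: "1 / 4 * M powr \<alpha> \<le> (LINT u|lborel. ?f u)"
    if S: "b = a + 1 / 4" "0 \<le> a" "b \<le> 1" and big: "\<And>u. a \<le> u \<Longrightarrow> u \<le> b \<Longrightarrow> M \<le> \<bar>u * p + (1 - u) * q\<bar>" for a b
  proof -
    have "1 / 4 * M powr \<alpha> = (LINT u|lborel. M powr \<alpha> * indicator {a..b} u)" using S by simp
    also have "\<dots> \<le> (LINT u|lborel. ?f u)"
    proof (rule integral_mono[OF _ If])
      show "integrable lborel (\<lambda>u. M powr \<alpha> * indicator {a..b} u)"
        by (intro integrable_mult_right integrable_real_indicator) (use S in auto)
      show "M powr \<alpha> * indicator {a..b} u \<le> ?f u" for u
        using S big[of u] assms M by (auto simp: indicator_def intro!: powr_mono2)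
    qed
    finally show ?thesis .
  qed
  have "1 / 4 * M powr \<alpha> \<le> (LINT u|lborel. ?f u)"
  proof (cases "\<bar>q\<bar> \<le> \<bar>p\<bar>")
    case True
    show ?thesis
    proof (rule *[of 1 "3/4"])
      fix u :: real assume u: "3 / 4 \<le> u" "u \<le> 1"
      have "\<bar>u * p\<bar> \<ge> 3 / 4 * \<bar>p\<bar>" using u mult_right_mono[of "3/4" u "\<bar>p\<bar>"] by (simp add: abs_mult)
      moreover have "\<bar>(1 - u) * q\<bar> \<le> 1 / 4 * \<bar>p\<bar>" using u True mult_mono[of "1 - u" "1/4" "\<bar>q\<bar>" "\<bar>p\<bar>"] by (simp add: abs_mult)
      moreover have "2 * M \<le> \<bar>p\<bar>" using True M(2) by (simp add: \<zeta> l1norm_def)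
      ultimately show "M \<le> \<bar>u * p + (1 - u) * q\<bar>" by linarith
    qed auto
  next
    case False
    show ?thesis
    proof (rule *[of "1/4" 0])
      fix u :: real assume u: "0 \<le> u" "u \<le> 1 / 4"
      have "\<bar>(1 - u) * q\<bar> \<ge> 3 / 4 * \<bar>q\<bar>" using u mult_right_mono[of "3/4" "1 - u" "\<bar>q\<bar>"] by (simp add: abs_mult)
      moreover have "\<bar>u * p\<bar> \<le> 1 / 4 * \<bar>q\<bar>" using u False mult_mono[of u "1/4" "\<bar>p\<bar>" "\<bar>q\<bar>"] by (simp add: abs_mult)
      moreover have "2 * M \<le> \<bar>q\<bar>" using False M(2) by (simp add: \<zeta> l1norm_def)
      ultimately show "M \<le> \<bar>u * p + (1 - u) * q\<bar>" by linarith
    qed auto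
  qed
  then show ?thesis by (simp add: cone_exponent_def set_lebesgue_integral_def \<zeta> M_def)
qed

text \<open>
From \<open>1 + e \<le> exp e\<close>, raised to the power \<open>p / \<alpha>\<close>.
\<close>

lemma exp_powr_decay:
  fixes c \<alpha> p :: real
  assumes c: "c > 0" and \<alpha>: "\<alpha> > 0" and p: "p > 0"
  shows "\<exists>C>0. \<forall>L\<ge>0. exp (- c * L powr \<alpha>) \<le> C * (1 + L) powr (- p)"
proof -
  \<comment> \<open>\<open>K\<close> is chosen such that \<open>(1 + L) powr \<alpha> \<le> K * (1 + c * L powr \<alpha> / q)\<close>.\<close>
  define q where "q = p / \<alpha>"
  have q: "q > 0" "p = \<alpha> * q" using \<alpha> p by (auto simp: q_def)
  define K where "K = 2 powr \<alpha> * max 1 (q / c)"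
  have K: "K > 0" by (simp add: K_def)
  have "exp (- c * L powr \<alpha>) \<le> K powr q * (1 + L) powr (- p)" if L: "L \<ge> 0" for L
  proof -
    let ?e = "1 + c * L powr \<alpha> / q"
    have e0: "c * L powr \<alpha> / q \<ge> 0" using c q by simp
    have "(1 + L) powr \<alpha> \<le> (2 * max 1 L) powr \<alpha>" using L \<alpha> by (intro powr_mono2) auto
    also have "\<dots> = 2 powr \<alpha> * max 1 L powr \<alpha>" by (rule powr_mult)
    also have "max 1 L powr \<alpha> \<le> 1 + L powr \<alpha>" by (simp add: max_def)
    also have "1 + L powr \<alpha> \<le> max 1 (q / c) * ?e"
    proof -
      have "1 * 1 \<le> max 1 (q / c) * 1" by simp
      moreover have "(q / c) * (c * L powr \<alpha> / q) \<le> max 1 (q / c) * (c * L powr \<alpha> / q)"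
        using e0 by (intro mult_right_mono) auto
      moreover have "(q / c) * (c * L powr \<alpha> / q) = L powr \<alpha>" using c q by simp
      ultimately show ?thesis by (simp only: distrib_left)
    qed
    finally have "(1 + L) powr \<alpha> \<le> K * ?e" by (simp add: K_def mult.assoc mult_left_mono)
    then have "((1 + L) powr \<alpha>) powr q \<le> (K * ?e) powr q" using q by (intro powr_mono2) auto
    also have "\<dots> = K powr q * ?e powr q" by (rule powr_mult)
    also have "?e powr q \<le> exp (c * L powr \<alpha> / q) powr q"
      using q e0 exp_ge_add_one_self[of "c * L powr \<alpha> / q"] by (intro powr_mono2) auto
    also have "exp (c * L powr \<alpha> / q) powr q = exp (c * L powr \<alpha>)" using q by (simp add: exp_powr_real)
    finally have "(1 + L) powr p \<le> K powr q * exp (c * L powr \<alpha>)"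
      by (simp add: powr_powr q mult_left_mono)
    then show ?thesis using L by (simp add: exp_minus powr_minus field_simps)
  qed
  then show ?thesis using K by (intro exI[of _ "K powr q"]) auto
qed

lemma exp_cone_exponent_integrable:
  assumes "c > 0" "\<alpha> > 0"
  shows "integrable lborel (\<lambda>\<zeta>. exp (- c * cone_exponent \<alpha> \<zeta>))"
proof -
  have c4: "c / 4 * (1 / 4) powr \<alpha> > 0" using assms by simp
  obtain C where C: "C > 0" "\<And>L. L \<ge> 0 \<Longrightarrow> exp (- (c / 4 * (1 / 4) powr \<alpha>) * L powr \<alpha>) \<le> C * (1 + L) powr (- 3)"
    using exp_powr_decay[OF c4 assms(2), of 3] by auto
  have m [measurable]: "cone_exponent \<alpha> \<in> borel_measurable borel"
    unfolding cone_exponent_def[abs_def] set_lebesgue_integral_def by measurable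
  show ?thesis
  proof (rule Bochner_Integration.integrable_bound)
    show "integrable lborel (\<lambda>\<zeta>. C * (1 + l1norm \<zeta>) powr (- 3))"
      using integral_plane_powr(1)[of 1 1] by simp
    have "exp (- c * cone_exponent \<alpha> \<zeta>) \<le> C * (1 + l1norm \<zeta>) powr (- 3)" for \<zeta>
    proof -
      have "c * (1 / 4 * (l1norm \<zeta> / 4) powr \<alpha>) \<le> c * cone_exponent \<alpha> \<zeta>"
        using cone_exponent_ge[OF assms(2), of \<zeta>] assms by (intro mult_left_mono) auto
      moreover have "(l1norm \<zeta> / 4) powr \<alpha> = (1 / 4) powr \<alpha> * l1norm \<zeta> powr \<alpha>"
        by (subst powr_mult[symmetric]) simp
      ultimately have "exp (- c * cone_exponent \<alpha> \<zeta>) \<le> exp (- (c / 4 * (1 / 4) powr \<alpha>) * l1norm \<zeta> powr \<alpha>)"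
        by simp
      also have "\<dots> \<le> C * (1 + l1norm \<zeta>) powr (- 3)" by (rule C(2)) simp
      finally show ?thesis .
    qed
    then show "AE \<zeta> in lborel. norm (exp (- c * cone_exponent \<alpha> \<zeta>)) \<le> norm (C * (1 + l1norm \<zeta>) powr (- 3))"
      using C(1) by simp
  qed measurable
qed

lemma cone_small_jumps_second_moment:
  assumes "\<alpha> < 2"
  shows "integrable lborel (\<lambda>y. (norm y)\<^sup>2 * (if \<bar>fst y + snd y\<bar> \<le> 1 then cone_density \<alpha> y else 0))"
proof (rule integrableI_bounded)
  let ?G = "\<lambda>y::real \<times> real. ennreal (if \<bar>fst y + snd y\<bar> \<le> 1 then (norm y)\<^sup>2 else 0)"
  have "(\<integral>\<^sup>+y. ennreal (norm ((norm y)\<^sup>2 * (if \<bar>fst y + snd y\<bar> \<le> 1 then cone_density \<alpha> y else 0))) \<partial>lborel)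
     = (\<integral>\<^sup>+y. ?G y * ennreal (cone_density \<alpha> y) \<partial>lborel)"
    by (intro nn_integral_cong) (auto simp: ennreal_mult cone_density_nonneg)
  also have "\<dots> = (\<integral>\<^sup>+u. indicator {0<..<1} u * (\<integral>\<^sup>+z. ?G (u * z, (1 - u) * z) * ennreal (\<bar>z\<bar> powr (- 1 - \<alpha>)) \<partial>lborel) \<partial>lborel)"
    by (rule cone_integral_polar) measurable
  also have "\<dots> \<le> (\<integral>\<^sup>+u. indicator {0<..<1} (u::real) * (\<integral>\<^sup>+z. ennreal (if \<bar>z\<bar> \<le> 1 then z\<^sup>2 * \<bar>z\<bar> powr (- 1 - \<alpha>) else 0) \<partial>lborel) \<partial>lborel)"
  proof (rule nn_integral_mono)
    fix u :: real
    show "indicator {0<..<1} u * (\<integral>\<^sup>+z. ?G (u * z, (1 - u) * z) * ennreal (\<bar>z\<bar> powr (- 1 - \<alpha>)) \<partial>lborel)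
       \<le> indicator {0<..<1} u * (\<integral>\<^sup>+z. ennreal (if \<bar>z\<bar> \<le> 1 then z\<^sup>2 * \<bar>z\<bar> powr (- 1 - \<alpha>) else 0) \<partial>lborel)"
    proof (cases "u \<in> {0<..<1}")
      case True
      have "(norm (u * z, (1 - u) * z))\<^sup>2 \<le> z\<^sup>2" for z
      proof -
        have "u\<^sup>2 + (1 - u)\<^sup>2 \<le> 1"
          using True mult_nonneg_nonneg[of u "1 - u"] by (simp add: power2_eq_square algebra_simps)
        from mult_right_mono[OF this, of "z\<^sup>2"] show ?thesis by (simp add: norm_Pair power_mult_distrib distrib_right)
      qed
      moreover have "u * z + (1 - u) * z = z" for z by (simp add: algebra_simps)
      ultimately have "?G (u * z, (1 - u) * z) * ennreal (\<bar>z\<bar> powr (- 1 - \<alpha>))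
          \<le> ennreal (if \<bar>z\<bar> \<le> 1 then z\<^sup>2 * \<bar>z\<bar> powr (- 1 - \<alpha>) else 0)" for z
        by (auto simp: mult_right_mono intro!: ennreal_leI simp flip: ennreal_mult)
      then show ?thesis by (intro mult_left_mono nn_integral_mono) auto
    qed simp
  qed
  also have "\<dots> < \<infinity>"
    using nn_integral_small_jumps_finite[OF assms] by (subst nn_integral_multc) (auto simp: ennreal_mult_less_top)
  finally show "(\<integral>\<^sup>+y. ennreal (norm ((norm y)\<^sup>2 * (if \<bar>fst y + snd y\<bar> \<le> 1 then cone_density \<alpha> y else 0))) \<partial>lborel) < \<infinity>" .
qed measurable

section \<open>Two-sided bounds at unit time\<close>

lemma heat_profile_le_1: "\<alpha> > 0 \<Longrightarrow> heat_profile \<alpha> y \<le> 1"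
proof -
  assume \<alpha>: "\<alpha> > 0"
  have "(1 + l1norm y) powr (- 2 - \<alpha>) \<le> 1 powr (- 2 - \<alpha>)" using \<alpha> by (intro powr_mono2') auto
  moreover have "(1 + gap y) powr (- \<alpha>) \<le> 1 powr (- \<alpha>)" using \<alpha> by (intro powr_mono2') auto
  ultimately show ?thesis unfolding heat_profile_def by (intro mult_le_one) auto
qed

lemma exp_norm_le_heat_profile:
  assumes \<alpha>: "\<alpha> > 0"
  shows "\<exists>C>0. \<forall>x. exp (- norm x) \<le> C * heat_profile \<alpha> x"
proof -
  obtain C where C: "C > 0" "\<And>L. L \<ge> 0 \<Longrightarrow> exp (- (1/2) * L powr 1) \<le> C * (1 + L) powr (- (2 + 2 * \<alpha>))"
    using exp_powr_decay[of "1/2" 1 "2 + 2 * \<alpha>"] \<alpha> by auto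
  have "exp (- norm x) \<le> C * heat_profile \<alpha> x" for x
  proof -
    have "l1norm x \<le> 2 * norm x"
      using norm_fst_le[of "fst x" "snd x"] norm_snd_le[of "snd x" "fst x"] by (simp add: l1norm_def)
    then have "exp (- norm x) \<le> exp (- (1/2) * l1norm x powr 1)" by simp
    also have "\<dots> \<le> C * (1 + l1norm x) powr (- (2 + 2 * \<alpha>))" by (rule C(2)) simp
    also have "(1 + l1norm x) powr (- (2 + 2 * \<alpha>)) = (1 + l1norm x) powr (- 2 - \<alpha>) * (1 + l1norm x) powr (- \<alpha>)"
      by (simp only: powr_add[symmetric]) (simp add: algebra_simps)
    also have "C * \<dots> \<le> C * heat_profile \<alpha> x"
      unfolding heat_profile_def using C(1) \<alpha> gap_le_l1norm[of x]
      by (intro mult_left_mono powr_mono2') auto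
    finally show ?thesis .
  qed
  then show ?thesis using C(1) by blast
qed

lemma convol_power_le:
  assumes J: "integrable lborel J" "\<And>y. J y \<ge> 0"
    and h: "h \<in> borel_measurable borel" "\<And>x. 0 \<le> h x" "\<And>x. h x \<le> 1"
    and C: "C \<ge> 0" "\<And>x. convol J h x \<le> C * h x"
    and A: "A \<ge> 0" and f: "\<And>x. f x \<le> A * h x"
  shows "(convol J ^^ n) f x \<le> A * C ^ n * h x"
proof (induction n arbitrary: x)
  case 0
  then show ?case using f by simp
next
  case (Suc n)
  have [measurable]: "h \<in> borel_measurable borel" by fact
  have I: "integrable lborel (\<lambda>y. J y * h (x - y))"
    by (rule integrable_mult_bounded(2)[OF J(1), where B=1]) (use h in auto)
  have "(convol J ^^ Suc n) f x \<le> (LINT y|lborel. A * C ^ n * (J y * h (x - y)))"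
    unfolding funpow.simps o_def convol_def[of J "(convol J ^^ n) f"]
  proof (rule integral_mono')
    show "integrable lborel (\<lambda>y. A * C ^ n * (J y * h (x - y)))" using I by (rule integrable_mult_right)
    show "J y * (convol J ^^ n) f (x - y) \<le> A * C ^ n * (J y * h (x - y))" for y
      using mult_left_mono[OF Suc.IH[of "x - y"] J(2)[of y]] by (simp only: mult_ac)
    show "0 \<le> A * C ^ n * (J y * h (x - y))" for y using A C J h by simp
  qed
  also have "\<dots> = A * C ^ n * convol J h x" by (simp add: convol_def)
  also have "\<dots> \<le> A * C ^ n * (C * h x)" using A C by (intro mult_left_mono) auto
  finally show ?case by (simp add: mult_ac)
qed

lemma isCont_fourier_int:
  assumes F: "integrable lborel F"
  shows "isCont (fourier_int F) x"
  unfolding continuous_at_sequentially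
proof (intro allI impI)
  fix u :: "nat \<Rightarrow> 'a" assume u: "u \<longlonglongrightarrow> x"
  have [measurable]: "F \<in> borel_measurable borel" using borel_measurable_integrable[OF F] by simp
  show "(fourier_int F \<circ> u) \<longlonglongrightarrow> fourier_int F x"
    unfolding o_def fourier_int_def
  proof (rule integral_dominated_convergence[where w="\<lambda>\<zeta>. norm (F \<zeta>)"])
    show "AE \<zeta> in lborel. (\<lambda>n. cis (u n \<bullet> \<zeta>) * F \<zeta>) \<longlonglongrightarrow> cis (x \<bullet> \<zeta>) * F \<zeta>"
      by (intro AE_I2 tendsto_intros isCont_tendsto_compose[of _ cis] u)
  qed (use F in \<open>auto simp: norm_mult\<close>)
qed

text \<open>
The constant \<open>c\<close> normalises the Levy density so that the exponent of the whole cone is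
\<open>cone_exponent \<alpha>\<close>.
\<close>

lemma cone_levy_decomposition:
  assumes \<alpha>: "0 < \<alpha>" "\<alpha> < 2"
  obtains c where "c > 0"
    "\<And>\<zeta>. levy_exponent (\<lambda>y. if \<bar>fst y + snd y\<bar> \<le> 1 then c * cone_density \<alpha> y else 0) \<zeta>
        = cone_exponent \<alpha> \<zeta> - levy_exponent (large_jumps \<alpha> c) \<zeta>"
proof -
  obtain K where K: "K > 0"
    "\<And>\<zeta>. (\<integral>\<^sup>+y. ennreal ((1 - cos (y \<bullet> \<zeta>)) * cone_density \<alpha> y) \<partial>lborel) = ennreal (K * cone_exponent \<alpha> \<zeta>)"
    using cone_levy_khintchine[OF \<alpha>] by blast
  let ?c = "1 / K"
  let ?J1 = "\<lambda>y. if \<bar>fst y + snd y\<bar> \<le> 1 then ?c * cone_density \<alpha> y else 0"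
  have "levy_exponent ?J1 \<zeta> = cone_exponent \<alpha> \<zeta> - levy_exponent (large_jumps \<alpha> ?c) \<zeta>" for \<zeta>
  proof -
    have "(\<integral>\<^sup>+y. ennreal ((1 - cos (y \<bullet> \<zeta>)) * (?c * cone_density \<alpha> y)) \<partial>lborel)
       = (\<integral>\<^sup>+y. ennreal ?c * ennreal ((1 - cos (y \<bullet> \<zeta>)) * cone_density \<alpha> y) \<partial>lborel)"
      using K(1) cone_density_nonneg by (intro nn_integral_cong) (simp add: mult_ac flip: ennreal_mult)
    also have "\<dots> = ennreal (cone_exponent \<alpha> \<zeta>)"
      using K cone_exponent_nonneg[of \<alpha> \<zeta>] by (simp add: nn_integral_cmult flip: ennreal_mult)
    finally have B: "has_bochner_integral lborel (\<lambda>y. (1 - cos (y \<bullet> \<zeta>)) * (?c * cone_density \<alpha> y)) (cone_exponent \<alpha> \<zeta>)"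
      using K(1) cone_density_nonneg cone_exponent_nonneg
      by (intro has_bochner_integral_nn_integral) auto
    have J2: "integrable lborel (\<lambda>y. (1 - cos (y \<bullet> \<zeta>)) * large_jumps \<alpha> ?c y)"
      using K(1) \<alpha> by (intro integrable_one_minus_cos_mult large_jumps_integrable) auto
    have "?J1 y = ?c * cone_density \<alpha> y - large_jumps \<alpha> ?c y" for y
      by (simp add: large_jumps_def cone_density_def)
    then have "levy_exponent ?J1 \<zeta> = (LINT y|lborel. (1 - cos (y \<bullet> \<zeta>)) * (?c * cone_density \<alpha> y) - (1 - cos (y \<bullet> \<zeta>)) * large_jumps \<alpha> ?c y)"
      unfolding levy_exponent_def by (simp only: right_diff_distrib)
    also have "\<dots> = cone_exponent \<alpha> \<zeta> - levy_exponent (large_jumps \<alpha> ?c) \<zeta>"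
      unfolding levy_exponent_def
      using Bochner_Integration.integral_diff[OF _ J2] B by (auto simp: has_bochner_integral_iff)
    finally show ?thesis .
  qed
  then show ?thesis using K(1) by (intro that[of ?c]) auto
qed

lemma levy_exponent_le:
  assumes "integrable lborel J" "\<And>y. J y \<ge> 0"
  shows "levy_exponent J \<zeta> \<le> 2 * integral\<^sup>L lborel J"
proof -
  have "levy_exponent J \<zeta> \<le> (LINT y|lborel. 2 * J y)"
    unfolding levy_exponent_def
  proof (rule integral_mono')
    show "(1 - cos (y \<bullet> \<zeta>)) * J y \<le> 2 * J y" for y
      using cos_ge_minus_one[of "y \<bullet> \<zeta>"] assms(2)[of y] by (intro mult_right_mono) (simp_all del: cos_ge_minus_one)
  qed (use assms in auto)
  then show ?thesis by simp
qed

text \<open>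
All that is used later about the part with bounded jumps. The lower bound near the origin comes from
continuity, the value at the origin being the integral of a positive function.
\<close>

lemma small_jumps_kernel:
  assumes \<alpha>: "0 < \<alpha>" "\<alpha> < 2" and c: "c > 0"
  defines "J \<equiv> \<lambda>y. if \<bar>fst y + snd y\<bar> \<le> 1 then c * cone_density \<alpha> y else 0"
  assumes E: "\<And>k. k > 0 \<Longrightarrow> integrable lborel (\<lambda>\<zeta>. exp (- levy_exponent J \<zeta> / k))"
  obtains g A \<delta> \<kappa> where "\<And>x. fourier_int (\<lambda>\<zeta>. complex_of_real (exp (- levy_exponent J \<zeta>))) x = complex_of_real (g x)"
    "\<And>x. 0 \<le> g x" "A > 0" "\<And>x. g x \<le> A * heat_profile \<alpha> x"
    "g \<in> borel_measurable borel" "\<delta> > 0" "\<kappa> > 0" "\<And>y. \<bar>fst y\<bar> \<le> \<delta> \<Longrightarrow> \<bar>snd y\<bar> \<le> \<delta> \<Longrightarrow> \<kappa> \<le> g y"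
proof -
  let ?F = "\<lambda>\<zeta>. complex_of_real (exp (- levy_exponent J \<zeta>))"
  define g where "g = (\<lambda>x. Re (fourier_int ?F x))"
  have Jm [measurable]: "J \<in> borel_measurable borel" unfolding J_def by measurable
  have J0: "J y \<ge> 0" for y using c cone_density_nonneg by (simp add: J_def)
  have Je: "J (- y) = J y" for y
  proof -
    have "\<bar>- fst y - snd y\<bar> = \<bar>fst y + snd y\<bar>" by (simp add: abs_if)
    then show ?thesis by (simp add: J_def cone_density_uminus)
  qed
  have Js: "norm y \<le> 1" if "J y \<noteq> 0" for y
  proof -
    have "fst y * snd y > 0" "\<bar>fst y + snd y\<bar> \<le> 1" using that by (auto simp: J_def cone_density_def split: if_splits)
    moreover have "norm y \<le> l1norm y"
      using sqrt_sum_squares_le_sum_abs[of "fst y" "snd y"] by (simp add: norm_prod_def l1norm_def)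
    ultimately show ?thesis using same_sign_l1norm[of y] by simp
  qed
  have J2: "integrable lborel (\<lambda>y. (norm y)\<^sup>2 * J y)"
  proof -
    have "(\<lambda>y. (norm y)\<^sup>2 * J y) = (\<lambda>y. c * ((norm y)\<^sup>2 * (if \<bar>fst y + snd y\<bar> \<le> 1 then cone_density \<alpha> y else 0)))"
      by (auto simp: J_def fun_eq_iff)
    then show ?thesis using cone_small_jumps_second_moment[OF \<alpha>(2)] by simp
  qed
  have Ee: "integrable lborel (\<lambda>\<zeta>. exp (- levy_exponent J \<zeta> / exp 1))" by (rule E) simp
  have IF: "integrable lborel ?F" using E[of 1] by (intro integrable_of_real) simp
  note D = fourier_exp_levy_decay[OF Jm J0 Je Js J2 Ee]
  define B where "B = exp (LINT y|lborel. (norm y)\<^sup>2 * J y) * (LINT \<zeta>|lborel. exp (- levy_exponent J \<zeta> / exp 1))"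
  have g: "fourier_int ?F x = complex_of_real (g x)" "0 \<le> g x" "g x \<le> B * exp (- norm x)" for x
    using D[of x] by (auto simp: g_def B_def complex_eq_iff)
  have B0: "B \<ge> 0" unfolding B_def by simp
  obtain C where C: "C > 0" "\<And>x. exp (- norm x) \<le> C * heat_profile \<alpha> x"
    using exp_norm_le_heat_profile[OF \<alpha>(1)] by blast
  have gA: "g x \<le> ((B + 1) * C) * heat_profile \<alpha> x" for x
  proof -
    have "g x \<le> (B + 1) * exp (- norm x)" using g(3)[of x] by (simp add: distrib_right add_increasing2)
    also have "\<dots> \<le> (B + 1) * (C * heat_profile \<alpha> x)" using B0 C(2) by (intro mult_left_mono) auto
    finally show ?thesis by (simp only: mult.assoc)
  qed
  have gm: "g \<in> borel_measurable borel" unfolding g_def by measurable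
  have g00: "g 0 > 0"
  proof -
    define m where "m = (LINT y|lborel. (norm y)\<^sup>2 * J y)"
    have "exp (- (2 * m)) \<le> exp (- levy_exponent J \<zeta>)" if "\<zeta> \<in> cbox (0, 0) (1, 1)" for \<zeta> :: "real \<times> real"
    proof -
      have n: "(norm \<zeta>)\<^sup>2 \<le> 2"
        using that power_le_one[of "fst \<zeta>" 2] power_le_one[of "snd \<zeta>" 2]
        by (simp add: mem_cbox_prod norm_prod_def)
      have "levy_exponent J \<zeta> \<le> (LINT y|lborel. 2 * ((norm y)\<^sup>2 * J y))"
        unfolding levy_exponent_def
      proof (rule integral_mono')
        fix y
        have "1 - cos (y \<bullet> \<zeta>) \<le> 2 * (norm y)\<^sup>2"
          using one_minus_cos_inner_le[of y \<zeta>] mult_right_mono[OF n, of "(norm y)\<^sup>2"] by simp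
        from mult_right_mono[OF this J0[of y]] show "(1 - cos (y \<bullet> \<zeta>)) * J y \<le> 2 * ((norm y)\<^sup>2 * J y)" by (simp only: mult.assoc)
      qed (use J2 J0 in auto)
      then show ?thesis by (simp add: m_def)
    qed
    then have "exp (- (2 * m)) * ((fst (1, 1 :: real) - fst (0, 0 :: real)) * (snd (1 :: real, 1) - snd (0 :: real, 0))) \<le> (LINT \<zeta>|lborel. exp (- levy_exponent J \<zeta>))"
      using E[of 1] by (intro integral_ge_on_box) auto
    moreover have "g 0 = (LINT \<zeta>|lborel. exp (- levy_exponent J \<zeta>))"
      by (simp add: g_def fourier_int_def)
    ultimately have "exp (- (2 * m)) \<le> g 0" by simp
    then show ?thesis by (rule less_le_trans[OF exp_gt_zero])
  qed
  have "isCont g 0" unfolding g_def by (rule isCont_Re[OF isCont_fourier_int[OF IF]])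
  then obtain d where d: "d > 0" "\<And>x. dist x 0 < d \<Longrightarrow> dist (g x) (g 0) < g 0 / 2"
    unfolding continuous_at_eps_delta using g00 by (metis half_gt_zero)
  have near: "g 0 / 2 \<le> g y" if "\<bar>fst y\<bar> \<le> d / 3" "\<bar>snd y\<bar> \<le> d / 3" for y
  proof -
    have "norm y \<le> \<bar>fst y\<bar> + \<bar>snd y\<bar>"
      using sqrt_sum_squares_le_sum_abs[of "fst y" "snd y"] by (simp add: norm_prod_def)
    then have "dist y 0 < d" using that d(1) by simp
    from d(2)[OF this] show ?thesis by (simp add: dist_real_def abs_if split: if_splits)
  qed
  show ?thesis
    by (rule that[of g "(B + 1) * C" "d / 3" "g 0 / 2"]) (use g gA gm g00 d(1) near B0 C(1) in auto)
qed

text \<open>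
The exponent of the large jumps is bounded by twice their mass, so removing them affects the
integrability of \<open>exp (- levy_exponent)\<close> by a constant factor only.
\<close>

lemma cone_heat_kernel_bounds:
  assumes \<alpha>: "0 < \<alpha>" "\<alpha> < 2"
  obtains C where "C \<ge> 1"
    "\<And>x. Im (fourier_int (\<lambda>\<zeta>. complex_of_real (exp (- cone_exponent \<alpha> \<zeta>))) x) = 0"
    "\<And>x. heat_profile \<alpha> x / C \<le> Re (fourier_int (\<lambda>\<zeta>. complex_of_real (exp (- cone_exponent \<alpha> \<zeta>))) x)"
    "\<And>x. Re (fourier_int (\<lambda>\<zeta>. complex_of_real (exp (- cone_exponent \<alpha> \<zeta>))) x) \<le> C * heat_profile \<alpha> x"
proof -
  obtain c where c: "c > 0" and dec: "\<And>\<zeta>. levy_exponent (\<lambda>y. if \<bar>fst y + snd y\<bar> \<le> 1 then c * cone_density \<alpha> y else 0) \<zeta>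
        = cone_exponent \<alpha> \<zeta> - levy_exponent (large_jumps \<alpha> c) \<zeta>"
    using cone_levy_decomposition[OF \<alpha>] by blast
  define J1 where "J1 = (\<lambda>y. if \<bar>fst y + snd y\<bar> \<le> 1 then c * cone_density \<alpha> y else 0)"
  define J2 where "J2 = large_jumps \<alpha> c"
  have J2i: "integrable lborel J2" unfolding J2_def using c \<alpha> by (intro large_jumps_integrable) auto
  have J20: "J2 y \<ge> 0" for y unfolding J2_def using c by (intro large_jumps_nonneg) auto
  have J2e: "J2 (- y) = J2 y" for y
  proof -
    have "\<bar>- fst y - snd y\<bar> = \<bar>fst y + snd y\<bar>" by (simp add: abs_if)
    then show ?thesis by (simp add: J2_def large_jumps_def)
  qed
  define lam where "lam = integral\<^sup>L lborel J2"
  have dec': "levy_exponent J1 \<zeta> = cone_exponent \<alpha> \<zeta> - levy_exponent J2 \<zeta>" for \<zeta>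
    unfolding J1_def J2_def by (rule dec)
  have J1m [measurable]: "J1 \<in> borel_measurable borel" unfolding J1_def by measurable
  have E: "integrable lborel (\<lambda>\<zeta>. exp (- levy_exponent J1 \<zeta> / k))" if k: "k > 0" for k
  proof (rule Bochner_Integration.integrable_bound)
    show "integrable lborel (\<lambda>\<zeta>. exp (2 * lam / k) * exp (- (1 / k) * cone_exponent \<alpha> \<zeta>))"
      using k \<alpha> by (intro integrable_mult_right exp_cone_exponent_integrable) auto
    have "- levy_exponent J1 \<zeta> / k \<le> 2 * lam / k - 1 / k * cone_exponent \<alpha> \<zeta>" for \<zeta>
      using levy_exponent_le[OF J2i J20, of \<zeta>] k unfolding dec' lam_def by (simp add: field_simps)
    then show "AE \<zeta> in lborel. norm (exp (- levy_exponent J1 \<zeta> / k)) \<le> norm (exp (2 * lam / k) * exp (- (1 / k) * cone_exponent \<alpha> \<zeta>))"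
      by (simp flip: exp_add)
  qed measurable
  let ?F = "\<lambda>\<zeta>. complex_of_real (exp (- levy_exponent J1 \<zeta>))"
  obtain g A \<delta> \<kappa> where g: "\<And>x. fourier_int ?F x = complex_of_real (g x)"
    "\<And>x. 0 \<le> g x" "A > 0" "\<And>x. g x \<le> A * heat_profile \<alpha> x" "g \<in> borel_measurable borel"
    "\<delta> > 0" "\<kappa> > 0" "\<And>y. \<bar>fst y\<bar> \<le> \<delta> \<Longrightarrow> \<bar>snd y\<bar> \<le> \<delta> \<Longrightarrow> \<kappa> \<le> g y"
    using small_jumps_kernel[OF \<alpha> c, folded J1_def, OF E] by metis
  have IF: "integrable lborel ?F" using E[of 1] by (intro integrable_of_real) simp
  have gle: "g x \<le> A" for x
    by (rule order_trans[OF g(4)]) (use g(3) heat_profile_le_1[OF \<alpha>(1)] in \<open>simp add: mult_left_le\<close>)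
  obtain C1 where C1: "C1 \<ge> 0" "\<And>x. convol J2 (heat_profile \<alpha>) x \<le> C1 * heat_profile \<alpha> x"
    using convol_large_jumps_profile_le[of c \<alpha>] c \<alpha> unfolding J2_def by auto
  obtain C2 where C2: "C2 > 0" "\<And>x. C2 * heat_profile \<alpha> x \<le> (convol J2 ^^ 2) g x"
    using convol_convol_large_jumps_ge[OF c \<alpha>(1) g(6,7,5) g(2) gle g(8)] unfolding J2_def by auto
  define q where "q = (\<lambda>x. fourier_int (\<lambda>\<zeta>. complex_of_real (exp (- cone_exponent \<alpha> \<zeta>))) x)"
  have Q: "Im (q x) = 0 \<and> exp (- lam) * (C2 / 2) * heat_profile \<alpha> x \<le> Re (q x)
     \<and> Re (q x) \<le> exp (- lam) * (A * exp C1) * heat_profile \<alpha> x" for x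
  proof -
    obtain p where p: "p \<ge> 0" "(\<lambda>n. (convol J2 ^^ n) g x / fact n) sums p"
       "fourier_int (\<lambda>\<zeta>. exp (char_int J2 \<zeta>) * ?F \<zeta>) x = complex_of_real p"
      using compound_poisson_density[OF J2i J20 IF g(1)[symmetric] g(2)] by blast
    have "cis (x \<bullet> \<zeta>) * complex_of_real (exp (- cone_exponent \<alpha> \<zeta>))
        = complex_of_real (exp (- lam)) * (cis (x \<bullet> \<zeta>) * (exp (char_int J2 \<zeta>) * ?F \<zeta>))" for \<zeta>
    proof -
      have "exp (- cone_exponent \<alpha> \<zeta>) = exp (- lam) * (exp (lam - levy_exponent J2 \<zeta>) * exp (- levy_exponent J1 \<zeta>))"
        unfolding dec' by (simp flip: exp_add)
      then have "complex_of_real (exp (- cone_exponent \<alpha> \<zeta>)) = complex_of_real (exp (- lam)) * (exp (char_int J2 \<zeta>) * ?F \<zeta>)"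
        unfolding char_int_even[OF J2i J2e] lam_def[symmetric] exp_of_real by (simp only: of_real_mult)
      then show ?thesis by (simp only: mult_ac)
    qed
    then have "q x = complex_of_real (exp (- lam)) * fourier_int (\<lambda>\<zeta>. exp (char_int J2 \<zeta>) * ?F \<zeta>) x"
      unfolding q_def fourier_int_def by (simp only: integral_mult_right_zero)
    then have q: "q x = complex_of_real (exp (- lam) * p)" unfolding p(3) by simp
    have "p \<le> A * heat_profile \<alpha> x * exp C1"
    proof (rule sums_le[OF _ p(2)])
      show "(\<lambda>n. A * heat_profile \<alpha> x * (C1 ^ n / fact n)) sums (A * heat_profile \<alpha> x * exp C1)"
        using exp_converges[of C1] by (intro sums_mult) (simp add: divide_inverse mult.commute)
      fix n
      have "(convol J2 ^^ n) g x \<le> A * C1 ^ n * heat_profile \<alpha> x"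
        by (rule convol_power_le[OF J2i J20])
           (use C1 g less_imp_le[OF heat_profile_pos] heat_profile_le_1[OF \<alpha>(1)] in auto)
      then show "(convol J2 ^^ n) g x / fact n \<le> A * heat_profile \<alpha> x * (C1 ^ n / fact n)"
        by (simp add: divide_right_mono mult_ac)
    qed
    moreover have "(\<Sum>n\<in>{2}. (convol J2 ^^ n) g x / fact n) \<le> p"
      unfolding sums_unique[OF p(2)]
      by (rule sum_le_suminf) (use p(2) convol_power_nonneg[of J2 g, OF J20 g(2)] in \<open>auto simp: sums_iff\<close>)
    then have "C2 / 2 * heat_profile \<alpha> x \<le> p" using C2(2)[of x] by simp
    ultimately show ?thesis unfolding q by (simp add: mult_ac)
  qed
  define C where "C = max 1 (max (exp (- lam) * (A * exp C1)) (1 / (exp (- lam) * (C2 / 2))))"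
  have "heat_profile \<alpha> x / C \<le> Re (q x)" for x
  proof -
    have "1 / (exp (- lam) * (C2 / 2)) \<le> C" unfolding C_def by simp
    then have "1 / C \<le> exp (- lam) * (C2 / 2)"
      using C2(1) by (simp add: C_def field_simps)
    then have "1 / C * heat_profile \<alpha> x \<le> exp (- lam) * (C2 / 2) * heat_profile \<alpha> x"
      by (rule mult_right_mono) (rule less_imp_le[OF heat_profile_pos])
    also have "\<dots> \<le> Re (q x)" using Q by blast
    finally show ?thesis by simp
  qed
  moreover have "Re (q x) \<le> C * heat_profile \<alpha> x" for x
  proof -
    have "exp (- lam) * (A * exp C1) \<le> C" unfolding C_def by simp
    from mult_right_mono[OF this, of "heat_profile \<alpha> x"] show ?thesis
      using Q[of x] less_imp_le[OF heat_profile_pos, of \<alpha> x] by linarith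
  qed
  ultimately show ?thesis using Q by (intro that[of C]) (auto simp: C_def q_def)
qed

section \<open>Scaling to the Kolmogorov kernel\<close>

text \<open>
The substitution \<open>u = t * r\<close>; the factor \<open>t\<close> in front is absorbed as the \<open>\<alpha>\<close>-th power of
\<open>t powr (1 / \<alpha>)\<close>.
\<close>

lemma cone_exponent_kolmogorov:
  assumes \<alpha>: "\<alpha> > 0" and t: "t > 0"
  shows "(LINT u:{0..t}|lborel. \<bar>\<phi> + u * \<xi>\<bar> powr \<alpha>)
    = cone_exponent \<alpha> (t powr (1 / \<alpha>) * \<phi> + t * t powr (1 / \<alpha>) * \<xi>, t powr (1 / \<alpha>) * \<phi>)"
proof -
  let ?T = "t powr (1 / \<alpha>)"
  have T: "?T powr \<alpha> = t" "?T > 0" using \<alpha> t by (auto simp: powr_powr)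
  have "(LINT u:{0..t}|lborel. \<bar>\<phi> + u * \<xi>\<bar> powr \<alpha>)
     = \<bar>t\<bar> *\<^sub>R (LINT r|lborel. indicator {0..t} (0 + t * r) *\<^sub>R \<bar>\<phi> + (0 + t * r) * \<xi>\<bar> powr \<alpha>)"
    unfolding set_lebesgue_integral_def by (rule lborel_integral_real_affine) (use t in auto)
  also have "\<dots> = (LINT r|lborel. t * (indicator {0..t} (0 + t * r) *\<^sub>R \<bar>\<phi> + (0 + t * r) * \<xi>\<bar> powr \<alpha>))"
    using t by simp
  also have "\<dots> = (LINT r|lborel. indicator {0..1} r *\<^sub>R \<bar>r * (?T * \<phi> + t * ?T * \<xi>) + (1 - r) * (?T * \<phi>)\<bar> powr \<alpha>)"
  proof (rule Bochner_Integration.integral_cong[OF refl])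
    fix r :: real
    have "r * (?T * \<phi> + t * ?T * \<xi>) + (1 - r) * (?T * \<phi>) = ?T * (\<phi> + (0 + t * r) * \<xi>)"
      by (simp add: algebra_simps)
    then have "\<bar>r * (?T * \<phi> + t * ?T * \<xi>) + (1 - r) * (?T * \<phi>)\<bar> powr \<alpha> = t * \<bar>\<phi> + (0 + t * r) * \<xi>\<bar> powr \<alpha>"
      using T by (simp add: abs_mult powr_mult)
    moreover have "indicator {0..t} (0 + t * r) = (indicator {0..1} r :: real)"
      using t by (auto simp: indicator_def zero_le_mult_iff mult_le_cancel_left2)
    ultimately show "t * (indicator {0..t} (0 + t * r) *\<^sub>R \<bar>\<phi> + (0 + t * r) * \<xi>\<bar> powr \<alpha>)
      = indicator {0..1} r *\<^sub>R \<bar>r * (?T * \<phi> + t * ?T * \<xi>) + (1 - r) * (?T * \<phi>)\<bar> powr \<alpha>"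
      by simp
  qed
  finally show ?thesis by (simp add: cone_exponent_def set_lebesgue_integral_def)
qed

lemma kolmogorov_kernel_eq:
  fixes s t x v :: real
  assumes s: "s > 0" and t: "t > 0"
  defines "\<alpha> \<equiv> 2 * s"
  defines "X \<equiv> x / (t * t powr (1 / \<alpha>))" and "V \<equiv> v / t powr (1 / \<alpha>)"
  shows "kolmogorov_kernel s t x v = complex_of_real (1 / (2 * pi)\<^sup>2 * (1 / t powr (1 + 1 / s))) *
     fourier_int (\<lambda>\<zeta>. complex_of_real (exp (- cone_exponent \<alpha> \<zeta>))) (X, V - X)"
proof -
  let ?T = "t powr (1 / \<alpha>)"
  have \<alpha>: "\<alpha> > 0" using s by (simp add: \<alpha>_def)
  have T: "?T > 0" using t by simp
  define G where "G = (\<lambda>\<eta> \<psi>. cis ((X, V - X) \<bullet> (\<eta>, \<psi>)) * complex_of_real (exp (- cone_exponent \<alpha> (\<eta>, \<psi>))))"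
  have GI: "integrable (lborel \<Otimes>\<^sub>M lborel) (case_prod G)"
  proof -
    have "integrable lborel (\<lambda>\<zeta>. cis ((X, V - X) \<bullet> \<zeta>) * complex_of_real (exp (- cone_exponent \<alpha> \<zeta>)))"
      using exp_cone_exponent_integrable[OF _ \<alpha>, of 1] by (intro integrable_cis_mult integrable_of_real) simp
    moreover have "(\<lambda>\<zeta>. cis ((X, V - X) \<bullet> \<zeta>) * complex_of_real (exp (- cone_exponent \<alpha> \<zeta>))) = case_prod G"
      by (auto simp: G_def)
    ultimately show ?thesis by (simp only: lborel_prod)
  qed
  have H: "exp (\<i> * complex_of_real (x * \<xi> + v * \<phi>)) *
        complex_of_real (exp (- (LINT u:{0..t}|lborel. \<bar>\<phi> + u * \<xi>\<bar> powr (2 * s))))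
      = G (?T * \<phi> + (t * ?T) * \<xi>) (0 + ?T * \<phi>)" for \<xi> \<phi>
  proof -
    have "(X, V - X) \<bullet> (?T * \<phi> + (t * ?T) * \<xi>, 0 + ?T * \<phi>) = X * (t * ?T) * \<xi> + (V * ?T) * \<phi>"
      by (simp add: inner_Pair algebra_simps)
    also have "X * (t * ?T) = x" using t T by (simp add: X_def)
    also have "V * ?T = v" using t T by (simp add: V_def)
    finally show ?thesis
      unfolding G_def cone_exponent_kolmogorov[OF \<alpha> t, unfolded \<alpha>_def, folded \<alpha>_def]
      using cone_exponent_kolmogorov[OF \<alpha> t, of \<phi> \<xi>] by (simp add: \<alpha>_def cis_conv_exp)
  qed
  have inner: "(LINT \<xi>|lborel. G (?T * \<phi> + (t * ?T) * \<xi>) (0 + ?T * \<phi>))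
      = complex_of_real (1 / (t * ?T)) * (LINT \<eta>|lborel. G \<eta> (0 + ?T * \<phi>))" for \<phi>
  proof -
    have "(LINT \<eta>|lborel. G \<eta> (0 + ?T * \<phi>)) = \<bar>t * ?T\<bar> *\<^sub>R (LINT \<xi>|lborel. G (?T * \<phi> + (t * ?T) * \<xi>) (0 + ?T * \<phi>))"
      by (rule lborel_integral_real_affine) (use t T in auto)
    then show ?thesis using t T by (simp add: scaleR_conv_of_real)
  qed
  have outer: "(LINT \<psi>|lborel. LINT \<eta>|lborel. G \<eta> \<psi>) = complex_of_real ?T * (LINT \<phi>|lborel. LINT \<eta>|lborel. G \<eta> (0 + ?T * \<phi>))"
  proof -
    have "(LINT \<psi>|lborel. LINT \<eta>|lborel. G \<eta> \<psi>) = \<bar>?T\<bar> *\<^sub>R (LINT \<phi>|lborel. LINT \<eta>|lborel. G \<eta> (0 + ?T * \<phi>))"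
      by (rule lborel_integral_real_affine) (use T in auto)
    then show ?thesis using T by (simp add: scaleR_conv_of_real)
  qed
  have TT: "t * ?T * ?T = t powr (1 + 1 / s)"
  proof -
    have "t * ?T * ?T = t powr 1 * t powr (1 / \<alpha>) * t powr (1 / \<alpha>)" using t by simp
    also have "\<dots> = t powr (1 + 1 / \<alpha> + 1 / \<alpha>)" by (simp only: powr_add)
    also have "1 + 1 / \<alpha> + 1 / \<alpha> = 1 + 1 / s" using s by (simp add: \<alpha>_def field_simps)
    finally show ?thesis .
  qed
  have "kolmogorov_kernel s t x v = complex_of_real (1 / (2 * pi)\<^sup>2) *
      (LINT \<phi>|lborel. complex_of_real (1 / (t * ?T)) * (LINT \<eta>|lborel. G \<eta> (0 + ?T * \<phi>)))"
    unfolding kolmogorov_kernel_def H inner ..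
  also have "\<dots> = complex_of_real (1 / (2 * pi)\<^sup>2) * (complex_of_real (1 / (t * ?T)) * (LINT \<phi>|lborel. LINT \<eta>|lborel. G \<eta> (0 + ?T * \<phi>)))"
    by (simp only: integral_mult_right_zero)
  also have "(LINT \<phi>|lborel. LINT \<eta>|lborel. G \<eta> (0 + ?T * \<phi>)) = complex_of_real (1 / ?T) * (LINT \<psi>|lborel. LINT \<eta>|lborel. G \<eta> \<psi>)"
    unfolding outer using T by simp
  also have "(LINT \<psi>|lborel. LINT \<eta>|lborel. G \<eta> \<psi>) = integral\<^sup>L (lborel \<Otimes>\<^sub>M lborel) (case_prod G)"
    by (rule lborel_pair.integral_snd[OF GI])
  also have "\<dots> = fourier_int (\<lambda>\<zeta>. complex_of_real (exp (- cone_exponent \<alpha> \<zeta>))) (X, V - X)"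
    unfolding fourier_int_def lborel_prod by (rule Bochner_Integration.integral_cong) (auto simp: G_def)
  finally show ?thesis unfolding TT[symmetric] by simp
qed

text \<open>
The real number \<open>1 \<and> r\<^sup>-\<^sup>p\<close> with the convention \<open>1 / 0 = \<infinity>\<close>, which the profile uses for its quotients.
\<close>

definition inv_powr_cap :: "real \<Rightarrow> real \<Rightarrow> real" where
  "inv_powr_cap p r = (if r = 0 then 1 else min 1 (r powr (- p)))"

lemma inv_powr_cap_nonneg: "0 \<le> inv_powr_cap p r"
  by (simp add: inv_powr_cap_def)

lemma inv_powr_cap_bounds:
  assumes "p > 0" "r \<ge> 0"
  shows "(1 + r) powr (- p) \<le> inv_powr_cap p r" "inv_powr_cap p r \<le> 2 powr p * (1 + r) powr (- p)"
proof -
  have "(1 + r) powr (- p) \<le> 1 powr (- p)" using assms by (intro powr_mono2') auto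
  moreover have "(1 + r) powr (- p) \<le> r powr (- p)" if "r \<noteq> 0" using assms that by (intro powr_mono2') auto
  ultimately show "(1 + r) powr (- p) \<le> inv_powr_cap p r" by (auto simp: inv_powr_cap_def)
  show "inv_powr_cap p r \<le> 2 powr p * (1 + r) powr (- p)"
  proof (cases "r \<le> 1")
    case True
    have "1 powr (- p) \<le> 2 powr p * (1 + r) powr (- p)" using True assms by (intro powr_neg_le_scale) auto
    then show ?thesis by (auto simp: inv_powr_cap_def)
  next
    case False
    have "r powr (- p) \<le> 2 powr p * (1 + r) powr (- p)" using False assms by (intro powr_neg_le_scale) auto
    then show ?thesis using False by (auto simp: inv_powr_cap_def)
  qed
qed

lemma ereal_min_divide:
  fixes a b d :: real
  assumes "b > 0" "d \<ge> 0"
  shows "min (ereal a) (ereal b / ereal d) = ereal (if d = 0 then a else min a (b / d))"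
  using assms by (auto simp: min_def ereal_divide)

lemma kolmogorov_profile_eq:
  fixes s t x v :: real
  assumes s: "s > 0" and t: "t > 0"
  defines "\<alpha> \<equiv> 2 * s"
  defines "X \<equiv> x / (t * t powr (1 / \<alpha>))" and "V \<equiv> v / t powr (1 / \<alpha>)"
  shows "kolmogorov_profile s t x v = ereal (1 / t powr (1 + 1 / s) *
     (inv_powr_cap (2 + \<alpha>) (norm (X - V / 2, V)) * inv_powr_cap \<alpha> (gap (X, V - X))))"
proof -
  let ?T = "t powr (1 / \<alpha>)"
  define S where "S = t * ?T"
  have \<alpha>: "\<alpha> > 0" using s by (simp add: \<alpha>_def)
  have T: "?T > 0" using t by simp
  have S: "S > 0" using T t by (simp add: S_def)
  have Ta: "?T powr \<alpha> = t" using \<alpha> t by (simp add: powr_powr)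
  define n where "n = norm (X - V / 2, V)"
  define m where "m = gap (X, V - X)"
  have n0: "n \<ge> 0" and m0: "m \<ge> 0" by (simp_all add: n_def m_def)
  have xv: "x - t * v / 2 = S * (X - V / 2)" "t * v / 2 = S * (V / 2)" "t * v = S * V"
    using t T by (simp_all add: S_def X_def V_def field_simps)
  have "norm (x - t * v / 2, t * v) = norm (S *\<^sub>R (X - V / 2, V))"
    using arg_cong2[OF xv(1,3), of "\<lambda>a b. norm (a, b)"] by simp
  also have "\<dots> = S * n" using S unfolding n_def by (simp only: norm_scaleR abs_of_pos)
  finally have N: "norm (x - t * v / 2, t * v) = S * n" .
  have m_eq: "m = max (\<bar>X - V / 2\<bar> - \<bar>V / 2\<bar>) 0"
    unfolding m_def gap_def by (simp add: max_def abs_if field_simps)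
  have "max (\<bar>x - t * v / 2\<bar> - \<bar>t * v / 2\<bar>) 0 = max (S * (\<bar>X - V / 2\<bar> - \<bar>V / 2\<bar>)) (S * 0)"
  proof -
    have a: "\<bar>S * r\<bar> = S * \<bar>r\<bar>" for r using S by (simp only: abs_mult abs_of_pos)
    have "max (\<bar>x - t * v / 2\<bar> - \<bar>t * v / 2\<bar>) 0 = max (S * \<bar>X - V / 2\<bar> - S * \<bar>V / 2\<bar>) 0"
      using arg_cong2[OF xv(1,2), of "\<lambda>a b. max (\<bar>a\<bar> - \<bar>b\<bar>) 0"] by (simp only: a)
    then show ?thesis by (simp only: right_diff_distrib[of S "\<bar>X - V / 2\<bar>"] mult_zero_right)
  qed
  also have "\<dots> = S * m" unfolding m_eq using S by (simp only: max_mult_distrib_left) simp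
  finally have M: "max (\<bar>x - t * v / 2\<bar> - \<bar>t * v / 2\<bar>) 0 = S * m" .
  have e1: "t powr (1 + 1 / s) > 0" using t by simp
  have f1: "t powr (2 + \<alpha>) / (S * n) powr (2 + \<alpha>) = 1 / t powr (1 + 1 / s) * n powr (- (2 + \<alpha>))"
  proof -
    have "?T powr (2 + \<alpha>) = t powr (1 + 1 / s)"
    proof -
      have "1 / \<alpha> * (2 + \<alpha>) = 1 + 1 / s" using s by (simp add: \<alpha>_def field_simps)
      then show ?thesis by (simp only: powr_powr)
    qed
    then show ?thesis
      using t unfolding S_def powr_mult powr_minus[of n "2 + \<alpha>"] by (simp add: field_simps)
  qed
  have f2: "t powr (1 + \<alpha>) / (S * m) powr \<alpha> = m powr (- \<alpha>)"
  proof -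
    have "t powr (1 + \<alpha>) = t * t powr \<alpha>" using t by (simp add: powr_add)
    then show ?thesis
      using t Ta unfolding S_def powr_mult by (simp add: powr_minus field_simps)
  qed
  have A: "min (1 / ereal (t powr (1 + 1 / s))) (ereal (t powr (2 + 2 * s)) / ereal (norm (x - t * v / 2, t * v) powr (2 + 2 * s)))
     = ereal (1 / t powr (1 + 1 / s) * inv_powr_cap (2 + \<alpha>) n)"
  proof -
    have "min (1 / ereal (t powr (1 + 1 / s))) (ereal (t powr (2 + \<alpha>)) / ereal ((S * n) powr (2 + \<alpha>)))
       = min (ereal (1 / t powr (1 + 1 / s))) (ereal (t powr (2 + \<alpha>)) / ereal ((S * n) powr (2 + \<alpha>)))"
      using e1 by (simp add: one_ereal_def)
    also have "\<dots> = ereal (if (S * n) powr (2 + \<alpha>) = 0 then 1 / t powr (1 + 1 / s)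
         else min (1 / t powr (1 + 1 / s)) (t powr (2 + \<alpha>) / (S * n) powr (2 + \<alpha>)))"
      by (rule ereal_min_divide) (use t in auto)
    also have "\<dots> = ereal (1 / t powr (1 + 1 / s) * inv_powr_cap (2 + \<alpha>) n)"
      unfolding f1 inv_powr_cap_def using S e1 by (auto simp: min_def field_simps)
    finally show ?thesis unfolding N \<alpha>_def .
  qed
  have B: "min 1 (ereal (t powr (1 + 2 * s)) / ereal (max (\<bar>x - t * v / 2\<bar> - \<bar>t * v / 2\<bar>) 0 powr (2 * s)))
     = ereal (inv_powr_cap \<alpha> m)"
  proof -
    have "min 1 (ereal (t powr (1 + \<alpha>)) / ereal ((S * m) powr \<alpha>))
       = ereal (if (S * m) powr \<alpha> = 0 then 1 else min 1 (t powr (1 + \<alpha>) / (S * m) powr \<alpha>))"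
      unfolding one_ereal_def by (rule ereal_min_divide) (use t in auto)
    also have "\<dots> = ereal (inv_powr_cap \<alpha> m)"
      unfolding f2 inv_powr_cap_def using S by auto
    finally show ?thesis unfolding M \<alpha>_def .
  qed
  show ?thesis
    unfolding kolmogorov_profile_def A B n_def[symmetric] m_def[symmetric] by (simp add: mult.assoc)
qed

lemma profile_comparison:
  assumes \<alpha>: "\<alpha> > 0"
  defines "P \<equiv> \<lambda>X V. inv_powr_cap (2 + \<alpha>) (norm (X - V / 2, V)) * inv_powr_cap \<alpha> (gap (X, V - X))"
    and "B \<equiv> 6 powr (2 + \<alpha>) * 2 powr \<alpha>"
  shows "P X V \<le> B * heat_profile \<alpha> (X, V - X)" "heat_profile \<alpha> (X, V - X) \<le> B * P X V"
proof -
  let ?n = "norm (X - V / 2, V)" and ?l = "l1norm (X, V - X)" and ?m = "gap (X, V - X)"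
  let ?p = "2 + \<alpha>"
  have p: "- 2 - \<alpha> = - ?p" by simp
  have "?l \<le> 2 * \<bar>X - V / 2\<bar> + \<bar>V\<bar>" unfolding l1norm_def by (simp add: abs_if)
  also have "\<dots> \<le> 2 * ?n + ?n"
    using norm_fst_le[of "X - V / 2" V] norm_snd_le[of V "X - V / 2"] by simp
  finally have l1: "1 + ?l \<le> 3 * (1 + ?n)" by simp
  have "?n \<le> \<bar>X - V / 2\<bar> + \<bar>V\<bar>" using sqrt_sum_squares_le_sum_abs[of "X - V / 2" V] by (simp add: norm_prod_def)
  also have "\<dots> \<le> 2 * ?l" unfolding l1norm_def by (simp add: abs_if)
  finally have l2: "1 + ?n \<le> 2 * (1 + ?l)" by simp
  have n1: "(1 + ?n) powr (- ?p) \<le> 3 powr ?p * (1 + ?l) powr (- ?p)"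
    using l1 \<alpha> by (intro powr_neg_le_scale) auto
  have n2: "(1 + ?l) powr (- ?p) \<le> 2 powr ?p * (1 + ?n) powr (- ?p)"
    using l2 \<alpha> by (intro powr_neg_le_scale) (auto intro: add_pos_nonneg)
  note c = inv_powr_cap_bounds[of ?p ?n] inv_powr_cap_bounds[of \<alpha> ?m]
  have "P X V \<le> (2 powr ?p * (3 powr ?p * (1 + ?l) powr (- ?p))) * (2 powr \<alpha> * (1 + ?m) powr (- \<alpha>))"
    unfolding P_def
    by (intro mult_mono order_trans[OF c(2)] mult_left_mono[OF n1] c(4)) (use \<alpha> inv_powr_cap_nonneg in auto)
  also have "\<dots> = (2 powr ?p * 3 powr ?p) * 2 powr \<alpha> * heat_profile \<alpha> (X, V - X)"
    unfolding heat_profile_def p by (simp only: mult_ac)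
  also have "2 powr ?p * 3 powr ?p = 6 powr ?p" by (simp flip: powr_mult)
  finally show "P X V \<le> B * heat_profile \<alpha> (X, V - X)" unfolding B_def .
  have "heat_profile \<alpha> (X, V - X) \<le> (2 powr ?p * inv_powr_cap ?p ?n) * inv_powr_cap \<alpha> ?m"
    unfolding heat_profile_def p
    by (intro mult_mono order_trans[OF n2] mult_left_mono[OF c(1)] c(3)) (use \<alpha> inv_powr_cap_nonneg in auto)
  also have "\<dots> = 2 powr ?p * 1 * P X V" unfolding P_def by (simp only: mult_ac mult_1_right)
  also have "\<dots> \<le> B * P X V"
    unfolding B_def P_def using \<alpha>
    by (intro mult_right_mono mult_mono powr_mono2) (auto simp: inv_powr_cap_nonneg ge_one_powr_ge_zero)
  finally show "heat_profile \<alpha> (X, V - X) \<le> B * P X V" .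
qed

theorem corollary1p2:
  fixes s :: real
  assumes "0 < s" and "s < 1"
  shows "\<exists>C::real. C \<ge> 1 \<and> (\<forall>t x v :: real. t > 0 \<longrightarrow>
           kolmogorov_kernel s t x v \<in> \<real> \<and>
           ereal (inverse C) * kolmogorov_profile s t x v \<le> ereal (Re (kolmogorov_kernel s t x v)) \<and>
           ereal (Re (kolmogorov_kernel s t x v)) \<le> ereal C * kolmogorov_profile s t x v)"
proof -
  define \<alpha> where "\<alpha> = 2 * s"
  have \<alpha>: "0 < \<alpha>" "\<alpha> < 2" using assms by (auto simp: \<alpha>_def)
  define q where "q = fourier_int (\<lambda>\<zeta>::real \<times> real. complex_of_real (exp (- cone_exponent \<alpha> \<zeta>)))"
  obtain C where C: "C \<ge> 1" "\<And>x. Im (q x) = 0" "\<And>x. heat_profile \<alpha> x / C \<le> Re (q x)" "\<And>x. Re (q x) \<le> C * heat_profile \<alpha> x"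
    unfolding q_def using cone_heat_kernel_bounds[OF \<alpha>] by metis
  define B where "B = 6 powr (2 + \<alpha>) * 2 powr \<alpha>"
  define D where "D = (2 * pi)\<^sup>2"
  have B: "B \<ge> 1" unfolding B_def using \<alpha> mult_mono[of 1 "6 powr (2 + \<alpha>)" 1 "2 powr \<alpha>"] by (simp add: ge_one_powr_ge_zero)
  have D: "D \<ge> 1" unfolding D_def using pi_gt3 by (intro one_le_power) simp
  have CDB: "C * D * B \<ge> 1" using C(1) D B mult_mono[of 1 "C * D" 1 B] mult_mono[of 1 C 1 D] by simp
  have "kolmogorov_kernel s t x v \<in> \<real> \<and>
           ereal (inverse (C * D * B)) * kolmogorov_profile s t x v \<le> ereal (Re (kolmogorov_kernel s t x v)) \<and>
           ereal (Re (kolmogorov_kernel s t x v)) \<le> ereal (C * D * B) * kolmogorov_profile s t x v"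
    if t: "t > 0" for t x v
  proof -
    define X where "X = x / (t * t powr (1 / \<alpha>))"
    define V where "V = v / t powr (1 / \<alpha>)"
    define \<tau> where "\<tau> = 1 / t powr (1 + 1 / s)"
    have \<tau>: "\<tau> > 0" using t by (simp add: \<tau>_def)
    let ?q = "Re (q (X, V - X))" and ?h = "heat_profile \<alpha> (X, V - X)"
    define P where "P = inv_powr_cap (2 + \<alpha>) (norm (X - V / 2, V)) * inv_powr_cap \<alpha> (gap (X, V - X))"
    have "q (X, V - X) = complex_of_real ?q" using C(2)[of "(X, V - X)"] by (simp add: complex_eq_iff)
    then have k: "kolmogorov_kernel s t x v = complex_of_real (\<tau> * ?q / D)"
      using kolmogorov_kernel_eq[OF assms(1) t, of x v]
      unfolding \<alpha>_def[symmetric] X_def[symmetric] V_def[symmetric] q_def[symmetric] \<tau>_def[symmetric] D_def[symmetric]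
      by simp
    have pr: "kolmogorov_profile s t x v = ereal (\<tau> * P)"
      using kolmogorov_profile_eq[OF assms(1) t, of x v]
      unfolding \<alpha>_def[symmetric] X_def[symmetric] V_def[symmetric] \<tau>_def[symmetric] P_def .
    have P: "P \<le> B * ?h" "?h \<le> B * P"
      unfolding P_def B_def by (rule profile_comparison[OF \<alpha>(1)])+
    have h0: "?h > 0" by (rule heat_profile_pos)
    have P0: "P \<ge> 0" unfolding P_def by (intro mult_nonneg_nonneg inv_powr_cap_nonneg)
    have "inverse (C * D * B) * (\<tau> * P) \<le> inverse (C * D * B) * (\<tau> * (B * ?h))"
      using \<tau> P(1) iffD2[OF inverse_nonnegative_iff_nonnegative, of "C * D * B"] CDB
      by (intro mult_left_mono) linarith+
    also have "\<dots> = \<tau> * (?h / C) / D" using B by (simp add: field_simps)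
    also have "\<dots> \<le> \<tau> * ?q / D" using \<tau> D C(3) by (intro divide_right_mono mult_left_mono) auto
    finally have lower: "inverse (C * D * B) * (\<tau> * P) \<le> \<tau> * ?q / D" .
    have "\<tau> * ?q / D \<le> \<tau> * (C * (B * P)) / D"
      using \<tau> D C(1) P by (intro divide_right_mono mult_left_mono order_trans[OF C(4)]) auto
    also have "\<dots> \<le> \<tau> * (C * (B * P)) * D"
      using \<tau> D C(1) B P0 mult_mono[of "inverse D" D "\<tau> * (C * (B * P))" "\<tau> * (C * (B * P))"] inverse_le_1_iff[of D]
      by (simp add: divide_inverse mult.commute)
    finally have upper: "\<tau> * ?q / D \<le> C * D * B * (\<tau> * P)" by (simp add: mult_ac)
    show ?thesis using lower upper unfolding k pr by simp
  qed
  with CDB show ?thesis by blast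
qed

end
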